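(* Let $k\in\mathbb{N}$. Then: (1) on $C^{k+1}({\bf A})$, $\mathcal{F}_k\circ\psi_0=\mathcal{A}\circ\psi_0\wedge[\mathcal{A}]^\times_{k+1}$; (2) for $f\in L^\infty({\bf A})$, $\|f\|_{U_{k+1}}=0$ if and only if $\mathbb{E}(f|\mathcal{F}_k)=0$; (3) $U_{k+1}$ is a norm on $L^\infty(\mathcal{F}_k)$; (4) $\mathcal{F}_k$ is shift invariant; (5) on $C^{k+1}({\bf A})$, $\mathcal{F}_k\circ\psi_0=\mathcal{A}\circ\psi_0\wedge[\mathcal{F}_k]^\times_{k+1}$; (6) $\mathcal{F}_0$ is the trivial σ-algebra and $\mathcal{F}_0\subseteq\mathcal{F}_1\subseteq\mathcal{F}_2\subseteq\cdots$.
   Context: ${\bf A}=\prod_\omega A_i$ is an ultraproduct of compact (Hausdorff, second countable) abelian groups over a non-principal ultrafilter $\omega$ with $\{i:|A_i|>n\}\in\omega$ for all $n$; $\mathcal{A}$ is the σ-algebra generated by ultraproducts of open sets, with measure the ultralimit of Haar measures. $C^n({\bf A})=\prod_\omega C^n(A_i)$ where $C^n(A_i)$ is the set of maps $c:\{0,1\}^n\to A_i$, $c(v)=x+\sum_jv_jt_j$, with Haar measure on $A_i^{n+1}$; $C^n_x({\bf A})$ is the subset with $c(0)=x$, with the ultralimit Haar measure in the $t_j$. $\psi_v:C^n({\bf A})\to{\bf A}$, $\psi_v(c)=c(v)$. For a σ-algebra $\mathcal{B}$ on ${\bf A}$, $\mathcal{B}\circ\psi_v=\{\psi_v^{-1}(S):S\in\mathcal{B}\}$,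 $[\mathcal{B}]^\times_n=\bigvee_{v\in K_n}\mathcal{B}\circ\psi_v$ on $C^n({\bf A})$, where $K_n=\{0,1\}^n\setminus\{0\}$; $\vee$ is the generated σ-algebra and $\mathcal{B}\wedge\mathcal{C}$ is the family of sets that agree up to null sets with a member of $\mathcal{B}$ and with a member of $\mathcal{C}$. Gowers norm: $\|f\|_{U_k}^{2^k}=\int_{C^k({\bf A})}\prod_v\mathcal{C}^{|v|}f(c(v))$ ($\mathcal{C}$ conjugation). For bounded measurable $F=\{f_v\}_{v\in K_n}$, $[F](x)=\int_{C^n_x({\bf A})}\prod_{v\in K_n}\mathcal{C}^{|v|}f_v(c(v))$. $\mathcal{F}_k$ is the σ-algebra generated by all $[F]$ with $n=k+1$. Shift invariant: $S\in\mathcal{B}$ implies $S+t\in\mathcal{B}$ for all $t\in{\bf A}$.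
   Formalization: In (1) and (5) equality of σ-algebras is read up to null sets: literal equality fails because ∧ as defined contains all null sets of C^{k+1}(A), e.g. ψ_v^{-1}({a}) with v≠0, which is not of the form ψ_0^{-1}(S). *)

theory Defs
  imports "HOL-Analysis.Analysis" "HOL-Probability.Conditional_Expectation"
    "HOL-Algebra.FiniteProduct"
begin

section \<open>Compact abelian groups and Haar measure\<close>

definition compact_abelian_group :: "'a monoid \<Rightarrow> 'a topology \<Rightarrow> bool" where
  "compact_abelian_group G T \<longleftrightarrow>
     comm_group G \<and> topspace T = carrier G \<and>
     compact_space T \<and> Hausdorff_space T \<and> second_countable T \<and>
     continuous_map (prod_topology T T) T (\<lambda>(x, y). x \<otimes>\<^bsub>G\<^esub> y) \<and>
     continuous_map T T (\<lambda>x. inv\<^bsub>G\<^esub> x)"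

definition borel_of :: "'a topology \<Rightarrow> 'a measure" where
  "borel_of T = sigma (topspace T) {U. openin T U}"

text \<open>Regularity need not be required: on a compact Hausdorff second countable space every
  finite Borel measure is regular.\<close>

definition haar_prob :: "'a monoid \<Rightarrow> 'a topology \<Rightarrow> 'a measure \<Rightarrow> bool" where
  "haar_prob G T \<mu> \<longleftrightarrow>
     prob_space \<mu> \<and> space \<mu> = topspace T \<and> sets \<mu> = sets (borel_of T) \<and>
     (\<forall>a\<in>carrier G. \<forall>S\<in>sets \<mu>. emeasure \<mu> ((\<lambda>x. a \<otimes>\<^bsub>G\<^esub> x) ` S) = emeasure \<mu> S)"

section \<open>Cubes in a compact abelian group\<close>

text \<open>A vertex of \<open>{0,1}\<^sup>n\<close> is represented by its support, a subset of \<open>{..<n}\<close>, so that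
  \<open>|v| = card v\<close> and the vertex 0 is the empty set. Groups are written multiplicatively, as in
  HOL-Algebra, so \<open>x + \<Sum>\<^sub>j v\<^sub>j t\<^sub>j\<close> is \<open>x\<close> times the product of \<open>t j\<close> over \<open>j \<in> v\<close>.\<close>

definition verts :: "nat \<Rightarrow> nat set set" where
  "verts n = Pow {..<n}"

definition K :: "nat \<Rightarrow> nat set set" where
  "K n = verts n - {{}}"

definition cube :: "'a monoid \<Rightarrow> nat \<Rightarrow> 'a \<Rightarrow> (nat \<Rightarrow> 'a) \<Rightarrow> (nat set \<Rightarrow> 'a)" where
  "cube G n x t = (\<lambda>v\<in>verts n. x \<otimes>\<^bsub>G\<^esub> finprod G t v)"

definition cubes :: "'a monoid \<Rightarrow> nat \<Rightarrow> (nat set \<Rightarrow> 'a) set" where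
  "cubes G n = {cube G n x t | x t. x \<in> carrier G \<and> t \<in> {..<n} \<rightarrow>\<^sub>E carrier G}"

definition cubes_at :: "'a monoid \<Rightarrow> nat \<Rightarrow> 'a \<Rightarrow> (nat set \<Rightarrow> 'a) set" where
  "cubes_at G n x = {c \<in> cubes G n. c {} = x}"

text \<open>The subspace topology from \<open>A\<close> to the power \<open>{0,1}\<^sup>n\<close>; it agrees with the topology of
  \<open>A\<^sup>n\<^sup>+\<^sup>1\<close> transported along \<open>(x, t) \<mapsto> cube G n x t\<close>.\<close>

definition cube_top :: "'a monoid \<Rightarrow> 'a topology \<Rightarrow> nat \<Rightarrow> (nat set \<Rightarrow> 'a) topology" where
  "cube_top G T n = subtopology (product_topology (\<lambda>_. T) (verts n)) (cubes G n)"

definition cube_at_top ::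
    "'a monoid \<Rightarrow> 'a topology \<Rightarrow> nat \<Rightarrow> 'a \<Rightarrow> (nat set \<Rightarrow> 'a) topology" where
  "cube_at_top G T n x = subtopology (product_topology (\<lambda>_. T) (verts n)) (cubes_at G n x)"

text \<open>The Haar measure of \<open>A\<^sup>n\<^sup>+\<^sup>1\<close> (respectively \<open>A\<^sup>n\<close>) is the product of Haar measures; by second
  countability the product \<open>\<sigma>\<close>-algebra is the Borel \<open>\<sigma>\<close>-algebra.\<close>

definition cube_haar ::
    "'a monoid \<Rightarrow> 'a topology \<Rightarrow> 'a measure \<Rightarrow> nat \<Rightarrow> (nat set \<Rightarrow> 'a) measure" where
  "cube_haar G T \<mu> n =
     distr (\<mu> \<Otimes>\<^sub>M PiM {..<n} (\<lambda>_. \<mu>)) (borel_of (cube_top G T n)) (\<lambda>(x, t). cube G n x t)"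

definition cube_at_haar ::
    "'a monoid \<Rightarrow> 'a topology \<Rightarrow> 'a measure \<Rightarrow> nat \<Rightarrow> 'a \<Rightarrow> (nat set \<Rightarrow> 'a) measure" where
  "cube_at_haar G T \<mu> n x =
     distr (PiM {..<n} (\<lambda>_. \<mu>)) (borel_of (cube_at_top G T n x)) (\<lambda>t. cube G n x t)"

section \<open>Ultraproducts\<close>

definition nonprincipal_ultrafilter :: "nat filter \<Rightarrow> bool" where
  "nonprincipal_ultrafilter \<omega> \<longleftrightarrow>
     \<omega> \<noteq> bot \<and>
     (\<forall>P. eventually P \<omega> \<or> eventually (\<lambda>i. \<not> P i) \<omega>) \<and>
     (\<forall>n. \<not> eventually (\<lambda>i. i = n) \<omega>)"

text \<open>Points of an ultraproduct are classes of sequences modulo equality \<open>\<omega>\<close>-almost everywhere.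
  The classes are formed among all sequences of the ambient type, not only those with values in
  the factors; hence the ultraproduct of subsets is literally a subset of the ultraproduct.\<close>

type_synonym 'a upoint = "(nat \<Rightarrow> 'a) set"

definition uclass :: "nat filter \<Rightarrow> (nat \<Rightarrow> 'a) \<Rightarrow> 'a upoint" where
  "uclass \<omega> f = {g. eventually (\<lambda>i. g i = f i) \<omega>}"

definition urep :: "'a upoint \<Rightarrow> nat \<Rightarrow> 'a" where
  "urep x = (SOME f. f \<in> x)"

definition uprod :: "nat filter \<Rightarrow> (nat \<Rightarrow> 'a set) \<Rightarrow> 'a upoint set" where
  "uprod \<omega> X = {uclass \<omega> f | f. eventually (\<lambda>i. f i \<in> X i) \<omega>}"

text \<open>The \<open>\<sigma>\<close>-algebra generated by ultraproducts of open sets, with the measure that takes the value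
  \<open>lim\<^sub>\<omega> \<mu>\<^sub>i(U\<^sub>i)\<close> on the ultraproduct of open sets \<open>U\<^sub>i\<close>. These sets are closed under
  intersection, so the measure is determined by these values.\<close>

definition ultra_measure ::
    "nat filter \<Rightarrow> (nat \<Rightarrow> 'a topology) \<Rightarrow> (nat \<Rightarrow> 'a measure) \<Rightarrow> 'a upoint measure" where
  "ultra_measure \<omega> T \<mu> =
     extend_measure (uprod \<omega> (\<lambda>i. topspace (T i)))
       {U. eventually (\<lambda>i. openin (T i) (U i)) \<omega>}
       (uprod \<omega>)
       (\<lambda>U. Lim \<omega> (\<lambda>i. emeasure (\<mu> i) (U i)))"

text \<open>\<open>\<A>\<close> on \<open>\<^bold>A\<close>, and the probability spaces \<open>C\<^sup>n(\<^bold>A)\<close> and \<open>C\<^sup>n\<^sub>x(\<^bold>A)\<close>. As a set, the space of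
  \<open>Cube_at \<dots> n x\<close> is \<open>{c \<in> C\<^sup>n(\<^bold>A). \<psi>\<^sub>0(c) = x}\<close>; it does not depend on the representative of \<open>x\<close>.\<close>

definition UA ::
    "nat filter \<Rightarrow> (nat \<Rightarrow> 'a topology) \<Rightarrow> (nat \<Rightarrow> 'a measure) \<Rightarrow> 'a upoint measure" where
  "UA \<omega> T \<mu> = ultra_measure \<omega> T \<mu>"

definition Cube ::
    "nat filter \<Rightarrow> (nat \<Rightarrow> 'a monoid) \<Rightarrow> (nat \<Rightarrow> 'a topology) \<Rightarrow> (nat \<Rightarrow> 'a measure) \<Rightarrow> nat
      \<Rightarrow> (nat set \<Rightarrow> 'a) upoint measure" where
  "Cube \<omega> G T \<mu> n =
     ultra_measure \<omega> (\<lambda>i. cube_top (G i) (T i) n) (\<lambda>i. cube_haar (G i) (T i) (\<mu> i) n)"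

definition Cube_at ::
    "nat filter \<Rightarrow> (nat \<Rightarrow> 'a monoid) \<Rightarrow> (nat \<Rightarrow> 'a topology) \<Rightarrow> (nat \<Rightarrow> 'a measure) \<Rightarrow> nat
      \<Rightarrow> 'a upoint \<Rightarrow> (nat set \<Rightarrow> 'a) upoint measure" where
  "Cube_at \<omega> G T \<mu> n x =
     ultra_measure \<omega> (\<lambda>i. cube_at_top (G i) (T i) n (urep x i))
       (\<lambda>i. cube_at_haar (G i) (T i) (\<mu> i) n (urep x i))"

definition psi :: "nat filter \<Rightarrow> nat set \<Rightarrow> (nat set \<Rightarrow> 'a) upoint \<Rightarrow> 'a upoint" where
  "psi \<omega> v c = uclass \<omega> (\<lambda>i. urep c i v)"

text \<open>The group operation of \<open>\<^bold>A\<close>.\<close>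

definition uadd ::
    "nat filter \<Rightarrow> (nat \<Rightarrow> 'a monoid) \<Rightarrow> 'a upoint \<Rightarrow> 'a upoint \<Rightarrow> 'a upoint" where
  "uadd \<omega> G x t = uclass \<omega> (\<lambda>i. urep x i \<otimes>\<^bsub>G i\<^esub> urep t i)"

definition shift_invariant ::
    "nat filter \<Rightarrow> (nat \<Rightarrow> 'a monoid) \<Rightarrow> 'a upoint set set \<Rightarrow> bool" where
  "shift_invariant \<omega> G \<B> \<longleftrightarrow>
     (\<forall>S\<in>\<B>. \<forall>t\<in>uprod \<omega> (\<lambda>i. carrier (G i)). (\<lambda>x. uadd \<omega> G x t) ` S \<in> \<B>)"

section \<open>Operations on \<open>\<sigma>\<close>-algebras\<close>

definition pull ::
    "nat filter \<Rightarrow> (nat set \<Rightarrow> 'a) upoint measure \<Rightarrow> nat set \<Rightarrow> 'a upoint set set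
      \<Rightarrow> (nat set \<Rightarrow> 'a) upoint set set" where
  "pull \<omega> C v \<B> = {psi \<omega> v -` S \<inter> space C | S. S \<in> \<B>}"

definition join_K ::
    "nat filter \<Rightarrow> (nat set \<Rightarrow> 'a) upoint measure \<Rightarrow> nat \<Rightarrow> 'a upoint set set
      \<Rightarrow> (nat set \<Rightarrow> 'a) upoint set set" where
  "join_K \<omega> C n \<B> = sigma_sets (space C) (\<Union>v\<in>K n. pull \<omega> C v \<B>)"

definition mod_null :: "'a measure \<Rightarrow> 'a set set \<Rightarrow> 'a set set" where
  "mod_null M \<B> = {S. S \<subseteq> space M \<and> (\<exists>B\<in>\<B>. sym_diff S B \<in> null_sets M)}"

definition wedge :: "'a measure \<Rightarrow> 'a set set \<Rightarrow> 'a set set \<Rightarrow> 'a set set" where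
  "wedge M \<B> \<C> = mod_null M \<B> \<inter> mod_null M \<C>"

text \<open>Equality of families up to null sets: each member of one agrees up to a null set with a
  member of the other. A wedge \<open>\<B> \<and> \<C>\<close> contains all null sets, so identities involving it have to be
  read in this sense.\<close>

definition eq_mod_null :: "'a measure \<Rightarrow> 'a set set \<Rightarrow> 'a set set \<Rightarrow> bool" where
  "eq_mod_null M \<B> \<C> \<longleftrightarrow>
     (\<forall>S\<in>\<B>. \<exists>S'\<in>\<C>. sym_diff S S' \<in> null_sets M) \<and>
     (\<forall>S'\<in>\<C>. \<exists>S\<in>\<B>. sym_diff S S' \<in> null_sets M)"

section \<open>Gowers norms and the \<open>\<sigma>\<close>-algebras \<open>\<F>\<^sub>k\<close>\<close>

text \<open>The integral is real and nonnegative for \<open>k \<ge> 1\<close>.\<close>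

definition gowers_norm ::
    "nat filter \<Rightarrow> (nat \<Rightarrow> 'a monoid) \<Rightarrow> (nat \<Rightarrow> 'a topology) \<Rightarrow> (nat \<Rightarrow> 'a measure) \<Rightarrow> nat
      \<Rightarrow> ('a upoint \<Rightarrow> complex) \<Rightarrow> real" where
  "gowers_norm \<omega> G T \<mu> k f =
     root (2 ^ k)
       (Re (\<integral>c. (\<Prod>v\<in>verts k. (cnj ^^ card v) (f (psi \<omega> v c))) \<partial>Cube \<omega> G T \<mu> k))"

definition bracket ::
    "nat filter \<Rightarrow> (nat \<Rightarrow> 'a monoid) \<Rightarrow> (nat \<Rightarrow> 'a topology) \<Rightarrow> (nat \<Rightarrow> 'a measure) \<Rightarrow> nat
      \<Rightarrow> (nat set \<Rightarrow> 'a upoint \<Rightarrow> complex) \<Rightarrow> 'a upoint \<Rightarrow> complex" where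
  "bracket \<omega> G T \<mu> n F x =
     (\<integral>c. (\<Prod>v\<in>K n. (cnj ^^ card v) (F v (psi \<omega> v c))) \<partial>Cube_at \<omega> G T \<mu> n x)"

definition bounded_family ::
    "'b measure \<Rightarrow> nat \<Rightarrow> (nat set \<Rightarrow> 'b \<Rightarrow> complex) \<Rightarrow> bool" where
  "bounded_family M n F \<longleftrightarrow>
     (\<forall>v\<in>K n. F v \<in> borel_measurable M \<and> (\<exists>C. \<forall>x\<in>space M. cmod (F v x) \<le> C))"

text \<open>\<open>\<F>\<^sub>k\<close>, as a measurable space: only its \<open>space\<close> and \<open>sets\<close> are meaningful.\<close>

definition Fk ::
    "nat filter \<Rightarrow> (nat \<Rightarrow> 'a monoid) \<Rightarrow> (nat \<Rightarrow> 'a topology) \<Rightarrow> (nat \<Rightarrow> 'a measure) \<Rightarrow> nat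
      \<Rightarrow> 'a upoint measure" where
  "Fk \<omega> G T \<mu> k =
     sigma (space (UA \<omega> T \<mu>))
       {bracket \<omega> G T \<mu> (k + 1) F -` B \<inter> space (UA \<omega> T \<mu>) | F B.
          bounded_family (UA \<omega> T \<mu>) (k + 1) F \<and> B \<in> sets borel}"

text \<open>Functions measurable with respect to \<open>N\<close> and essentially bounded with respect to \<open>M\<close>, where
  \<open>N\<close> is a sub-\<open>\<sigma>\<close>-algebra of \<open>M\<close>; elements of \<open>L\<^sup>\<infinity>\<close> are such functions modulo \<open>M\<close>-almost
  everywhere equality.\<close>

definition L_infty :: "'b measure \<Rightarrow> 'b measure \<Rightarrow> ('b \<Rightarrow> complex) set" where
  "L_infty M N = {f. f \<in> borel_measurable N \<and> (\<exists>C. AE x in M. cmod (f x) \<le> C)}"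

definition norm_on_L_infty ::
    "'b measure \<Rightarrow> 'b measure \<Rightarrow> (('b \<Rightarrow> complex) \<Rightarrow> real) \<Rightarrow> bool" where
  "norm_on_L_infty M N p \<longleftrightarrow>
     (\<forall>f\<in>L_infty M N. 0 \<le> p f) \<and>
     (\<forall>f\<in>L_infty M N. p f = 0 \<longleftrightarrow> (AE x in M. f x = 0)) \<and>
     (\<forall>f\<in>L_infty M N. \<forall>a. p (\<lambda>x. a * f x) = cmod a * p f) \<and>
     (\<forall>f\<in>L_infty M N. \<forall>g\<in>L_infty M N. p (\<lambda>x. f x + g x) \<le> p f + p g)"

definition complex_cond_exp ::
    "'b measure \<Rightarrow> 'b measure \<Rightarrow> ('b \<Rightarrow> complex) \<Rightarrow> 'b \<Rightarrow> complex" where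
  "complex_cond_exp M N f x =
     Complex (real_cond_exp M N (\<lambda>y. Re (f y)) x) (real_cond_exp M N (\<lambda>y. Im (f y)) x)"

end

theory Submission
  imports Defs "HOL-Probability.Probability"
begin

text \<open>
  The ultraproduct measures are obtained from the Caratheodory extension theorem and saturation;
  by lower semicontinuity of the measures of sections of open sets, Fubini's theorem holds for
  them although the \<open>\<sigma>\<close>-algebra of a product exceeds the product \<open>\<sigma>\<close>-algebra.

  For a cube \<open>c\<close> with \<open>c(0) = x\<close>, translation invariance gives that \<open>[F](x)\<close> is the average over \<open>r\<close> of
  \<open>\<Prod>\<^sub>v \<C>\<^sup>|\<^sup>v\<^sup>| f\<^sub>v(c(v) + v \<cdot> r)\<close>. For each fixed \<open>r\<close> this product is measurable with respect to the join
  over \<open>v \<noteq> 0\<close>, so a function orthogonal to the join is orthogonal to \<open>[F] \<circ> \<psi>\<^sub>0\<close>; hence \<open>\<F>\<^sub>k \<circ> \<psi>\<^sub>0\<close> lies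
  in the join. Conversely, a function \<open>g\<close> is orthogonal to all \<open>[F]\<close> if and only if \<open>g \<circ> \<psi>\<^sub>0\<close> is
  orthogonal to the join, as the join is generated by the \<open>\<pi>\<close>-system of intersections of sets
  \<open>\<psi>\<^sub>v\<^sup>-\<^sup>1(S\<^sub>v)\<close>. Together with the Gowers--Cauchy--Schwarz inequality this yields (1), (2) and (3). By (2),
  replacing each \<open>f\<^sub>v\<close> by its projection to \<open>\<F>\<^sub>k\<close> does not change \<open>[F]\<close> almost everywhere, and running
  the averaging argument with \<open>\<F>\<^sub>k\<close> in place of \<open>\<A>\<close> gives (5).
\<close>

text \<open>The averaging argument has its form because of joint measurability. As a function of the
  cube and of \<open>r\<close>, the integrand is known to be measurable only for the ultraproduct
  \<sigma>-algebra of the product, so the integral over \<open>r\<close> cannot be formed inside the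
  join. It is tested instead against bounded functions orthogonal to the join: Fubini's theorem for
  the full \<sigma>-algebra exchanges the integrals, and membership in the join is needed for one
  \<open>r\<close> at a time. For this reason orthogonality (\<open>perp\<close>), rather than
  conditional expectation, is the working notion; it can also be checked on a generating family.

  Generation by ultraproducts of open sets alone shapes Fubini's theorem in turn. The measure of a
  section of an internal set is a limit of functions on the factors, and it is measurable for this
  \<sigma>-algebra because the superlevel sets of these functions are open.

  Definiteness of the norm is self-orthogonality: a function measurable with respect to
  \<open>Fk\<close> whose norm vanishes is orthogonal to itself.\<close>

locale ultra =
  fixes \<omega> :: "nat filter"
  assumes ultra: "nonprincipal_ultrafilter \<omega>"
begin

lemma nonbot [simp]: "\<omega> \<noteq> bot"
  using ultra by (simp add: nonprincipal_ultrafilter_def)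

lemma ev_not_iff: "eventually (\<lambda>i. \<not> P i) \<omega> \<longleftrightarrow> \<not> eventually P \<omega>"
proof
  assume *: "eventually (\<lambda>i. \<not> P i) \<omega>"
  show "\<not> eventually P \<omega>"
  proof
    assume "eventually P \<omega>"
    with * have "eventually (\<lambda>i. False) \<omega>" by eventually_elim auto
    then show False by (simp add: eventually_False)
  qed
qed (use ultra in \<open>auto simp: nonprincipal_ultrafilter_def\<close>)

text \<open>Non-principality excludes one index after another, so \<omega> refines the cofinite
  filter. Saturation relies on this to use ever more sets as the index grows.\<close>

lemma ev_ge: "eventually (\<lambda>i. i \<ge> n) \<omega>"
proof (induction n)
  case (Suc n)
  have "eventually (\<lambda>i. i \<noteq> n) \<omega>"
    using ultra by (auto simp: nonprincipal_ultrafilter_def ev_not_iff)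
  with Suc show ?case by eventually_elim auto
qed auto

lemma ev_const [simp]: "eventually (\<lambda>i. P) \<omega> \<longleftrightarrow> P"
  by (cases P) (auto simp: eventually_False)

section \<open>Classes of sequences and ultraproducts of sets\<close>

lemma uclass_eq_iff: "uclass \<omega> f = uclass \<omega> g \<longleftrightarrow> eventually (\<lambda>i. f i = g i) \<omega>"
proof
  assume "uclass \<omega> f = uclass \<omega> g"
  then have "f \<in> uclass \<omega> g" by (auto simp: uclass_def)
  then show "eventually (\<lambda>i. f i = g i) \<omega>" by (simp add: uclass_def)
next
  assume *: "eventually (\<lambda>i. f i = g i) \<omega>"
  have "eventually (\<lambda>i. h i = f i) \<omega> \<longleftrightarrow> eventually (\<lambda>i. h i = g i) \<omega>" for h
    by (rule eventually_subst) (use * in eventually_elim, auto)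
  then show "uclass \<omega> f = uclass \<omega> g" by (auto simp: uclass_def)
qed

lemma urep_uclass: "eventually (\<lambda>i. urep (uclass \<omega> f) i = f i) \<omega>"
proof -
  have "urep (uclass \<omega> f) \<in> uclass \<omega> f"
    unfolding urep_def by (rule someI[of _ f]) (simp add: uclass_def)
  then show ?thesis by (simp add: uclass_def)
qed

lemma uclass_in_uprod: "uclass \<omega> f \<in> uprod \<omega> X \<longleftrightarrow> eventually (\<lambda>i. f i \<in> X i) \<omega>"
proof
  assume "uclass \<omega> f \<in> uprod \<omega> X"
  then obtain g where g: "uclass \<omega> f = uclass \<omega> g" "eventually (\<lambda>i. g i \<in> X i) \<omega>"
    by (auto simp: uprod_def)
  from g(1) have "eventually (\<lambda>i. f i = g i) \<omega>" by (simp add: uclass_eq_iff)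
  with g(2) show "eventually (\<lambda>i. f i \<in> X i) \<omega>" by eventually_elim auto
qed (auto simp: uprod_def)

lemma uprod_urep:
  assumes "x \<in> uprod \<omega> X"
  shows "eventually (\<lambda>i. urep x i \<in> X i) \<omega>" and "uclass \<omega> (urep x) = x"
proof -
  obtain f where f: "x = uclass \<omega> f" using assms by (auto simp: uprod_def)
  show eq: "uclass \<omega> (urep x) = x" unfolding f uclass_eq_iff by (rule urep_uclass)
  show "eventually (\<lambda>i. urep x i \<in> X i) \<omega>"
    using assms by (subst (asm) eq[symmetric]) (simp add: uclass_in_uprod)
qed

text \<open>If inclusion failed on a large set of indices, choosing a point of
  \<open>X i - Y i\<close> there would give a class in one ultraproduct only. Hence an internal set
  determines its factors \<omega>-almost everywhere, which makes limits of measures well defined on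
  internal sets.\<close>

lemma uprod_mono_iff: "uprod \<omega> X \<subseteq> uprod \<omega> Y \<longleftrightarrow> eventually (\<lambda>i. X i \<subseteq> Y i) \<omega>"
proof
  assume *: "uprod \<omega> X \<subseteq> uprod \<omega> Y"
  show "eventually (\<lambda>i. X i \<subseteq> Y i) \<omega>"
  proof (rule ccontr)
    assume "\<not> eventually (\<lambda>i. X i \<subseteq> Y i) \<omega>"
    then have ev: "eventually (\<lambda>i. \<not> X i \<subseteq> Y i) \<omega>" by (simp add: ev_not_iff)
    define f where "f i = (SOME x. x \<in> X i - Y i)" for i
    have f: "eventually (\<lambda>i. f i \<in> X i - Y i) \<omega>"
      using ev
    proof eventually_elim
      case (elim i)
      then have "\<exists>x. x \<in> X i - Y i" by auto
      then show ?case unfolding f_def by (rule someI_ex)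
    qed
    then have "uclass \<omega> f \<in> uprod \<omega> X"
      unfolding uclass_in_uprod by eventually_elim auto
    with * have "eventually (\<lambda>i. f i \<in> Y i) \<omega>" by (auto simp: uclass_in_uprod[symmetric])
    with f have "eventually (\<lambda>i. False) \<omega>" by eventually_elim auto
    then show False by simp
  qed
next
  assume *: "eventually (\<lambda>i. X i \<subseteq> Y i) \<omega>"
  show "uprod \<omega> X \<subseteq> uprod \<omega> Y"
    unfolding uprod_def using * by (force elim: eventually_elim2)
qed

lemma uprod_eq_iff: "uprod \<omega> X = uprod \<omega> Y \<longleftrightarrow> eventually (\<lambda>i. X i = Y i) \<omega>"
  unfolding set_eq_subset uprod_mono_iff by (simp add: eventually_conj_iff)

lemma uprod_empty [simp]: "uprod \<omega> (\<lambda>_. {}) = {}"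
  by (auto simp: uprod_def)

lemma uprod_Int: "uprod \<omega> X \<inter> uprod \<omega> Y = uprod \<omega> (\<lambda>i. X i \<inter> Y i)"
proof -
  have "x \<in> uprod \<omega> X \<inter> uprod \<omega> Y \<longleftrightarrow> x \<in> uprod \<omega> (\<lambda>i. X i \<inter> Y i)" for x
  proof (cases "\<exists>f. x = uclass \<omega> f")
    case True
    then show ?thesis by (auto simp: uclass_in_uprod eventually_conj_iff)
  qed (auto simp: uprod_def)
  then show ?thesis by auto
qed

lemma uprod_Diff: "uprod \<omega> X - uprod \<omega> Y = uprod \<omega> (\<lambda>i. X i - Y i)"
proof -
  have "x \<in> uprod \<omega> X - uprod \<omega> Y \<longleftrightarrow> x \<in> uprod \<omega> (\<lambda>i. X i - Y i)" for x
  proof (cases "\<exists>f. x = uclass \<omega> f")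
    case True
    then show ?thesis by (auto simp: uclass_in_uprod eventually_conj_iff ev_not_iff)
  qed (auto simp: uprod_def)
  then show ?thesis by auto
qed

text \<open>For an ultrafilter, a union of two index sets is large only if one of them is.\<close>

lemma uprod_Un: "uprod \<omega> X \<union> uprod \<omega> Y = uprod \<omega> (\<lambda>i. X i \<union> Y i)"
proof -
  have *: "eventually (\<lambda>i. f i \<in> X i \<union> Y i) \<omega> \<longleftrightarrow>
      eventually (\<lambda>i. f i \<in> X i) \<omega> \<or> eventually (\<lambda>i. f i \<in> Y i) \<omega>" for f
    using ev_not_iff[of "\<lambda>i. f i \<in> X i \<union> Y i"]
    by (auto simp: eventually_conj_iff ev_not_iff elim: eventually_mono)
  have "x \<in> uprod \<omega> X \<union> uprod \<omega> Y \<longleftrightarrow> x \<in> uprod \<omega> (\<lambda>i. X i \<union> Y i)" for x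
  proof (cases "\<exists>f. x = uclass \<omega> f")
    case True
    then show ?thesis by (auto simp: uclass_in_uprod *[simplified])
  qed (auto simp: uprod_def)
  then show ?thesis by auto
qed

text \<open>Compactness of \<open>{a..b}\<close> gives the image filter a cluster point. For an
  ultrafilter this is a limit, since a neighbourhood that is not hit almost everywhere is avoided
  almost everywhere.\<close>

lemma ulim_ex:
  fixes f :: "nat \<Rightarrow> real"
  assumes "eventually (\<lambda>i. f i \<in> {a..b}) \<omega>"
  shows "\<exists>l\<in>{a..b}. (f \<longlongrightarrow> l) \<omega>"
proof -
  have "filtermap f \<omega> \<noteq> bot" by (simp add: filtermap_bot_iff)
  moreover have "eventually (\<lambda>x. x \<in> {a..b}) (filtermap f \<omega>)"
    using assms by (simp add: eventually_filtermap)
  ultimately obtain l where l: "l \<in> {a..b}" "inf (nhds l) (filtermap f \<omega>) \<noteq> bot"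
    using compact_Icc[of a b] unfolding compact_filter by blast
  have "(f \<longlongrightarrow> l) \<omega>"
  proof (rule topological_tendstoI)
    fix S assume S: "open S" "l \<in> S"
    show "eventually (\<lambda>x. f x \<in> S) \<omega>"
    proof (rule ccontr)
      assume "\<not> eventually (\<lambda>x. f x \<in> S) \<omega>"
      then have "eventually (\<lambda>x. x \<notin> S) (filtermap f \<omega>)"
        by (simp add: eventually_filtermap ev_not_iff)
      moreover have "eventually (\<lambda>x. x \<in> S) (nhds l)"
        using S by (auto simp: eventually_nhds)
      ultimately have "eventually (\<lambda>x. False) (inf (nhds l) (filtermap f \<omega>))"
        unfolding eventually_inf by blast
      with l(2) show False by (simp add: eventually_False)
    qed
  qed
  with l(1) show ?thesis by blast
qed

text \<open>Saturation: choose \<open>x i\<close> in the intersection of as many of the first \<open>i\<close> sets as possible.\<close>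

lemma uprod_saturation:
  assumes "\<And>n::nat. \<exists>x. eventually (\<lambda>i. x i \<in> (\<Inter>m\<le>n. S m i)) \<omega>"
  shows "\<exists>x. \<forall>n. eventually (\<lambda>i. x i \<in> S n i) \<omega>"
proof -
  define P where "P i n \<longleftrightarrow> (\<Inter>m\<le>n. S m i) \<noteq> {}" for i n
  define N where "N i = (GREATEST n. n \<le> i \<and> P i n)" for i
  define x where "x i = (SOME y. y \<in> (\<Inter>m\<le>N i. S m i))" for i
  have "eventually (\<lambda>i. x i \<in> S n i) \<omega>" for n
  proof -
    obtain y where y: "eventually (\<lambda>i. y i \<in> (\<Inter>m\<le>n. S m i)) \<omega>" using assms by blast
    from y ev_ge[of n] show ?thesis
    proof eventually_elim
      case (elim i)
      then have Pn: "n \<le> i \<and> P i n" by (auto simp: P_def)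
      have "N i \<le> i \<and> P i (N i)" unfolding N_def
        by (rule GreatestI_nat[where b=i]) (use Pn in auto)
      moreover have "n \<le> N i" unfolding N_def
        by (rule Greatest_le_nat[where b=i]) (use Pn in auto)
      moreover have "x i \<in> (\<Inter>m\<le>N i. S m i)" if "P i (N i)"
      proof -
        have "\<exists>y. y \<in> (\<Inter>m\<le>N i. S m i)" using that unfolding P_def by blast
        then show ?thesis unfolding x_def by (rule someI_ex)
      qed
      ultimately show ?case by blast
    qed
  qed
  then show ?thesis by blast
qed

end

section \<open>The ultraproduct of probability spaces\<close>

text \<open>The measurable sets need only include the open ones, because finite product measures
  carry the product \<sigma>-algebra rather than one defined from the topology. Second countability
  makes the condition stable under products.\<close>

definition pspace :: "'a topology \<Rightarrow> 'a measure \<Rightarrow> bool" where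
  "pspace T M \<longleftrightarrow> second_countable T \<and> prob_space M \<and> space M = topspace T \<and>
     (\<forall>U. openin T U \<longrightarrow> U \<in> sets M)"

context ultra begin

text \<open>Good factors are demanded only \<omega>-almost everywhere: the spaces in
  \<open>Cube_at\<close> are built from \<open>urep x i\<close>, which may leave the group on a
  negligible set of indices.\<close>

definition uspace :: "(nat \<Rightarrow> 'a topology) \<Rightarrow> (nat \<Rightarrow> 'a measure) \<Rightarrow> bool" where
  "uspace T M \<longleftrightarrow> eventually (\<lambda>i. pspace (T i) (M i)) \<omega>"

abbreviation uopen :: "(nat \<Rightarrow> 'a topology) \<Rightarrow> (nat \<Rightarrow> 'a set) \<Rightarrow> bool" where
  "uopen T U \<equiv> eventually (\<lambda>i. openin (T i) (U i)) \<omega>"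

abbreviation "L \<equiv> ultra_measure \<omega>"

lemma uopen_subset: "uopen T U \<Longrightarrow> uprod \<omega> U \<subseteq> uprod \<omega> (\<lambda>i. topspace (T i))"
  unfolding uprod_mono_iff by (auto elim!: eventually_mono dest: openin_subset)

lemma space_L: "space (L T M) = uprod \<omega> (\<lambda>i. topspace (T i))"
  and sets_L: "sets (L T M) = sigma_sets (uprod \<omega> (\<lambda>i. topspace (T i))) (uprod \<omega> ` {U. uopen T U})"
proof -
  have "uprod \<omega> ` {U. uopen T U} \<subseteq> Pow (uprod \<omega> (\<lambda>i. topspace (T i)))"
    using uopen_subset by blast
  then show "space (L T M) = uprod \<omega> (\<lambda>i. topspace (T i))"
    and "sets (L T M) = sigma_sets (uprod \<omega> (\<lambda>i. topspace (T i))) (uprod \<omega> ` {U. uopen T U})"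
    unfolding ultra_measure_def by (simp_all add: space_extend_measure sets_extend_measure)
qed

lemma sets_L_uprod [intro]: "uopen T U \<Longrightarrow> uprod \<omega> U \<in> sets (L T M)"
  unfolding sets_L by blast

lemma Int_stable_uopen: "Int_stable (uprod \<omega> ` {U. uopen T U})"
proof (rule Int_stableI)
  fix a b assume "a \<in> uprod \<omega> ` {U. uopen T U}" "b \<in> uprod \<omega> ` {U. uopen T U}"
  then obtain U V where *: "a = uprod \<omega> U" "b = uprod \<omega> V" "uopen T U" "uopen T V" by blast
  have "uopen T (\<lambda>i. U i \<inter> V i)" using *(3,4) by eventually_elim auto
  then show "a \<inter> b \<in> uprod \<omega> ` {U. uopen T U}" unfolding * uprod_Int by blast
qed

lemma ulim_measure:
  assumes "uspace T M"
  shows "\<exists>l\<ge>0. ((\<lambda>i. measure (M i) (S i)) \<longlongrightarrow> l) \<omega>"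
proof -
  have "eventually (\<lambda>i. measure (M i) (S i) \<in> {0..1}) \<omega>"
    using assms unfolding uspace_def by eventually_elim (auto simp: pspace_def prob_space.prob_le_1)
  from ulim_ex[OF this] show ?thesis by auto
qed

text \<open>\<open>extend_measure\<close> takes its prescribed values only if some measure extends
  them; this supplies one. Caratheodory's theorem needs a ring, and open sets are not closed under
  differences, so the construction runs over the ultraproducts of all measurable sets and is
  restricted afterwards. Continuity at the empty set is trivial by saturation: a decreasing sequence
  of internal sets with empty intersection contains the empty set.\<close>

lemma ex_loeb_measure:
  assumes "uspace T M"
  shows "\<exists>\<mu>'. (\<forall>S l. eventually (\<lambda>i. S i \<in> sets (M i)) \<omega> \<longrightarrow>
      ((\<lambda>i. measure (M i) (S i)) \<longlongrightarrow> l) \<omega> \<longrightarrow> \<mu>' (uprod \<omega> S) = ennreal l) \<and>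
    positive (sets (L T M)) \<mu>' \<and> countably_additive (sets (L T M)) \<mu>'"
proof -
  let ?\<Omega> = "uprod \<omega> (\<lambda>i. topspace (T i))"
  define R where "R = uprod \<omega> ` {S. eventually (\<lambda>i. S i \<in> sets (M i)) \<omega>}"
  \<comment> \<open>The value of \<open>f\<close> is read off from a chosen sequence of factors;
    \<open>uprod_eq_iff\<close> makes the choice irrelevant.\<close>
  define rp where "rp X = (SOME S. eventually (\<lambda>i. S i \<in> sets (M i)) \<omega> \<and> X = uprod \<omega> S)" for X
  define f where "f X = ennreal (Lim \<omega> (\<lambda>i. measure (M i) (rp X i)))" for X
  have ps: "eventually (\<lambda>i. pspace (T i) (M i)) \<omega>" using assms by (simp add: uspace_def)
  note lim = ulim_measure[OF assms]
  have f: "f (uprod \<omega> S) = ennreal l"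
    if S: "eventually (\<lambda>i. S i \<in> sets (M i)) \<omega>" and l: "((\<lambda>i. measure (M i) (S i)) \<longlongrightarrow> l) \<omega>" for S l
  proof -
    have "eventually (\<lambda>i. rp (uprod \<omega> S) i \<in> sets (M i)) \<omega> \<and> uprod \<omega> S = uprod \<omega> (rp (uprod \<omega> S))"
      unfolding rp_def by (rule someI[of _ S]) (use S in auto)
    then have "eventually (\<lambda>i. S i = rp (uprod \<omega> S) i) \<omega>" by (simp add: uprod_eq_iff)
    then have "eventually (\<lambda>i. measure (M i) (S i) = measure (M i) (rp (uprod \<omega> S) i)) \<omega>"
      by eventually_elim auto
    with l have "((\<lambda>i. measure (M i) (rp (uprod \<omega> S) i)) \<longlongrightarrow> l) \<omega>"
      by (rule Lim_transform_eventually)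
    then show ?thesis by (simp add: f_def tendsto_Lim)
  qed
  interpret ring_of_sets ?\<Omega> R
  proof (rule ring_of_setsI)
    show "R \<subseteq> Pow ?\<Omega>"
    proof
      fix a assume "a \<in> R"
      then obtain S where S: "a = uprod \<omega> S" "eventually (\<lambda>i. S i \<in> sets (M i)) \<omega>"
        by (auto simp: R_def)
      have "eventually (\<lambda>i. S i \<subseteq> topspace (T i)) \<omega>"
        using ps S(2) by eventually_elim (auto simp: pspace_def dest: sets.sets_into_space)
      then show "a \<in> Pow ?\<Omega>" by (simp add: S uprod_mono_iff)
    qed
    show "{} \<in> R" unfolding R_def by (rule image_eqI[of _ _ "\<lambda>_. {}"]) auto
    fix a b assume "a \<in> R" "b \<in> R"
    then obtain S S' where *: "a = uprod \<omega> S" "b = uprod \<omega> S'"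
      "eventually (\<lambda>i. S i \<in> sets (M i)) \<omega>" "eventually (\<lambda>i. S' i \<in> sets (M i)) \<omega>"
      by (auto simp: R_def)
    have "eventually (\<lambda>i. S i \<union> S' i \<in> sets (M i)) \<omega>" "eventually (\<lambda>i. S i - S' i \<in> sets (M i)) \<omega>"
      using *(3,4) by (eventually_elim, auto)+
    then show "a \<union> b \<in> R" "a - b \<in> R" unfolding * uprod_Un uprod_Diff R_def by auto
  qed
  have f0: "f {} = 0"
    using f[of "\<lambda>_. {}" 0] by simp
  have "\<exists>\<mu>'. (\<forall>s\<in>R. \<mu>' s = f s) \<and> measure_space ?\<Omega> (sigma_sets ?\<Omega> R) \<mu>'"
  proof (rule caratheodory_empty_continuous)
    show "positive R f" using f0 by (auto simp: positive_def)
    show "additive R f"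
      unfolding additive_def
    proof (intro ballI impI)
      fix a b assume "a \<in> R" "b \<in> R" and disj: "a \<inter> b = {}"
      then obtain S S' where *: "a = uprod \<omega> S" "b = uprod \<omega> S'"
        "eventually (\<lambda>i. S i \<in> sets (M i)) \<omega>" "eventually (\<lambda>i. S' i \<in> sets (M i)) \<omega>"
        by (auto simp: R_def)
      obtain l l' where l: "l \<ge> 0" "((\<lambda>i. measure (M i) (S i)) \<longlongrightarrow> l) \<omega>"
        "l' \<ge> 0" "((\<lambda>i. measure (M i) (S' i)) \<longlongrightarrow> l') \<omega>"
        using lim[of S] lim[of S'] by blast
      have "uprod \<omega> (\<lambda>i. S i \<inter> S' i) = uprod \<omega> (\<lambda>_. {})"
        using disj by (simp add: * uprod_Int)
      then have "eventually (\<lambda>i. S i \<inter> S' i = {}) \<omega>" by (simp only: uprod_eq_iff)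
      with *(3,4) ps
      have ev: "eventually (\<lambda>i. measure (M i) (S i) + measure (M i) (S' i) = measure (M i) (S i \<union> S' i)) \<omega>"
        by eventually_elim
          (auto simp: pspace_def finite_measure.finite_measure_Union prob_space.finite_measure)
      have "((\<lambda>i. measure (M i) (S i \<union> S' i)) \<longlongrightarrow> l + l') \<omega>"
        using tendsto_add[OF l(2) l(4)] ev by (rule Lim_transform_eventually)
      moreover have "eventually (\<lambda>i. S i \<union> S' i \<in> sets (M i)) \<omega>"
        using *(3,4) by eventually_elim auto
      ultimately have "f (a \<union> b) = ennreal (l + l')" unfolding * uprod_Un by (intro f)
      then show "f (a \<union> b) = f a + f b"
        using f[OF *(3) l(2)] f[OF *(4) l(4)] l by (simp add: *)
    qed
    show "f A \<noteq> \<infinity>" for A by (simp add: f_def)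
    fix A :: "nat \<Rightarrow> 'a upoint set"
    assume A: "range A \<subseteq> R" "decseq A" "(\<Inter>i. A i) = {}"
    have "\<forall>n. \<exists>S. A n = uprod \<omega> S" using A(1) by (auto simp: R_def)
    then obtain S where S: "\<And>n. A n = uprod \<omega> (S n)" by metis
    have "\<exists>n. A n = {}"
    proof (rule ccontr)
      assume ne: "\<nexists>n. A n = {}"
      \<comment> \<open>A point of \<open>A n\<close> lies in all earlier sets, so its coordinates
        satisfy the first \<open>n + 1\<close> conditions simultaneously almost everywhere.\<close>
      have "\<exists>x. eventually (\<lambda>i. x i \<in> (\<Inter>m\<le>n. S m i)) \<omega>" for n
      proof -
        from ne obtain x where "x \<in> A n" by blast
        then obtain g where g: "x = uclass \<omega> g" by (auto simp: S uprod_def)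
        have "eventually (\<lambda>i. g i \<in> S m i) \<omega>" if "m \<le> n" for m
        proof -
          have "x \<in> A m" using \<open>x \<in> A n\<close> \<open>decseq A\<close> that by (auto simp: decseq_def)
          then show ?thesis by (simp add: S g uclass_in_uprod)
        qed
        then have "eventually (\<lambda>i. \<forall>m\<in>{..n}. g i \<in> S m i) \<omega>"
          by (intro eventually_ball_finite) auto
        then show ?thesis by (auto intro: exI[of _ g])
      qed
      from uprod_saturation[OF this] obtain x where "\<And>n. eventually (\<lambda>i. x i \<in> S n i) \<omega>" by blast
      then have "uclass \<omega> x \<in> (\<Inter>i. A i)" by (simp add: S uclass_in_uprod)
      then show False using A(3) by simp
    qed
    then obtain n where n: "A n = {}" by blast
    have "eventually (\<lambda>m. f (A m) = 0) sequentially"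
      using eventually_ge_at_top[of n]
    proof eventually_elim
      case (elim m)
      then have "A m = {}" using n \<open>decseq A\<close> by (auto simp: decseq_def)
      then show ?case using f0 by simp
    qed
    then show "(\<lambda>i. f (A i)) \<longlonglongrightarrow> 0" by (rule tendsto_eventually)
  qed
  then obtain \<mu>' where \<mu>': "\<And>s. s \<in> R \<Longrightarrow> \<mu>' s = f s" "measure_space ?\<Omega> (sigma_sets ?\<Omega> R) \<mu>'" by blast
  have "eventually (\<lambda>i. U i \<in> sets (M i)) \<omega>" if "uopen T U" for U
    using ps that by eventually_elim (auto simp: pspace_def)
  then have "uprod \<omega> ` {U. uopen T U} \<subseteq> R"
    unfolding R_def by blast
  then have sub: "sets (L T M) \<subseteq> sigma_sets ?\<Omega> R"
    unfolding sets_L by (rule sigma_sets_mono')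
  have pos: "positive (sets (L T M)) \<mu>'"
    using \<mu>'(2) by (simp add: measure_space_def positive_def)
  have "countably_additive (sets (L T M)) \<mu>'"
    unfolding countably_additive_def
  proof (intro allI impI)
    fix A :: "nat \<Rightarrow> 'a upoint set"
    assume A: "range A \<subseteq> sets (L T M)" "disjoint_family A" "(\<Union>i. A i) \<in> sets (L T M)"
    have "countably_additive (sigma_sets ?\<Omega> R) \<mu>'" using \<mu>'(2) by (simp add: measure_space_def)
    moreover have "range A \<subseteq> sigma_sets ?\<Omega> R" "(\<Union>i. A i) \<in> sigma_sets ?\<Omega> R" using A sub by blast+
    ultimately show "(\<Sum>i. \<mu>' (A i)) = \<mu>' (\<Union>i. A i)"
      using A(2) unfolding countably_additive_def by blast
  qed
  moreover have "\<mu>' (uprod \<omega> S) = ennreal l"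
    if "eventually (\<lambda>i. S i \<in> sets (M i)) \<omega>" "((\<lambda>i. measure (M i) (S i)) \<longlongrightarrow> l) \<omega>" for S l
    using f[OF that] \<mu>'(1)[of "uprod \<omega> S"] that(1) unfolding R_def by simp
  ultimately show ?thesis using pos by (intro exI[of _ \<mu>'] conjI allI impI)
qed

lemma emeasure_L:
  assumes "uspace T M" "uopen T U" "((\<lambda>i. measure (M i) (U i)) \<longlongrightarrow> l) \<omega>"
  shows "emeasure (L T M) (uprod \<omega> U) = ennreal l"
proof -
  from ex_loeb_measure[OF assms(1)] obtain \<mu>' where \<mu>'1: "\<forall>S l. eventually (\<lambda>i. S i \<in> sets (M i)) \<omega> \<longrightarrow>
      ((\<lambda>i. measure (M i) (S i)) \<longlongrightarrow> l) \<omega> \<longrightarrow> \<mu>' (uprod \<omega> S) = ennreal l"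
    and \<mu>': "positive (sets (L T M)) \<mu>'" "countably_additive (sets (L T M)) \<mu>'"
    by (elim exE conjE)
  have ps: "eventually (\<lambda>i. pspace (T i) (M i)) \<omega>" using assms by (simp add: uspace_def)
  note lim = ulim_measure[OF assms(1)]
  have lime: "Lim \<omega> (\<lambda>i. emeasure (M i) (S i)) = ennreal l" and m: "\<mu>' (uprod \<omega> S) = ennreal l"
    if "uopen T S" "((\<lambda>i. measure (M i) (S i)) \<longlongrightarrow> l) \<omega>" for S l
  proof -
    have ev: "eventually (\<lambda>i. emeasure (M i) (S i) = ennreal (measure (M i) (S i))) \<omega>"
      using ps that(1)
      by eventually_elim (auto simp: pspace_def finite_measure.emeasure_eq_measure prob_space.finite_measure)
    have "((\<lambda>i. ennreal (measure (M i) (S i))) \<longlongrightarrow> ennreal l) \<omega>"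
      using that by (intro tendsto_ennrealI)
    then have "((\<lambda>i. emeasure (M i) (S i)) \<longlongrightarrow> ennreal l) \<omega>"
      by (rule Lim_transform_eventually) (use ev in eventually_elim, simp)
    then show "Lim \<omega> (\<lambda>i. emeasure (M i) (S i)) = ennreal l" by (simp add: tendsto_Lim)
    show "\<mu>' (uprod \<omega> S) = ennreal l"
      by (rule \<mu>'1[rule_format, OF _ that(2)]) (use ps that(1) in eventually_elim, auto simp: pspace_def)
  qed
  have "emeasure (L T M) (uprod \<omega> U) = Lim \<omega> (\<lambda>i. emeasure (M i) (U i))"
  proof (rule emeasure_extend_measure[where \<mu>'=\<mu>' and G="uprod \<omega>" and I="{U. uopen T U}" and i=U
        and \<mu>="\<lambda>U. Lim \<omega> (\<lambda>i. emeasure (M i) (U i))" and \<Omega>="uprod \<omega> (\<lambda>i. topspace (T i))"])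
    show "L T M = extend_measure (uprod \<omega> (\<lambda>i. topspace (T i))) {U. uopen T U} (uprod \<omega>)
        (\<lambda>U. Lim \<omega> (\<lambda>i. emeasure (M i) (U i)))"
      by (simp add: ultra_measure_def)
    show "uprod \<omega> ` {U. uopen T U} \<subseteq> Pow (uprod \<omega> (\<lambda>i. topspace (T i)))"
      using uopen_subset by blast
    show "\<mu>' (uprod \<omega> S) = Lim \<omega> (\<lambda>i. emeasure (M i) (S i))" if "S \<in> {U. uopen T U}" for S
    proof -
      from lim[of S] obtain l where "((\<lambda>i. measure (M i) (S i)) \<longlongrightarrow> l) \<omega>" by blast
      with that show ?thesis using lime[of S l] m[of S l] by simp
    qed
    show "positive (sets (L T M)) \<mu>'" "countably_additive (sets (L T M)) \<mu>'" by fact+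
    show "U \<in> {U. uopen T U}" using assms(2) by simp
  qed
  then show ?thesis using lime[OF assms(2,3)] by simp
qed

lemma prob_space_L: assumes "uspace T M" shows "prob_space (L T M)"
proof
  have ps: "eventually (\<lambda>i. pspace (T i) (M i)) \<omega>" using assms by (simp add: uspace_def)
  have "eventually (\<lambda>i. measure (M i) (topspace (T i)) = 1) \<omega>"
    using ps by eventually_elim (auto simp: pspace_def prob_space.prob_space dest: sym)
  then have "((\<lambda>i. measure (M i) (topspace (T i))) \<longlongrightarrow> 1) \<omega>" by (rule tendsto_eventually)
  from emeasure_L[OF assms _ this] show "emeasure (L T M) (space (L T M)) = 1"
    by (simp add: space_L)
qed

lemma measure_L:
  assumes "uspace T M" "uopen T U"
  shows "((\<lambda>i. measure (M i) (U i)) \<longlongrightarrow> measure (L T M) (uprod \<omega> U)) \<omega>"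
proof -
  from ulim_measure[OF assms(1)] obtain l where l: "l \<ge> 0" "((\<lambda>i. measure (M i) (U i)) \<longlongrightarrow> l) \<omega>"
    by blast
  moreover have "measure (L T M) (uprod \<omega> U) = l"
    using emeasure_L[OF assms l(2)] l(1) by (simp add: measure_def)
  ultimately show ?thesis by simp
qed

text \<open>The internal open sets are closed under intersection and include the whole space, so
  they determine a probability measure. The hypothesis asks for limits because values on the factors
  are what computations provide.\<close>

lemma measure_eqI_L:
  assumes "uspace T M" "prob_space N" "sets N = sets (L T M)"
    and "\<And>U. uopen T U \<Longrightarrow> ((\<lambda>i. measure (M i) (U i)) \<longlongrightarrow> measure N (uprod \<omega> U)) \<omega>"
  shows "N = L T M"
proof (rule measure_eqI_generator_eq[OF Int_stable_uopen])
  interpret N: prob_space N by fact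
  interpret LL: prob_space "L T M" by (rule prob_space_L[OF assms(1)])
  show "uprod \<omega> ` {U. uopen T U} \<subseteq> Pow (uprod \<omega> (\<lambda>i. topspace (T i)))"
    using uopen_subset by blast
  show "sets N = sigma_sets (uprod \<omega> (\<lambda>i. topspace (T i))) (uprod \<omega> ` {U. uopen T U})"
    "sets (L T M) = sigma_sets (uprod \<omega> (\<lambda>i. topspace (T i))) (uprod \<omega> ` {U. uopen T U})"
    using assms(3) by (auto simp: sets_L)
  show "range (\<lambda>_::nat. uprod \<omega> (\<lambda>i. topspace (T i))) \<subseteq> uprod \<omega> ` {U. uopen T U}" by auto
  show "emeasure N X = emeasure (L T M) X" if "X \<in> uprod \<omega> ` {U. uopen T U}" for X
  proof -
    from that obtain U where U: "X = uprod \<omega> U" "uopen T U" by blast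
    have "measure N X = measure (L T M) X"
      using tendsto_unique[OF nonbot assms(4)[OF U(2)] measure_L[OF assms(1) U(2)]] U by simp
    then show ?thesis by (simp add: N.emeasure_eq_measure LL.emeasure_eq_measure)
  qed
qed (use assms(2) in \<open>auto simp: prob_space.emeasure_le_1 finite_measure.emeasure_eq_measure prob_space.finite_measure\<close>)

end

section \<open>Open sets in products of second countable spaces\<close>

lemma second_countableE:
  assumes "second_countable T"
  obtains \<B> where "countable \<B>" "\<And>V. V \<in> \<B> \<Longrightarrow> openin T V"
    "\<And>U x. openin T U \<Longrightarrow> x \<in> U \<Longrightarrow> \<exists>V\<in>\<B>. x \<in> V \<and> V \<subseteq> U"
proof -
  from assms obtain \<B> where B: "countable \<B>" "\<forall>V\<in>\<B>. openin T V"
    "\<forall>U x. openin T U \<and> x \<in> U \<longrightarrow> (\<exists>V\<in>\<B>. x \<in> V \<and> V \<subseteq> U)"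
    unfolding second_countable_def by (elim exE conjE)
  show thesis
    by (rule that[of \<B>]) (use B in simp_all)
qed

lemma openin_prod_topologyE:
  assumes "openin (prod_topology T1 T2) W" "(x, y) \<in> W"
  obtains U V where "openin T1 U" "openin T2 V" "x \<in> U" "y \<in> V" "U \<times> V \<subseteq> W"
proof -
  have "\<exists>U V. openin T1 U \<and> openin T2 V \<and> x \<in> U \<and> y \<in> V \<and> U \<times> V \<subseteq> W"
    using assms unfolding openin_prod_topology_alt by simp
  then show thesis by (elim exE conjE) (rule that)
qed

text \<open>A countable base of rectangles is what places every open subset of the product in the
  product \<sigma>-algebra; an uncountable union of rectangles need not belong to it.\<close>

lemma second_countable_rectangles:
  assumes "second_countable T1" "second_countable T2"
  shows "\<exists>\<R>. countable \<R> \<and> (\<forall>r\<in>\<R>. openin T1 (fst r) \<and> openin T2 (snd r)) \<and>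
    (\<forall>W z. openin (prod_topology T1 T2) W \<longrightarrow> z \<in> W \<longrightarrow> (\<exists>r\<in>\<R>. z \<in> fst r \<times> snd r \<and> fst r \<times> snd r \<subseteq> W))"
proof -
  obtain B1 where B1: "countable B1" "\<And>V. V \<in> B1 \<Longrightarrow> openin T1 V"
    "\<And>U x. openin T1 U \<Longrightarrow> x \<in> U \<Longrightarrow> \<exists>V\<in>B1. x \<in> V \<and> V \<subseteq> U"
    using second_countableE[OF assms(1)] by metis
  obtain B2 where B2: "countable B2" "\<And>V. V \<in> B2 \<Longrightarrow> openin T2 V"
    "\<And>U x. openin T2 U \<Longrightarrow> x \<in> U \<Longrightarrow> \<exists>V\<in>B2. x \<in> V \<and> V \<subseteq> U"
    using second_countableE[OF assms(2)] by metis
  show ?thesis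
  proof (intro exI[of _ "B1 \<times> B2"] conjI ballI allI impI)
    show "countable (B1 \<times> B2)" using B1(1) B2(1) by auto
    show "openin T1 (fst r)" "openin T2 (snd r)" if "r \<in> B1 \<times> B2" for r
      using that B1(2) B2(2) by auto
    fix W z assume W: "openin (prod_topology T1 T2) W" "z \<in> W"
    obtain x y where z: "z = (x, y)" by fastforce
    from W obtain U V where UV: "openin T1 U" "openin T2 V" "x \<in> U" "y \<in> V" "U \<times> V \<subseteq> W"
      unfolding z by (rule openin_prod_topologyE)
    from B1(3)[OF UV(1,3)] B2(3)[OF UV(2,4)]
    obtain U' V' where "U' \<in> B1" "x \<in> U'" "U' \<subseteq> U" "V' \<in> B2" "y \<in> V'" "V' \<subseteq> V"
      by (elim bexE conjE)
    then show "\<exists>r\<in>B1 \<times> B2. z \<in> fst r \<times> snd r \<and> fst r \<times> snd r \<subseteq> W"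
      using UV(5) by (intro bexI[of _ "(U', V')"]) (auto simp: z)
  qed
qed

text \<open>Write \<open>W\<close> as a countable union of open rectangles
  \<open>A n \<times> B n\<close>. The section at \<open>x\<close> is the increasing limit of finite
  unions of those \<open>B n\<close> for which \<open>A n\<close> contains \<open>x\<close>. Some
  finite union already has measure above \<open>q\<close>, and it is contained in the section at
  every \<open>y\<close> that lies in the same finitely many \<open>A n\<close>.\<close>

lemma measure_lsc_section:
  assumes P1: "pspace T1 M1" and P2: "pspace T2 M2" and W: "openin (prod_topology T1 T2) W"
  shows "openin T1 {x \<in> topspace T1. q < measure M2 (Pair x -` W)}"
    and "W \<in> sets (M1 \<Otimes>\<^sub>M M2)"
proof -
  interpret M2: prob_space M2 using P2 by (simp add: pspace_def)
  have sc: "second_countable T1" "second_countable T2" using P1 P2 by (simp_all add: pspace_def)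
  from second_countable_rectangles[OF sc] obtain \<R>0 where \<R>0: "countable \<R>0"
    "\<forall>r\<in>\<R>0. openin T1 (fst r) \<and> openin T2 (snd r)"
    "\<forall>W z. openin (prod_topology T1 T2) W \<longrightarrow> z \<in> W \<longrightarrow> (\<exists>r\<in>\<R>0. z \<in> fst r \<times> snd r \<and> fst r \<times> snd r \<subseteq> W)"
    by (elim exE conjE)
  \<comment> \<open>The empty rectangle keeps the family inhabited, so that
    \<open>from_nat_into\<close> can enumerate it.\<close>
  define \<R> where "\<R> = insert ({},{}) {r \<in> \<R>0. fst r \<times> snd r \<subseteq> W}"
  have "countable \<R>" "\<R> \<noteq> {}" using \<R>0(1) by (auto simp: \<R>_def)
  define R where "R = from_nat_into \<R>"
  have R: "range R = \<R>"
    unfolding R_def using \<open>countable \<R>\<close> \<open>\<R> \<noteq> {}\<close> by (simp add: range_from_nat_into)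
  define A where "A n = fst (R n)" for n
  define B where "B n = snd (R n)" for n
  have RA: "R n \<in> \<R>" for n using R by blast
  have A: "openin T1 (A n)" and B: "openin T2 (B n)" and AB: "A n \<times> B n \<subseteq> W" for n
    using RA[of n] \<R>0(2) by (auto simp: \<R>_def A_def B_def)
  have WAB: "W = (\<Union>n. A n \<times> B n)"
  proof
    show "W \<subseteq> (\<Union>n. A n \<times> B n)"
    proof (rule subsetI)
      fix z assume "z \<in> W"
      from \<R>0(3)[rule_format, OF W \<open>z \<in> W\<close>]
      obtain r where r: "r \<in> \<R>0" "z \<in> fst r \<times> snd r" "fst r \<times> snd r \<subseteq> W" by (elim bexE conjE)
      then have "r \<in> \<R>" by (auto simp: \<R>_def)
      then obtain n where "R n = r" using R by (metis imageE)
      with r(2) show "z \<in> (\<Union>n. A n \<times> B n)" by (auto simp: A_def B_def intro!: exI[of _ n])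
    qed
  qed (use AB in auto)
  have B_sets: "B n \<in> sets M2" and A_sets: "A n \<in> sets M1" for n
    using A B P1 P2 by (auto simp: pspace_def)
  show "W \<in> sets (M1 \<Otimes>\<^sub>M M2)"
    unfolding WAB using A_sets B_sets by auto
  define D where "D n x = (if x \<in> A n then B n else {})" for n x
  have sect: "Pair x -` W = (\<Union>n. D n x)" for x
    unfolding WAB D_def by auto
  have D_sets: "(\<Union>n<N. D n x) \<in> sets M2" for N x
    by (intro sets.finite_UN) (auto simp: D_def B_sets)
  show "openin T1 {x \<in> topspace T1. q < measure M2 (Pair x -` W)}" (is "openin T1 ?S")
  proof (subst openin_subopen, intro ballI)
    fix x assume x: "x \<in> ?S"
    have "(\<lambda>N. measure M2 (\<Union>n<N. D n x)) \<longlonglongrightarrow> measure M2 (\<Union>N. \<Union>n<N. D n x)"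
    proof (rule M2.finite_Lim_measure_incseq)
      show "incseq (\<lambda>N. \<Union>n<N. D n x)" by (intro monoI UN_mono) auto
    qed (use D_sets in auto)
    also have "(\<Union>N. \<Union>n<N. D n x) = Pair x -` W" unfolding sect by blast
    finally have "eventually (\<lambda>N. q < measure M2 (\<Union>n<N. D n x)) sequentially"
      using x by (intro order_tendstoD(1)) auto
    then obtain N where N: "q < measure M2 (\<Union>n<N. D n x)"
      by (meson eventually_at_top_linorder order_refl)
    \<comment> \<open>Finitely many of the first \<open>N\<close> sets \<open>A n\<close> contain
      \<open>x\<close>; on their intersection the corresponding \<open>B n\<close> stay in the
      section. The whole space is included for the case that there are none.\<close>
    define V where "V = topspace T1 \<inter> (\<Inter>n\<in>{n. n < N \<and> x \<in> A n}. A n)"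
    have "openin T1 V"
    proof (cases "{n. n < N \<and> x \<in> A n} = {}")
      case False
      then have "openin T1 (\<Inter>n\<in>{n. n < N \<and> x \<in> A n}. A n)"
        using A by (intro openin_INT2) auto
      then show ?thesis unfolding V_def by auto
    qed (auto simp: V_def simp del: Collect_empty_eq)
    moreover have "x \<in> V" using x by (auto simp: V_def)
    moreover have "V \<subseteq> ?S"
    proof
      fix y assume y: "y \<in> V"
      have "(\<Union>n<N. D n x) \<subseteq> (\<Union>n. D n y)"
        using y by (auto simp: D_def V_def split: if_splits)
      moreover have "(\<Union>n. D n y) \<in> sets M2" by (auto simp: D_def B_sets)
      ultimately have "measure M2 (\<Union>n<N. D n x) \<le> measure M2 (\<Union>n. D n y)"
        by (intro M2.finite_measure_mono)
      with N y show "y \<in> ?S" unfolding sect by (auto simp: V_def)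
    qed
    ultimately show "\<exists>V. openin T1 V \<and> x \<in> V \<and> V \<subseteq> ?S" by blast
  qed
qed

lemma second_countable_prod_topology:
  assumes "second_countable T1" "second_countable T2"
  shows "second_countable (prod_topology T1 T2)"
proof -
  from second_countable_rectangles[OF assms] obtain \<R> where \<R>: "countable \<R>"
    "\<forall>r\<in>\<R>. openin T1 (fst r) \<and> openin T2 (snd r)"
    "\<forall>W z. openin (prod_topology T1 T2) W \<longrightarrow> z \<in> W \<longrightarrow> (\<exists>r\<in>\<R>. z \<in> fst r \<times> snd r \<and> fst r \<times> snd r \<subseteq> W)"
    by (elim exE conjE)
  show ?thesis
    unfolding second_countable_def
  proof (intro exI[of _ "(\<lambda>r. fst r \<times> snd r) ` \<R>"] conjI allI impI ballI)
    show "countable ((\<lambda>r. fst r \<times> snd r) ` \<R>)" using \<R>(1) by auto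
    show "openin (prod_topology T1 T2) V" if "V \<in> (\<lambda>r. fst r \<times> snd r) ` \<R>" for V
      using that \<R>(2) by (auto simp: openin_prod_Times_iff)
    fix W z assume W: "openin (prod_topology T1 T2) W \<and> z \<in> W"
    from \<R>(3)[rule_format, OF conjunct1[OF W] conjunct2[OF W]]
    obtain r where "r \<in> \<R>" "z \<in> fst r \<times> snd r" "fst r \<times> snd r \<subseteq> W" by (elim bexE conjE)
    then show "\<exists>V\<in>(\<lambda>r. fst r \<times> snd r) ` \<R>. z \<in> V \<and> V \<subseteq> W"
      by (intro bexI[of _ "fst r \<times> snd r"]) auto
  qed
qed

lemma pspace_pair:
  assumes "pspace T1 M1" "pspace T2 M2"
  shows "pspace (prod_topology T1 T2) (M1 \<Otimes>\<^sub>M M2)"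
proof -
  interpret M1: prob_space M1 using assms by (simp add: pspace_def)
  interpret M2: prob_space M2 using assms by (simp add: pspace_def)
  interpret pair_prob_space M1 M2 ..
  show ?thesis
    using assms second_countable_prod_topology measure_lsc_section(2)[OF assms]
    by (auto simp: pspace_def space_pair_measure prob_space_axioms)
qed

section \<open>Internal maps and integrals of internal functions\<close>

context ultra begin

definition umap :: "(nat \<Rightarrow> 'a \<Rightarrow> 'b) \<Rightarrow> 'a upoint \<Rightarrow> 'b upoint" where
  "umap h x = uclass \<omega> (\<lambda>i. h i (urep x i))"

lemma umap_uclass: "umap h (uclass \<omega> f) = uclass \<omega> (\<lambda>i. h i (f i))"
  unfolding umap_def uclass_eq_iff using urep_uclass[of f] by eventually_elim auto

lemma umap_umap: "umap g (umap h x) = umap (\<lambda>i a. g i (h i a)) x"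
  unfolding umap_def[of h] umap_uclass by (simp add: umap_def)

lemma umap_in_uprod:
  assumes "x \<in> uprod \<omega> X" "eventually (\<lambda>i. \<forall>a\<in>X i. h i a \<in> Y i) \<omega>"
  shows "umap h x \<in> uprod \<omega> Y"
  unfolding umap_def uclass_in_uprod using uprod_urep(1)[OF assms(1)] assms(2)
  by eventually_elim auto

lemma umap_vimage: "umap h -` uprod \<omega> U \<inter> uprod \<omega> X = uprod \<omega> (\<lambda>i. h i -` U i \<inter> X i)"
proof -
  have "x \<in> umap h -` uprod \<omega> U \<inter> uprod \<omega> X \<longleftrightarrow> x \<in> uprod \<omega> (\<lambda>i. h i -` U i \<inter> X i)" for x
  proof (cases "\<exists>f. x = uclass \<omega> f")
    case True
    then show ?thesis by (auto simp: uclass_in_uprod eventually_conj_iff umap_uclass)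
  qed (auto simp: uprod_def)
  then show ?thesis by auto
qed

lemma measurable_umap:
  assumes "eventually (\<lambda>i. continuous_map (T i) (T' i) (h i)) \<omega>"
  shows "umap h \<in> L T M \<rightarrow>\<^sub>M L T' M'"
proof (rule measurable_sigma_sets[OF sets_L])
  show "uprod \<omega> ` {U. uopen T' U} \<subseteq> Pow (uprod \<omega> (\<lambda>i. topspace (T' i)))"
    using uopen_subset by blast
  show "umap h \<in> space (L T M) \<rightarrow> uprod \<omega> (\<lambda>i. topspace (T' i))"
    unfolding space_L
    by (intro Pi_I umap_in_uprod, assumption)
      (use assms in eventually_elim, auto simp: continuous_map_def)
  fix A assume "A \<in> uprod \<omega> ` {U. uopen T' U}"
  then obtain U where U: "A = uprod \<omega> U" "uopen T' U" by blast
  have "uopen T (\<lambda>i. h i -` U i \<inter> topspace (T i))"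
    using assms U(2)
    by eventually_elim (auto simp: continuous_map_def vimage_def Int_def conj_commute)
  then show "umap h -` A \<inter> space (L T M) \<in> sets (L T M)"
    unfolding U(1) space_L umap_vimage by blast
qed

text \<open>Only open sets are tested at each index, since \<open>measure_eqI_L\<close> looks only
  at internal open sets, and their preimages under an internal continuous map are again of this
  kind.\<close>

lemma distr_umap:
  assumes us: "uspace T M" "uspace T' M'"
    and cont: "eventually (\<lambda>i. continuous_map (T i) (T' i) (h i)) \<omega>"
    and meas: "eventually (\<lambda>i. \<forall>U. openin (T' i) U \<longrightarrow>
        measure (M' i) U = measure (M i) (h i -` U \<inter> topspace (T i))) \<omega>"
  shows "distr (L T M) (L T' M') (umap h) = L T' M'"
proof (rule measure_eqI_L[OF us(2)])
  note [measurable] = measurable_umap[OF cont]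
  interpret prob_space "L T M" by (rule prob_space_L[OF us(1)])
  show "prob_space (distr (L T M) (L T' M') (umap h))" by (rule prob_space_distr) measurable
  fix U assume U: "uopen T' U"
  have op: "uopen T (\<lambda>i. h i -` U i \<inter> topspace (T i))"
    using cont U
    by eventually_elim (auto simp: continuous_map_def vimage_def Int_def conj_commute)
  have "((\<lambda>i. measure (M i) (h i -` U i \<inter> topspace (T i))) \<longlongrightarrow>
      measure (L T M) (umap h -` uprod \<omega> U \<inter> space (L T M))) \<omega>"
    unfolding space_L umap_vimage by (rule measure_L[OF us(1) op])
  also have "measure (L T M) (umap h -` uprod \<omega> U \<inter> space (L T M)) =
      measure (distr (L T M) (L T' M') (umap h)) (uprod \<omega> U)"
    using U by (subst measure_distr) auto
  finally show "((\<lambda>i. measure (M' i) (U i)) \<longlongrightarrow>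
      measure (distr (L T M) (L T' M') (umap h)) (uprod \<omega> U)) \<omega>"
  proof (rule Lim_transform_eventually)
    show "eventually (\<lambda>i. measure (M i) (h i -` U i \<inter> topspace (T i)) = measure (M' i) (U i)) \<omega>"
      using meas U by eventually_elim auto
  qed
qed auto

text \<open>The integral of a function with values in \<open>{0..1}\<close> is approximated within
  \<open>1 / m\<close> by the average of the measures of its superlevel sets at the levels
  \<open>k / m\<close>. Lower semicontinuity makes these sets open, so their measures converge along
  \<omega> to those of their ultraproducts, and the latter approximate the integral of the limit
  function equally well.\<close>

lemma integral_internal:
  fixes g :: "nat \<Rightarrow> 'a \<Rightarrow> real"
  assumes us: "uspace T M"
    and g01: "eventually (\<lambda>i. \<forall>x\<in>topspace (T i). 0 \<le> g i x \<and> g i x \<le> 1) \<omega>"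
    and lsc: "eventually (\<lambda>i. \<forall>q. openin (T i) {x \<in> topspace (T i). q < g i x}) \<omega>"
    and G: "\<And>x. x \<in> space (L T M) \<Longrightarrow> ((\<lambda>i. g i (urep x i)) \<longlongrightarrow> G x) \<omega>"
  shows "G \<in> borel_measurable (L T M)"
    and "((\<lambda>i. \<integral>x. g i x \<partial>M i) \<longlongrightarrow> (\<integral>x. G x \<partial>L T M)) \<omega>"
proof -
  interpret LM: prob_space "L T M" by (rule prob_space_L[OF us])
  have ps: "eventually (\<lambda>i. pspace (T i) (M i)) \<omega>" using us by (simp add: uspace_def)
  define U where "U q i = {x \<in> topspace (T i). q < g i x}" for q i
  have U: "uopen T (U q)" for q unfolding U_def using lsc by eventually_elim auto
  have top: "eventually (\<lambda>i. urep x i \<in> topspace (T i)) \<omega>" if "x \<in> space (L T M)" for x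
    using that unfolding space_L by (rule uprod_urep)
  have inU: "x \<in> uprod \<omega> (U q) \<longleftrightarrow> eventually (\<lambda>i. q < g i (urep x i)) \<omega>"
    if x: "x \<in> space (L T M)" for x q
  proof -
    have "x \<in> uprod \<omega> (U q) \<longleftrightarrow> uclass \<omega> (urep x) \<in> uprod \<omega> (U q)"
      using x unfolding space_L by (simp add: uprod_urep(2))
    also have "\<dots> \<longleftrightarrow> eventually (\<lambda>i. q < g i (urep x i)) \<omega>"
      unfolding uclass_in_uprod U_def
      by (rule eventually_subst) (use top[OF x] in eventually_elim, auto)
    finally show ?thesis .
  qed
  show meas: "G \<in> borel_measurable (L T M)"
  proof (subst borel_measurable_iff_greater, intro allI)
    fix a :: real
    \<comment> \<open>The internal superlevel set at level \<open>a\<close> can contain points whose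
      limit is exactly \<open>a\<close>; rational levels strictly above \<open>a\<close> exclude
      them.\<close>
    have "{x \<in> space (L T M). a < G x} = (\<Union>q\<in>{q\<in>\<rat>. a < q}. uprod \<omega> (U q))"
    proof (intro equalityI subsetI)
      fix x assume x: "x \<in> {x \<in> space (L T M). a < G x}"
      then obtain q where q: "q \<in> \<rat>" "a < q" "q < G x" using Rats_dense_in_real by blast
      have "eventually (\<lambda>i. q < g i (urep x i)) \<omega>"
        using G[of x] x q by (intro order_tendstoD) auto
      then show "x \<in> (\<Union>q\<in>{q\<in>\<rat>. a < q}. uprod \<omega> (U q))" using x q inU by auto
    next
      fix x assume "x \<in> (\<Union>q\<in>{q\<in>\<rat>. a < q}. uprod \<omega> (U q))"
      then obtain q where q: "a < q" "x \<in> uprod \<omega> (U q)" by auto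
      then have x: "x \<in> space (L T M)" using uopen_subset[OF U] by (auto simp: space_L)
      then have "eventually (\<lambda>i. q \<le> g i (urep x i)) \<omega>"
        using q inU by (auto elim: eventually_mono)
      then have "q \<le> G x" by (intro tendsto_lowerbound[OF G[OF x]]) auto
      then show "x \<in> {x \<in> space (L T M). a < G x}" using q x by auto
    qed
    moreover have "(\<Union>q\<in>{q\<in>\<rat>. a < q}. uprod \<omega> (U q)) \<in> sets (L T M)"
      by (intro sets.countable_UN') (auto simp: countable_rat intro: countable_subset[OF _ countable_rat] U)
    ultimately show "{x \<in> space (L T M). a < G x} \<in> sets (L T M)" by simp
  qed
  have G01: "0 \<le> G x" "G x \<le> 1" if x: "x \<in> space (L T M)" for x
  proof -
    have ev: "eventually (\<lambda>i. 0 \<le> g i (urep x i)) \<omega>" "eventually (\<lambda>i. g i (urep x i) \<le> 1) \<omega>"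
      using g01 top[OF x] by (eventually_elim, auto)+
    show "0 \<le> G x" "G x \<le> 1"
      by (rule tendsto_lowerbound[OF G[OF x] ev(1) nonbot])
         (rule tendsto_upperbound[OF G[OF x] ev(2) nonbot])
  qed
  have intG: "integrable (L T M) G"
    by (rule LM.integrable_const_bound[where B=1]) (use meas G01 in \<open>auto intro!: AE_I2\<close>)
  \<comment> \<open>The sum counts the levels below \<open>y\<close>. The count is the ceiling of
    \<open>m * y\<close>, so rounding costs at most one level.\<close>
  have count: "y \<le> (\<Sum>k<m. of_bool (real k / m < y)) / m \<and> (\<Sum>k<m. of_bool (real k / m < y)) / m \<le> y + 1 / m"
    if "0 \<le> y" "y \<le> 1" "m > 0" for y :: real and m :: nat
  proof -
    have "{k. k < m \<and> real k / m < y} = {..<nat \<lceil>m * y\<rceil>}"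
    proof -
      have "k < m \<and> real k / m < y \<longleftrightarrow> k < nat \<lceil>m * y\<rceil>" for k
      proof -
        have "k < nat \<lceil>m * y\<rceil> \<longleftrightarrow> real k < m * y"
          by (simp add: zless_nat_eq_int_zless less_ceiling_iff)
        moreover have "real k < m * y \<Longrightarrow> k < m"
          using that by (smt (verit) mult_left_le of_nat_0_le_iff of_nat_less_iff)
        ultimately show ?thesis using that by (auto simp: field_simps)
      qed
      then show ?thesis by auto
    qed
    moreover have "(\<Sum>k<m. of_bool (real k / m < y)) = real (card {k. k < m \<and> real k / m < y})"
      by (simp add: of_bool_def sum.If_cases Int_def conj_commute)
    moreover have "real (nat \<lceil>m * y\<rceil>) \<ge> m * y" "real (nat \<lceil>m * y\<rceil>) \<le> m * y + 1"
      using that by (simp_all add: of_nat_nat)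
    ultimately show ?thesis using that by (simp add: field_simps)
  qed
  \<comment> \<open>Three errors of \<open>1 / m\<close>: the step function at index
    \<open>i\<close>, the step function in the limit, and the convergence of \<open>J\<close> to
    \<open>J'\<close>.\<close>
  have approx: "eventually (\<lambda>i. \<bar>(\<integral>x. g i x \<partial>M i) - (\<integral>x. G x \<partial>L T M)\<bar> < 3 / m) \<omega>" if m: "m > 0" for m :: nat
  proof -
    define J where "J i = (\<Sum>k<m. measure (M i) (U (real k / m) i)) / m" for i
    define J' where "J' = (\<Sum>k<m. measure (L T M) (uprod \<omega> (U (real k / m)))) / m"
    have lim: "(J \<longlongrightarrow> J') \<omega>"
      unfolding J_def J'_def by (intro tendsto_intros measure_L[OF us U]) (use m in auto)
    have 1: "eventually (\<lambda>i. \<bar>(\<integral>x. g i x \<partial>M i) - J i\<bar> \<le> 1 / m) \<omega>"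
      using ps g01 lsc
    proof eventually_elim
      case (elim i)
      interpret Mi: prob_space "M i" using elim(1) by (simp add: pspace_def)
      have sp: "space (M i) = topspace (T i)" using elim(1) by (simp add: pspace_def)
      have Us: "U q i \<in> sets (M i)" for q using elim by (auto simp: pspace_def U_def)
      have gm: "g i \<in> borel_measurable (M i)"
        unfolding borel_measurable_iff_greater using Us by (auto simp: U_def sp)
      have gi: "integrable (M i) (g i)"
        by (rule Mi.integrable_const_bound[where B=1]) (use gm elim(2) in \<open>auto intro!: AE_I2 simp: sp\<close>)
      define s where "s x = (\<Sum>k<m. indicator (U (real k / m) i) x) / real m" for x
      have si: "integrable (M i) s"
        unfolding s_def using Us by (auto simp: Mi.emeasure_eq_measure)
      have sJ: "(\<integral>x. s x \<partial>M i) = J i"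
        unfolding s_def J_def using Us by (subst integral_divide_zero)
          (simp add: Mi.emeasure_eq_measure Bochner_Integration.integral_sum)
      have sx: "g i x \<le> s x \<and> s x \<le> g i x + 1 / m" if "x \<in> space (M i)" for x
      proof -
        have "s x = (\<Sum>k<m. of_bool (real k / m < g i x)) / m"
          using that by (simp add: s_def U_def sp indicator_def of_bool_def)
        then show ?thesis using count[of "g i x" m] elim(2) that m by (auto simp: sp)
      qed
      have "(\<integral>x. g i x \<partial>M i) \<le> (\<integral>x. s x \<partial>M i)"
        by (rule integral_mono[OF gi si]) (use sx in auto)
      moreover have "(\<integral>x. s x \<partial>M i) \<le> (\<integral>x. g i x + 1 / m \<partial>M i)"
        by (rule integral_mono[OF si]) (use sx gi in auto)
      moreover have "(\<integral>x. g i x + 1 / m \<partial>M i) = (\<integral>x. g i x \<partial>M i) + 1 / m"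
        using gi by (simp add: Mi.prob_space)
      ultimately show ?case by (simp add: sJ)
    qed
    have 2: "\<bar>(\<integral>x. G x \<partial>L T M) - J'\<bar> \<le> 1 / m"
    proof -
      define s where "s x = (\<Sum>k<m. indicator (uprod \<omega> (U (real k / m))) x) / real m" for x
      have si: "integrable (L T M) s"
        unfolding s_def using sets_L_uprod[OF U] by (auto simp: LM.emeasure_eq_measure)
      have sJ: "(\<integral>x. s x \<partial>L T M) = J'"
        unfolding s_def J'_def using sets_L_uprod[OF U] by (subst integral_divide_zero)
          (simp add: LM.emeasure_eq_measure Bochner_Integration.integral_sum)
      have sx: "G x \<le> s x \<and> s x \<le> G x + 1 / m" if x: "x \<in> space (L T M)" for x
      proof -
        \<comment> \<open>Membership in the ultraproduct reflects \<open>g i\<close>, not its limit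
          \<open>G\<close>. The comparison is therefore made at a common index for all
          \<open>m\<close> levels and only then passed to the limit.\<close>
        have "eventually (\<lambda>i. of_bool (real k / m < g i (urep x i)) = (indicator (uprod \<omega> (U (real k / m))) x :: real)) \<omega>" for k
        proof (cases "x \<in> uprod \<omega> (U (real k / m))")
          case True
          then have "eventually (\<lambda>i. real k / m < g i (urep x i)) \<omega>" using inU[OF x] by simp
          then show ?thesis using True by (auto elim: eventually_mono)
        next
          case False
          then have "eventually (\<lambda>i. \<not> real k / m < g i (urep x i)) \<omega>" using inU[OF x] by (simp add: ev_not_iff)
          then show ?thesis using False by (auto elim: eventually_mono)
        qed
        then have "eventually (\<lambda>i. \<forall>k\<in>{..<m}. of_bool (real k / m < g i (urep x i)) = (indicator (uprod \<omega> (U (real k / m))) x :: real)) \<omega>"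
          by (intro eventually_ball_finite) auto
        then have ev: "eventually (\<lambda>i. g i (urep x i) \<le> s x \<and> s x \<le> g i (urep x i) + 1 / m) \<omega>"
          using g01 top[OF x]
        proof eventually_elim
          case (elim i)
          have "s x = (\<Sum>k<m. of_bool (real k / m < g i (urep x i))) / m"
            using elim(1) by (simp add: s_def)
          then show ?case using count[of "g i (urep x i)" m] elim m by auto
        qed
        have "G x \<le> s x"
          by (rule tendsto_upperbound[OF G[OF x]]) (use ev in \<open>auto elim: eventually_mono\<close>)
        moreover have "s x \<le> G x + 1 / m"
          by (rule tendsto_lowerbound[OF tendsto_add[OF G[OF x] tendsto_const]])
            (use ev in \<open>auto elim: eventually_mono\<close>)
        ultimately show ?thesis by simp
      qed
      have "(\<integral>x. G x \<partial>L T M) \<le> (\<integral>x. s x \<partial>L T M)"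
        by (rule integral_mono[OF intG si]) (use sx in auto)
      moreover have "(\<integral>x. s x \<partial>L T M) \<le> (\<integral>x. G x + 1 / m \<partial>L T M)"
        by (rule integral_mono[OF si]) (use sx intG in auto)
      moreover have "(\<integral>x. G x + 1 / m \<partial>L T M) = (\<integral>x. G x \<partial>L T M) + 1 / m"
        using intG by (simp add: LM.prob_space)
      ultimately show ?thesis by (simp add: sJ)
    qed
    have "eventually (\<lambda>i. dist (J i) J' < 1 / m) \<omega>"
      using lim m by (intro tendstoD) auto
    with 1 show ?thesis
    proof eventually_elim
      case (elim i)
      have "3 / real m = 1 / m + 1 / m + 1 / m" by simp
      with elim 2 show ?case unfolding dist_real_def by linarith
    qed
  qed
  show "((\<lambda>i. \<integral>x. g i x \<partial>M i) \<longlongrightarrow> (\<integral>x. G x \<partial>L T M)) \<omega>"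
  proof (rule tendstoI)
    fix e :: real assume "e > 0"
    then obtain m where "inverse (real (Suc m)) < e / 3" using reals_Archimedean[of "e/3"] by auto
    then have "3 / real (Suc m) < e" by (simp add: field_simps)
    with approx[of "Suc m"] show "eventually (\<lambda>i. dist (\<integral>x. g i x \<partial>M i) (\<integral>x. G x \<partial>L T M) < e) \<omega>"
      by (auto simp: dist_real_def elim!: eventually_mono)
  qed
qed

end

lemma measure_pair_eq_integral:
  assumes "prob_space M1" "prob_space M2" "W \<in> sets (M1 \<Otimes>\<^sub>M M2)"
  shows "(\<integral>x. measure M2 (Pair x -` W) \<partial>M1) = measure (M1 \<Otimes>\<^sub>M M2) W"
proof -
  interpret M1: prob_space M1 by fact
  interpret M2: prob_space M2 by fact
  interpret P: pair_prob_space M1 M2 ..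
  have m: "(\<lambda>x. measure M2 (Pair x -` W)) \<in> borel_measurable M1"
    using M2.measurable_emeasure_Pair[OF assms(3)] unfolding measure_def by simp
  have "ennreal (measure (M1 \<Otimes>\<^sub>M M2) W) = (\<integral>\<^sup>+x. emeasure M2 (Pair x -` W) \<partial>M1)"
    using M2.emeasure_pair_measure_alt[OF assms(3)] by (simp add: P.emeasure_eq_measure)
  also have "\<dots> = (\<integral>\<^sup>+x. ennreal (measure M2 (Pair x -` W)) \<partial>M1)"
    by (simp add: M2.emeasure_eq_measure)
  also have "\<dots> = ennreal (\<integral>x. measure M2 (Pair x -` W) \<partial>M1)"
    by (intro nn_integral_eq_integral M1.integrable_const_bound[where B=1] m) auto
  finally show ?thesis by (simp add: integral_nonneg_AE)
qed

section \<open>Bounded measurable functions\<close>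

text \<open>Bounded everywhere rather than almost everywhere: composites with measurable maps then
  stay bounded even if the map has a null image, as the inclusion of a fibre can have.\<close>

definition bm :: "'a measure \<Rightarrow> ('a \<Rightarrow> complex) \<Rightarrow> bool" where
  "bm M f \<longleftrightarrow> f \<in> borel_measurable M \<and> (\<exists>C. \<forall>x\<in>space M. cmod (f x) \<le> C)"

lemma bmI: "f \<in> borel_measurable M \<Longrightarrow> (\<And>x. x \<in> space M \<Longrightarrow> cmod (f x) \<le> C) \<Longrightarrow> bm M f"
  by (auto simp: bm_def)

lemma bm_meas: "bm M f \<Longrightarrow> f \<in> borel_measurable M"
  by (simp add: bm_def)

lemma bmE:
  assumes "bm M f"
  obtains C where "C \<ge> 0" "\<And>x. x \<in> space M \<Longrightarrow> cmod (f x) \<le> C"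
proof -
  from assms obtain C where C: "\<forall>x\<in>space M. cmod (f x) \<le> C" by (auto simp: bm_def)
  show thesis
    by (rule that[of "max C 0"]) (use C in \<open>auto simp: le_max_iff_disj\<close>)
qed

lemma bm_const [intro]: "bm M (\<lambda>_. c)"
  by (auto simp: bm_def)

lemma bm_cong: "(\<And>x. x \<in> space M \<Longrightarrow> f x = g x) \<Longrightarrow> bm M f \<longleftrightarrow> bm M g"
  unfolding bm_def by (simp cong: measurable_cong)

lemma bm_mult [intro]: assumes "bm M f" "bm M g" shows "bm M (\<lambda>x. f x * g x)"
proof -
  obtain C D where C: "C \<ge> 0" "\<And>x. x \<in> space M \<Longrightarrow> cmod (f x) \<le> C"
    and D: "D \<ge> 0" "\<And>x. x \<in> space M \<Longrightarrow> cmod (g x) \<le> D" using assms by (auto elim!: bmE)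
  have [measurable]: "f \<in> borel_measurable M" "g \<in> borel_measurable M" using assms by (auto simp: bm_def)
  show ?thesis
    by (rule bmI[where C="C*D"]) (use C D in \<open>auto simp: norm_mult intro!: mult_mono\<close>)
qed

lemma bm_add [intro]: assumes "bm M f" "bm M g" shows "bm M (\<lambda>x. f x + g x)"
proof -
  obtain C D where C: "C \<ge> 0" "\<And>x. x \<in> space M \<Longrightarrow> cmod (f x) \<le> C"
    and D: "D \<ge> 0" "\<And>x. x \<in> space M \<Longrightarrow> cmod (g x) \<le> D" using assms by (auto elim!: bmE)
  have [measurable]: "f \<in> borel_measurable M" "g \<in> borel_measurable M" using assms by (auto simp: bm_def)
  show ?thesis
    by (rule bmI[where C="C+D"]) (use C D in \<open>auto intro!: norm_triangle_mono\<close>)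
qed

lemma bm_cnj [intro]: assumes "bm M f" shows "bm M (\<lambda>x. cnj (f x))"
proof -
  have "cnj \<in> borel_measurable borel"
    by (intro borel_measurable_continuous_onI) (intro continuous_intros)
  then show ?thesis using assms by (auto simp: bm_def intro: measurable_compose)
qed

lemma bm_cnj_pow [intro]: assumes "bm M f" shows "bm M (\<lambda>x. (cnj ^^ n) (f x))"
  by (induction n) (use assms in auto)

lemma bm_minus [intro]: assumes "bm M f" shows "bm M (\<lambda>x. - f x)"
  using bm_mult[OF bm_const[of M "-1"] assms] by simp

lemma bm_diff [intro]: assumes "bm M f" "bm M g" shows "bm M (\<lambda>x. f x - g x)"
  using bm_add[OF assms(1) bm_minus[OF assms(2)]] by simp

lemma bm_prod [intro]: "(\<And>i. i \<in> I \<Longrightarrow> bm M (f i)) \<Longrightarrow> bm M (\<lambda>x. \<Prod>i\<in>I. f i x)"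
  by (induction I rule: infinite_finite_induct) auto

lemma bm_compose: assumes "bm N f" "h \<in> M \<rightarrow>\<^sub>M N" shows "bm M (\<lambda>x. f (h x))"
  using assms by (auto simp: bm_def dest: measurable_space intro: measurable_compose)

lemma bm_indicator [intro]: "S \<in> sets M \<Longrightarrow> bm M (indicator S)"
  by (rule bmI[where C=1]) (auto simp: indicator_def)

lemma bm_integrable: assumes "finite_measure M" "bm M f" shows "integrable M f"
proof -
  interpret finite_measure M by fact
  from assms obtain C where "\<And>x. x \<in> space M \<Longrightarrow> cmod (f x) \<le> C" by (auto simp: bm_def)
  then show ?thesis using assms
    by (intro integrable_const_bound[where B=C]) (auto simp: bm_def intro!: AE_I2)
qed

lemma bm_subalg: "subalgebra M F \<Longrightarrow> bm F f \<Longrightarrow> bm M f"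
  by (auto simp: bm_def subalgebra_def intro: measurable_from_subalg[of M F])

section \<open>Fubini's theorem for ultraproducts\<close>

context ultra begin

definition upair :: "'a upoint \<Rightarrow> 'b upoint \<Rightarrow> ('a \<times> 'b) upoint" where
  "upair x y = uclass \<omega> (\<lambda>i. (urep x i, urep y i))"

definition umap2 :: "(nat \<Rightarrow> 'a \<Rightarrow> 'b \<Rightarrow> 'c) \<Rightarrow> 'a upoint \<Rightarrow> 'b upoint \<Rightarrow> 'c upoint" where
  "umap2 m x y = uclass \<omega> (\<lambda>i. m i (urep x i) (urep y i))"

abbreviation "pT T1 T2 \<equiv> (\<lambda>i::nat. prod_topology (T1 i) (T2 i))"
abbreviation "pM M1 M2 \<equiv> (\<lambda>i::nat. M1 i \<Otimes>\<^sub>M M2 i)"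
abbreviation "ufst \<equiv> umap (\<lambda>_. fst)"
abbreviation "usnd \<equiv> umap (\<lambda>_. snd)"

lemma uspace_pair: "uspace T1 M1 \<Longrightarrow> uspace T2 M2 \<Longrightarrow> uspace (pT T1 T2) (pM M1 M2)"
  unfolding uspace_def by (erule (1) eventually_elim2) (rule pspace_pair)

lemma upair_eq_umap: "upair x = umap (\<lambda>i b. (urep x i, b))"
  by (rule ext) (simp add: upair_def umap_def)

lemma ufst_upair: "x \<in> uprod \<omega> X \<Longrightarrow> ufst (upair x y) = x"
  and usnd_upair: "y \<in> uprod \<omega> Y \<Longrightarrow> usnd (upair x y) = y"
  unfolding upair_def umap_uclass by (simp_all add: uprod_urep(2))

lemma umap2_proj: "umap2 m (ufst z) (usnd z) = umap (\<lambda>i p. m i (fst p) (snd p)) z"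
  unfolding umap2_def unfolding umap_def uclass_eq_iff
  using urep_uclass[of "\<lambda>i. fst (urep z i)"] urep_uclass[of "\<lambda>i. snd (urep z i)"]
  by eventually_elim simp

lemma ev_topspace: "x \<in> space (L T M) \<Longrightarrow> eventually (\<lambda>i. urep x i \<in> topspace (T i)) \<omega>"
  unfolding space_L by (rule uprod_urep(1))

lemma measurable_upair:
  assumes "x \<in> space (L T1 M1)"
  shows "upair x \<in> L T2 M2 \<rightarrow>\<^sub>M L (pT T1 T2) M"
  unfolding upair_eq_umap
  by (rule measurable_umap, use ev_topspace[OF assms] in eventually_elim)
    (auto intro!: continuous_map_pairedI)

text \<open>The fibre over \<open>x\<close> of an internal open set is the ultraproduct of the
  fibres over the coordinates of \<open>x\<close>, and these are open.\<close>

lemma upair_section: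
  assumes us: "uspace T1 M1" "uspace T2 M2"
    and x: "x \<in> space (L T1 M1)" and W: "uopen (pT T1 T2) W"
  shows "((\<lambda>i. measure (M2 i) (Pair (urep x i) -` W i)) \<longlongrightarrow>
    measure (distr (L T2 M2) (L (pT T1 T2) (pM M1 M2)) (upair x)) (uprod \<omega> W)) \<omega>"
proof -
  have op: "uopen T2 (\<lambda>i. Pair (urep x i) -` W i)"
    using W ev_topspace[OF x]
  proof eventually_elim
    case (elim i)
    have "openin (T2 i) {y \<in> topspace (T2 i). (urep x i, y) \<in> W i}"
      by (rule openin_continuous_map_preimage[OF _ elim(1)])
        (use elim(2) in \<open>auto intro!: continuous_map_pairedI\<close>)
    moreover have "{y \<in> topspace (T2 i). (urep x i, y) \<in> W i} = Pair (urep x i) -` W i"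
      using openin_subset[OF elim(1)] by auto
    ultimately show ?case by simp
  qed
  have "upair x -` uprod \<omega> W \<inter> space (L T2 M2) = uprod \<omega> (\<lambda>i. Pair (urep x i) -` W i \<inter> topspace (T2 i))"
    unfolding upair_eq_umap space_L umap_vimage by (rule refl)
  also have "\<dots> = uprod \<omega> (\<lambda>i. Pair (urep x i) -` W i)"
    unfolding uprod_eq_iff using op by eventually_elim (auto dest: openin_subset)
  finally have eq: "upair x -` uprod \<omega> W \<inter> space (L T2 M2) = uprod \<omega> (\<lambda>i. Pair (urep x i) -` W i)" .
  show ?thesis
    using measure_L[OF us(2) op] measurable_upair[OF x] W
    by (subst measure_distr) (auto simp: eq)
qed

text \<open>The kernel places the second measure on the fibre over \<open>x\<close>. Its
  measurability in \<open>x\<close> comes from \<open>integral_internal\<close>, whose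
  semicontinuity hypothesis holds for section measures. The mixture of the kernel has the right
  limits on internal open sets and therefore is the measure of the ultraproduct of the products.
  Phrasing Fubini's theorem as a \<open>bind\<close> carries it from sets to functions.\<close>

lemma
  assumes us: "uspace T1 M1" "uspace T2 M2"
  defines "\<kappa> \<equiv> \<lambda>x. distr (L T2 M2) (L (pT T1 T2) (pM M1 M2)) (upair x)"
  shows measurable_kernel: "\<kappa> \<in> L T1 M1 \<rightarrow>\<^sub>M subprob_algebra (L (pT T1 T2) (pM M1 M2))"
    and bind_kernel: "L T1 M1 \<bind> \<kappa> = L (pT T1 T2) (pM M1 M2)"
proof -
  let ?L1 = "L T1 M1" and ?L2 = "L T2 M2" and ?L12 = "L (pT T1 T2) (pM M1 M2)"
  interpret L1: prob_space ?L1 by (rule prob_space_L[OF us(1)])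
  interpret L2: prob_space ?L2 by (rule prob_space_L[OF us(2)])
  have us12: "uspace (pT T1 T2) (pM M1 M2)" by (rule uspace_pair[OF us])
  have ps: "eventually (\<lambda>i. pspace (T1 i) (M1 i) \<and> pspace (T2 i) (M2 i)) \<omega>"
    using us unfolding uspace_def by eventually_elim auto
  have pk: "prob_space (\<kappa> x)" if "x \<in> space ?L1" for x
    unfolding \<kappa>_def by (rule L2.prob_space_distr[OF measurable_upair[OF that]])
  have sk: "sets (\<kappa> x) = sets ?L12" for x by (simp add: \<kappa>_def)
  have kem: "emeasure (\<kappa> x) S = ennreal (measure (\<kappa> x) S)" if "x \<in> space ?L1" for x S
    using pk[OF that] by (simp add: finite_measure.emeasure_eq_measure prob_space.finite_measure)
  have int: "(\<lambda>x. measure (\<kappa> x) (uprod \<omega> W)) \<in> borel_measurable ?L1"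
    "((\<lambda>i. measure (M1 i \<Otimes>\<^sub>M M2 i) (W i)) \<longlongrightarrow> (\<integral>x. measure (\<kappa> x) (uprod \<omega> W) \<partial>?L1)) \<omega>"
    if W: "uopen (pT T1 T2) W" for W
  proof -
    have 1: "eventually (\<lambda>i. \<forall>x\<in>topspace (T1 i). 0 \<le> measure (M2 i) (Pair x -` W i) \<and>
        measure (M2 i) (Pair x -` W i) \<le> 1) \<omega>"
      using ps by eventually_elim (auto simp: pspace_def prob_space.prob_le_1)
    have 2: "eventually (\<lambda>i. \<forall>q. openin (T1 i) {x \<in> topspace (T1 i). q < measure (M2 i) (Pair x -` W i)}) \<omega>"
      using ps W by eventually_elim (auto intro: measure_lsc_section(1))
    have 3: "((\<lambda>i. measure (M2 i) (Pair (urep x i) -` W i)) \<longlongrightarrow> measure (\<kappa> x) (uprod \<omega> W)) \<omega>"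
      if "x \<in> space ?L1" for x
      unfolding \<kappa>_def by (rule upair_section[OF us that W])
    show "(\<lambda>x. measure (\<kappa> x) (uprod \<omega> W)) \<in> borel_measurable ?L1"
      by (rule integral_internal(1)[OF us(1) 1 2 3])
    have "((\<lambda>i. \<integral>x. measure (M2 i) (Pair x -` W i) \<partial>M1 i) \<longlongrightarrow> (\<integral>x. measure (\<kappa> x) (uprod \<omega> W) \<partial>?L1)) \<omega>"
      by (rule integral_internal(2)[OF us(1) 1 2 3])
    then show "((\<lambda>i. measure (M1 i \<Otimes>\<^sub>M M2 i) (W i)) \<longlongrightarrow> (\<integral>x. measure (\<kappa> x) (uprod \<omega> W) \<partial>?L1)) \<omega>"
    proof (rule Lim_transform_eventually)
      show "eventually (\<lambda>i. (\<integral>x. measure (M2 i) (Pair x -` W i) \<partial>M1 i) = measure (M1 i \<Otimes>\<^sub>M M2 i) (W i)) \<omega>"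
        using ps W
      proof eventually_elim
        case (elim i)
        then show ?case
          by (intro measure_pair_eq_integral measure_lsc_section(2)[of "T1 i" _ "T2 i"])
            (auto simp: pspace_def)
      qed
    qed
  qed
  have emm: "(\<lambda>x. emeasure (\<kappa> x) (uprod \<omega> W)) \<in> borel_measurable ?L1" if "uopen (pT T1 T2) W" for W
  proof -
    have "(\<lambda>x. ennreal (measure (\<kappa> x) (uprod \<omega> W))) \<in> borel_measurable ?L1"
      using int(1)[OF that] by simp
    then show ?thesis
      by (subst measurable_cong[where g="\<lambda>x. ennreal (measure (\<kappa> x) (uprod \<omega> W))"]) (auto simp: kem)
  qed
  show km: "\<kappa> \<in> ?L1 \<rightarrow>\<^sub>M subprob_algebra ?L12"
  proof (rule measurable_subprob_algebra_generated[OF sets_L Int_stable_uopen])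
    show "uprod \<omega> ` {U. uopen (pT T1 T2) U} \<subseteq> Pow (uprod \<omega> (\<lambda>i. topspace (prod_topology (T1 i) (T2 i))))"
      using uopen_subset[of "pT T1 T2"] by blast
    show "(\<lambda>a. emeasure (\<kappa> a) (uprod \<omega> (\<lambda>i. topspace (prod_topology (T1 i) (T2 i))))) \<in> borel_measurable ?L1"
      by (rule emm) (intro always_eventually allI openin_topspace)
  qed (use pk sk emm in \<open>auto intro: prob_space_imp_subprob_space\<close>)
  have ne: "space ?L1 \<noteq> {}" by (rule L1.not_empty)
  have em: "emeasure (?L1 \<bind> \<kappa>) X = (\<integral>\<^sup>+x. emeasure (\<kappa> x) X \<partial>?L1)" if "X \<in> sets ?L12" for X
    by (rule emeasure_bind[OF ne km that])
  show "?L1 \<bind> \<kappa> = ?L12"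
  proof (rule measure_eqI_L[OF us12])
    show s: "sets (?L1 \<bind> \<kappa>) = sets ?L12"
      by (rule sets_bind[OF sk ne])
    then have sp: "space (?L1 \<bind> \<kappa>) = space ?L12" by (rule sets_eq_imp_space_eq)
    have "(\<integral>\<^sup>+x. emeasure (\<kappa> x) (space ?L12) \<partial>?L1) = (\<integral>\<^sup>+x. 1 \<partial>?L1)"
    proof (rule nn_integral_cong)
      fix x assume "x \<in> space ?L1"
      then have "emeasure (\<kappa> x) (space (\<kappa> x)) = 1" by (rule prob_space.emeasure_space_1[OF pk])
      then show "emeasure (\<kappa> x) (space ?L12) = 1" by (simp add: \<kappa>_def)
    qed
    then show "prob_space (?L1 \<bind> \<kappa>)"
      by (intro prob_spaceI) (simp add: sp em L1.emeasure_space_1)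
    fix W assume W: "uopen (pT T1 T2) W"
    have "emeasure (?L1 \<bind> \<kappa>) (uprod \<omega> W) = (\<integral>\<^sup>+x. ennreal (measure (\<kappa> x) (uprod \<omega> W)) \<partial>?L1)"
      using W by (subst em) (auto simp: kem intro!: nn_integral_cong)
    also have "\<dots> = ennreal (\<integral>x. measure (\<kappa> x) (uprod \<omega> W) \<partial>?L1)"
      by (intro nn_integral_eq_integral L1.integrable_const_bound[where B=1] int(1) W AE_I2)
        (auto simp: prob_space.prob_le_1 pk)
    finally have "measure (?L1 \<bind> \<kappa>) (uprod \<omega> W) = (\<integral>x. measure (\<kappa> x) (uprod \<omega> W) \<partial>?L1)"
      by (simp add: measure_def integral_nonneg_AE)
    with int(2)[OF W] show "((\<lambda>i. measure (M1 i \<Otimes>\<^sub>M M2 i) (W i)) \<longlongrightarrow> measure (?L1 \<bind> \<kappa>) (uprod \<omega> W)) \<omega>"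
      by simp
  qed
qed

lemma integral_upair:
  assumes us: "uspace T1 M1" "uspace T2 M2" and f: "bm (L (pT T1 T2) (pM M1 M2)) f"
  shows "\<And>x. x \<in> space (L T1 M1) \<Longrightarrow> bm (L T2 M2) (\<lambda>y. f (upair x y))"
    and "bm (L T1 M1) (\<lambda>x. \<integral>y. f (upair x y) \<partial>L T2 M2)"
    and "(\<integral>z. f z \<partial>L (pT T1 T2) (pM M1 M2)) = (\<integral>x. (\<integral>y. f (upair x y) \<partial>L T2 M2) \<partial>L T1 M1)"
proof -
  let ?L1 = "L T1 M1" and ?L2 = "L T2 M2" and ?L12 = "L (pT T1 T2) (pM M1 M2)"
  define \<kappa> where "\<kappa> = (\<lambda>x. distr ?L2 ?L12 (upair x))"
  interpret L1: prob_space ?L1 by (rule prob_space_L[OF us(1)])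
  interpret L2: prob_space ?L2 by (rule prob_space_L[OF us(2)])
  interpret L12: prob_space ?L12 by (rule prob_space_L[OF uspace_pair[OF us]])
  have km: "\<kappa> \<in> ?L1 \<rightarrow>\<^sub>M subprob_algebra ?L12"
    unfolding \<kappa>_def by (rule measurable_kernel[OF us])
  have bind: "?L1 \<bind> \<kappa> = ?L12"
    unfolding \<kappa>_def by (rule bind_kernel[OF us])
  have up: "upair x \<in> ?L2 \<rightarrow>\<^sub>M ?L12" if "x \<in> space ?L1" for x
    by (rule measurable_upair[OF that])
  have fm: "f \<in> borel_measurable ?L12" using f by (rule bm_meas)
  obtain C where C: "\<And>z. z \<in> space ?L12 \<Longrightarrow> cmod (f z) \<le> C" using f by (rule bmE) blast
  show sec: "bm ?L2 (\<lambda>y. f (upair x y))" if "x \<in> space ?L1" for x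
    by (rule bm_compose[OF f up[OF that]])
  have ik: "(\<integral>z. f z \<partial>\<kappa> x) = (\<integral>y. f (upair x y) \<partial>?L2)" if "x \<in> space ?L1" for x
    unfolding \<kappa>_def by (rule integral_distr[OF up[OF that] fm])
  have ik': "(\<integral>z. h (f z) \<partial>\<kappa> x) = (\<integral>y. h (f (upair x y)) \<partial>?L2)"
    if "x \<in> space ?L1" "h \<in> borel_measurable borel" for x and h :: "complex \<Rightarrow> real"
    unfolding \<kappa>_def by (rule integral_distr[OF up[OF that(1)]]) (rule measurable_compose[OF fm that(2)])
  have "(\<lambda>x. \<integral>z. f z \<partial>\<kappa> x) \<in> borel_measurable ?L1"
    by (rule measurable_compose[OF km integral_measurable_subprob_algebra[OF fm]])
  then have m: "(\<lambda>x. \<integral>y. f (upair x y) \<partial>?L2) \<in> borel_measurable ?L1"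
    by (subst measurable_cong[where g="\<lambda>x. \<integral>z. f z \<partial>\<kappa> x"]) (auto simp: ik)
  show bm1: "bm ?L1 (\<lambda>x. \<integral>y. f (upair x y) \<partial>?L2)"
  proof (rule bmI[OF m])
    fix x assume x: "x \<in> space ?L1"
    have "cmod (\<integral>y. f (upair x y) \<partial>?L2) \<le> (\<integral>y. cmod (f (upair x y)) \<partial>?L2)"
      by (rule integral_norm_bound)
    also have "\<dots> \<le> (\<integral>y. C \<partial>?L2)"
    proof (rule integral_mono)
      show "integrable ?L2 (\<lambda>y. cmod (f (upair x y)))"
        using bm_integrable[OF L2.finite_measure_axioms sec[OF x]] by simp
      show "cmod (f (upair x y)) \<le> C" if "y \<in> space ?L2" for y
        using C measurable_space[OF up[OF x] that] by auto
    qed simp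
    finally show "cmod (\<integral>y. f (upair x y) \<partial>?L2) \<le> C" by (simp add: L2.prob_space)
  qed
  \<comment> \<open>\<open>integral_bind\<close> is applied to real functions; \<open>h\<close>
    stands for \<open>Re\<close> and for \<open>Im\<close>.\<close>
  have real: "(\<integral>z. h (f z) \<partial>?L12) = (\<integral>x. (\<integral>y. h (f (upair x y)) \<partial>?L2) \<partial>?L1)"
    if h: "h \<in> borel_measurable borel" "\<And>z. \<bar>h z\<bar> \<le> cmod z" for h :: "complex \<Rightarrow> real"
  proof -
    have "(\<integral>z. h (f z) \<partial>(?L1 \<bind> \<kappa>)) = (\<integral>x. (\<integral>z. h (f z) \<partial>\<kappa> x) \<partial>?L1)"
    proof (rule integral_bind[where B=C and B'=1])
      show "(\<lambda>z. h (f z)) \<in> borel_measurable ?L12" by (rule measurable_compose[OF fm h(1)])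
      show "\<bar>h (f z)\<bar> \<le> C" if "z \<in> space ?L12" for z using h(2)[of "f z"] C[OF that] by linarith
      show "AE x in ?L1. emeasure (\<kappa> x) (space (\<kappa> x)) \<le> ennreal 1"
        using km by (intro AE_I2) (auto dest!: measurable_space simp: space_subprob_algebra
            intro: subprob_space.emeasure_space_le_1)
    qed (use km L1.finite_measure_axioms in auto)
    also have "\<dots> = (\<integral>x. (\<integral>y. h (f (upair x y)) \<partial>?L2) \<partial>?L1)"
      by (rule Bochner_Integration.integral_cong) (auto simp: ik' h(1))
    finally show ?thesis unfolding bind .
  qed
  have int12: "integrable ?L12 f" by (rule bm_integrable[OF L12.finite_measure_axioms f])
  have int2: "integrable ?L2 (\<lambda>y. f (upair x y))" if "x \<in> space ?L1" for x
    by (rule bm_integrable[OF L2.finite_measure_axioms sec[OF that]])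
  have int1: "integrable ?L1 (\<lambda>x. \<integral>y. f (upair x y) \<partial>?L2)"
    by (rule bm_integrable[OF L1.finite_measure_axioms bm1])
  show "(\<integral>z. f z \<partial>?L12) = (\<integral>x. (\<integral>y. f (upair x y) \<partial>?L2) \<partial>?L1)"
  proof (rule complex_eqI)
    have "Re (\<integral>z. f z \<partial>?L12) = (\<integral>x. (\<integral>y. Re (f (upair x y)) \<partial>?L2) \<partial>?L1)"
      unfolding integral_Re[OF int12, symmetric] by (rule real) (auto simp: abs_Re_le_cmod)
    also have "\<dots> = (\<integral>x. Re (\<integral>y. f (upair x y) \<partial>?L2) \<partial>?L1)"
      by (rule Bochner_Integration.integral_cong) (auto simp: integral_Re int2)
    also have "\<dots> = Re (\<integral>x. (\<integral>y. f (upair x y) \<partial>?L2) \<partial>?L1)" by (rule integral_Re[OF int1])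
    finally show "Re (\<integral>z. f z \<partial>?L12) = Re (\<integral>x. (\<integral>y. f (upair x y) \<partial>?L2) \<partial>?L1)" .
    have "Im (\<integral>z. f z \<partial>?L12) = (\<integral>x. (\<integral>y. Im (f (upair x y)) \<partial>?L2) \<partial>?L1)"
      unfolding integral_Im[OF int12, symmetric] by (rule real) (auto simp: abs_Im_le_cmod)
    also have "\<dots> = (\<integral>x. Im (\<integral>y. f (upair x y) \<partial>?L2) \<partial>?L1)"
      by (rule Bochner_Integration.integral_cong) (auto simp: integral_Im int2)
    also have "\<dots> = Im (\<integral>x. (\<integral>y. f (upair x y) \<partial>?L2) \<partial>?L1)" by (rule integral_Im[OF int1])
    finally show "Im (\<integral>z. f z \<partial>?L12) = Im (\<integral>x. (\<integral>y. f (upair x y) \<partial>?L2) \<partial>?L1)" .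
  qed
qed

text \<open>The ultraproduct \<open>\<sigma>\<close>-algebra on a product is larger than the product of the \<open>\<sigma>\<close>-algebras of
  the factors, so joint measurability has to refer to the ultraproduct of the products.\<close>

definition jbm where
  "jbm T1 M1 T2 M2 F \<longleftrightarrow> bm (L (pT T1 T2) (pM M1 M2)) (\<lambda>z. F (ufst z) (usnd z))"

lemma jbm_mult: "jbm T1 M1 T2 M2 F \<Longrightarrow> jbm T1 M1 T2 M2 F' \<Longrightarrow> jbm T1 M1 T2 M2 (\<lambda>x y. F x y * F' x y)"
  unfolding jbm_def by (rule bm_mult)

lemma jbm_cnj_pow: "jbm T1 M1 T2 M2 F \<Longrightarrow> jbm T1 M1 T2 M2 (\<lambda>x y. (cnj ^^ n) (F x y))"
  unfolding jbm_def by (rule bm_cnj_pow)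

lemma jbm_prod: "(\<And>i. i \<in> I \<Longrightarrow> jbm T1 M1 T2 M2 (F i)) \<Longrightarrow> jbm T1 M1 T2 M2 (\<lambda>x y. \<Prod>i\<in>I. F i x y)"
  unfolding jbm_def by (rule bm_prod)

lemma jbm_umap2:
  assumes "bm (L T3 M3) f"
    and "eventually (\<lambda>i. continuous_map (prod_topology (T1 i) (T2 i)) (T3 i) (\<lambda>p. m i (fst p) (snd p))) \<omega>"
  shows "jbm T1 M1 T2 M2 (\<lambda>x y. f (umap2 m x y))"
  unfolding jbm_def umap2_proj by (rule bm_compose[OF assms(1) measurable_umap[OF assms(2)]])

lemma jbm_fst: "bm (L T1 M1) f \<Longrightarrow> jbm T1 M1 T2 M2 (\<lambda>x y. f x)"
  and jbm_snd: "bm (L T2 M2) g \<Longrightarrow> jbm T1 M1 T2 M2 (\<lambda>x y. g y)"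
  unfolding jbm_def
  by (erule bm_compose, rule measurable_umap, simp add: continuous_map_fst continuous_map_snd)+

lemma jbm_swap:
  assumes "jbm T1 M1 T2 M2 F"
  shows "jbm T2 M2 T1 M1 (\<lambda>y x. F x y)"
proof -
  have "bm (L (pT T2 T1) (pM M2 M1)) (\<lambda>z. F (ufst (umap (\<lambda>_ (a, b). (b, a)) z)) (usnd (umap (\<lambda>_ (a, b). (b, a)) z)))"
    by (rule bm_compose[OF assms[unfolded jbm_def] measurable_umap])
      (simp add: case_prod_unfold continuous_map_pairedI continuous_map_fst continuous_map_snd)
  then show ?thesis by (simp add: jbm_def umap_umap case_prod_unfold)
qed

text \<open>On the spaces concerned \<open>ufst\<close> and \<open>usnd\<close> undo
  \<open>upair\<close>, so statements about functions on the product become statements about curried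
  functions.\<close>

lemma jbm_iterated:
  assumes us: "uspace T1 M1" "uspace T2 M2" and F: "jbm T1 M1 T2 M2 F"
  shows "\<And>x. x \<in> space (L T1 M1) \<Longrightarrow> bm (L T2 M2) (F x)"
    and "bm (L T1 M1) (\<lambda>x. \<integral>y. F x y \<partial>L T2 M2)"
    and "(\<integral>z. F (ufst z) (usnd z) \<partial>L (pT T1 T2) (pM M1 M2)) = (\<integral>x. (\<integral>y. F x y \<partial>L T2 M2) \<partial>L T1 M1)"
proof -
  note * = integral_upair[OF us F[unfolded jbm_def]]
  have eq: "F (ufst (upair x y)) (usnd (upair x y)) = F x y"
    if "x \<in> space (L T1 M1)" "y \<in> space (L T2 M2)" for x y
    using that unfolding space_L by (simp add: ufst_upair usnd_upair)
  have eq': "(\<integral>y. F (ufst (upair x y)) (usnd (upair x y)) \<partial>L T2 M2) = (\<integral>y. F x y \<partial>L T2 M2)"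
    if "x \<in> space (L T1 M1)" for x
    by (rule Bochner_Integration.integral_cong) (auto simp: eq that)
  show "bm (L T2 M2) (F x)" if "x \<in> space (L T1 M1)" for x
    using *(1)[OF that] by (subst (asm) bm_cong[where g="F x"]) (auto simp: eq that)
  show "bm (L T1 M1) (\<lambda>x. \<integral>y. F x y \<partial>L T2 M2)"
    using *(2) by (subst (asm) bm_cong[where g="\<lambda>x. \<integral>y. F x y \<partial>L T2 M2"]) (auto simp: eq')
  show "(\<integral>z. F (ufst z) (usnd z) \<partial>L (pT T1 T2) (pM M1 M2)) = (\<integral>x. (\<integral>y. F x y \<partial>L T2 M2) \<partial>L T1 M1)"
    unfolding *(3) by (rule Bochner_Integration.integral_cong) (auto simp: eq')
qed

text \<open>\<open>bind_kernel\<close> disintegrates over the first factor only. The coordinate swap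
  is an internal homeomorphism preserving the product measures, so both iterated integrals equal the
  integral over the product.\<close>

lemma fubini:
  assumes us: "uspace T1 M1" "uspace T2 M2" and F: "jbm T1 M1 T2 M2 F"
  shows "(\<integral>x. (\<integral>y. F x y \<partial>L T2 M2) \<partial>L T1 M1) = (\<integral>y. (\<integral>x. F x y \<partial>L T1 M1) \<partial>L T2 M2)"
proof -
  let ?s = "umap (\<lambda>_::nat. \<lambda>(a, b). (b, a))"
  have cont: "eventually (\<lambda>i. continuous_map (prod_topology (T2 i) (T1 i)) (prod_topology (T1 i) (T2 i)) (\<lambda>(a, b). (b, a))) \<omega>"
    by (intro always_eventually allI)
      (simp add: case_prod_unfold continuous_map_pairedI continuous_map_fst continuous_map_snd)
  have "distr (L (pT T2 T1) (pM M2 M1)) (L (pT T1 T2) (pM M1 M2)) ?s = L (pT T1 T2) (pM M1 M2)"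
  proof (rule distr_umap[OF uspace_pair[OF us(2,1)] uspace_pair[OF us] cont])
    show "eventually (\<lambda>i. \<forall>U. openin (prod_topology (T1 i) (T2 i)) U \<longrightarrow> measure (M1 i \<Otimes>\<^sub>M M2 i) U =
        measure (M2 i \<Otimes>\<^sub>M M1 i) ((\<lambda>(a, b). (b, a)) -` U \<inter> topspace (prod_topology (T2 i) (T1 i)))) \<omega>"
      using us unfolding uspace_def
    proof eventually_elim
      case (elim i)
      interpret M1: prob_space "M1 i" using elim by (simp add: pspace_def)
      interpret M2: prob_space "M2 i" using elim by (simp add: pspace_def)
      interpret P: pair_sigma_finite "M1 i" "M2 i" ..
      show ?case
      proof (intro allI impI)
        fix U assume U: "openin (prod_topology (T1 i) (T2 i)) U"
        have "U \<in> sets (M1 i \<Otimes>\<^sub>M M2 i)" by (rule measure_lsc_section(2)[OF elim(1,2) U])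
        then show "measure (M1 i \<Otimes>\<^sub>M M2 i) U = measure (M2 i \<Otimes>\<^sub>M M1 i)
            ((\<lambda>(a, b). (b, a)) -` U \<inter> topspace (prod_topology (T2 i) (T1 i)))"
          using elim by (subst P.distr_pair_swap, subst measure_distr)
            (auto simp: space_pair_measure pspace_def)
      qed
    qed
  qed
  then have "(\<integral>z. F (ufst z) (usnd z) \<partial>L (pT T1 T2) (pM M1 M2)) =
      (\<integral>z. F (ufst z) (usnd z) \<partial>distr (L (pT T2 T1) (pM M2 M1)) (L (pT T1 T2) (pM M1 M2)) ?s)" by simp
  also have "\<dots> = (\<integral>z. F (ufst (?s z)) (usnd (?s z)) \<partial>L (pT T2 T1) (pM M2 M1))"
    by (rule integral_distr[OF measurable_umap[OF cont] bm_meas[OF F[unfolded jbm_def]]])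
  also have "\<dots> = (\<integral>z. F (usnd z) (ufst z) \<partial>L (pT T2 T1) (pM M2 M1))"
    by (simp add: umap_umap case_prod_unfold)
  finally show ?thesis
    using jbm_iterated(3)[OF us F] jbm_iterated(3)[OF us(2,1) jbm_swap[OF F]] by simp
qed

end

section \<open>Compact groups and their cubes\<close>

lemma continuous_map_measurable:
  assumes "pspace T M" "continuous_map T T' h"
  shows "h \<in> M \<rightarrow>\<^sub>M borel_of T'"
  unfolding borel_of_def
proof (rule measurable_measure_of)
  show "{U. openin T' U} \<subseteq> Pow (topspace T')" by (auto dest: openin_subset)
  show "h \<in> space M \<rightarrow> topspace T'"
    using assms by (auto simp: pspace_def continuous_map_def)
  fix U assume "U \<in> {U. openin T' U}"
  then have "openin T {x \<in> topspace T. h x \<in> U}"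
    using assms(2) by (auto simp: continuous_map_def)
  moreover have "{x \<in> topspace T. h x \<in> U} = h -` U \<inter> space M"
    using assms by (auto simp: pspace_def)
  ultimately show "h -` U \<inter> space M \<in> sets M" using assms(1) by (auto simp: pspace_def)
qed

lemma sets_borel_of_open: "openin T U \<Longrightarrow> U \<in> sets (borel_of T)"
  unfolding borel_of_def by (subst sets_measure_of) (auto dest: openin_subset)

lemma space_borel_of [simp]: "space (borel_of T) = topspace T"
  unfolding borel_of_def by (rule space_measure_of) (auto dest: openin_subset)

lemma pspace_distr:
  assumes "pspace T M" "second_countable T'" "continuous_map T T' h"
  shows "pspace T' (distr M (borel_of T') h)"
    and "openin T' U \<Longrightarrow> measure (distr M (borel_of T') h) U = measure M (h -` U \<inter> topspace T)"
proof -
  have m: "h \<in> M \<rightarrow>\<^sub>M borel_of T'" by (rule continuous_map_measurable[OF assms(1,3)])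
  show "pspace T' (distr M (borel_of T') h)"
    using assms(1,2) prob_space.prob_space_distr[OF _ m]
    by (auto simp: pspace_def sets_borel_of_open)
  show "measure (distr M (borel_of T') h) U = measure M (h -` U \<inter> topspace T)" if "openin T' U"
    using measure_distr[OF m sets_borel_of_open[OF that]] assms(1) by (simp add: pspace_def)
qed

text \<open>For finite \<open>I\<close> there are only countably many boxes of basic open sets. They
  form a base and are measurable for the product measure, so every open set is measurable and the
  product is again second countable.\<close>

lemma pspace_PiM:
  assumes ps: "pspace T M" and I: "finite I"
  shows "pspace (product_topology (\<lambda>_. T) I) (PiM I (\<lambda>_. M))"
proof -
  interpret M: prob_space M using ps by (simp add: pspace_def)
  have "second_countable T" using ps by (simp add: pspace_def)
  then obtain B where B: "countable B" "\<And>V. V \<in> B \<Longrightarrow> openin T V"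
    "\<And>U x. openin T U \<Longrightarrow> x \<in> U \<Longrightarrow> \<exists>V\<in>B. x \<in> V \<and> V \<subseteq> U"
    by (rule second_countableE) blast
  define \<B> where "\<B> = Pi\<^sub>E I ` (I \<rightarrow>\<^sub>E B)"
  have cB: "countable \<B>"
    unfolding \<B>_def by (intro countable_image countable_PiE I B(1))
  have oB: "openin (product_topology (\<lambda>_. T) I) V" "V \<in> sets (PiM I (\<lambda>_. M))" if "V \<in> \<B>" for V
  proof -
    from that obtain f where f: "V = Pi\<^sub>E I f" "\<And>i. i \<in> I \<Longrightarrow> f i \<in> B" by (auto simp: \<B>_def)
    show "openin (product_topology (\<lambda>_. T) I) V"
      unfolding f(1) by (subst openin_PiE[OF I]) (use f B(2) in auto)
    show "V \<in> sets (PiM I (\<lambda>_. M))"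
      unfolding f(1) by (rule sets_PiM_I_finite[OF I]) (use f B(2) ps in \<open>auto simp: pspace_def\<close>)
  qed
  have base: "\<exists>V\<in>\<B>. z \<in> V \<and> V \<subseteq> U" if U: "openin (product_topology (\<lambda>_. T) I) U" and z: "z \<in> U" for U z
  proof -
    obtain F where F: "\<forall>i\<in>I. openin T (F i)" "z \<in> Pi\<^sub>E I F" "Pi\<^sub>E I F \<subseteq> U"
      using U[unfolded openin_product_topology_alt, rule_format, OF z] by (elim exE conjE)
    have "\<forall>i\<in>I. \<exists>V\<in>B. z i \<in> V \<and> V \<subseteq> F i"
      using F B(3) by (auto simp: PiE_iff)
    then obtain f where f: "\<forall>i\<in>I. f i \<in> B \<and> z i \<in> f i \<and> f i \<subseteq> F i" by metis
    have "Pi\<^sub>E I (restrict f I) \<in> \<B>" unfolding \<B>_def using f by (intro imageI) auto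
    moreover have "z \<in> Pi\<^sub>E I (restrict f I)" using F(2) f by (auto simp: PiE_iff)
    moreover have "Pi\<^sub>E I (restrict f I) \<subseteq> U"
      using F(3) f by (intro order.trans[OF PiE_mono F(3)]) auto
    ultimately show ?thesis by blast
  qed
  have "U \<in> sets (PiM I (\<lambda>_. M))" if U: "openin (product_topology (\<lambda>_. T) I) U" for U
  proof -
    have "U = \<Union>{V\<in>\<B>. V \<subseteq> U}" using base[OF U] by blast
    moreover have "\<Union>{V\<in>\<B>. V \<subseteq> U} \<in> sets (PiM I (\<lambda>_. M))"
      using cB oB by (intro sets.countable_Union) auto
    ultimately show ?thesis by simp
  qed
  moreover have "second_countable (product_topology (\<lambda>_. T) I)"
    unfolding second_countable_def using cB oB base by (intro exI[of _ \<B>]) auto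
  ultimately show ?thesis
    using ps by (auto simp: pspace_def space_PiM M.prob_space_axioms intro!: prob_space_PiM)
qed

locale haar_group =
  fixes G :: "'a monoid" (structure) and T :: "'a topology" and \<mu> :: "'a measure"
  assumes cag: "compact_abelian_group G T" and haar: "haar_prob G T \<mu>"
begin

sublocale comm_group G
  using cag by (simp add: compact_abelian_group_def)

abbreviation "PT I \<equiv> product_topology (\<lambda>_. T) I"
abbreviation "PM I \<equiv> PiM I (\<lambda>_. \<mu>)"

lemma topspace_T [simp]: "topspace T = carrier G"
  using cag by (simp add: compact_abelian_group_def)

lemma prob_mu: "prob_space \<mu>"
  using haar by (simp add: haar_prob_def)

lemma space_mu [simp]: "space \<mu> = carrier G"
  using haar by (simp add: haar_prob_def)

lemma sets_mu: "sets \<mu> = sets (borel_of T)"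
  using haar by (simp add: haar_prob_def)

lemma pspace_mu: "pspace T \<mu>"
  using cag prob_mu by (auto simp: pspace_def compact_abelian_group_def sets_mu sets_borel_of_open)

lemma pspace_PM: "finite I \<Longrightarrow> pspace (PT I) (PM I)"
  by (rule pspace_PiM[OF pspace_mu])

lemma continuous_mult:
  assumes "continuous_map X T f" "continuous_map X T g"
  shows "continuous_map X T (\<lambda>z. f z \<otimes> g z)"
proof -
  have "continuous_map (prod_topology T T) T (\<lambda>(x, y). x \<otimes> y)"
    using cag by (simp add: compact_abelian_group_def)
  from continuous_map_compose[OF continuous_map_pairedI[OF assms] this] show ?thesis
    by (simp add: o_def)
qed

lemma continuous_carrier: "continuous_map X T f \<Longrightarrow> z \<in> topspace X \<Longrightarrow> f z \<in> carrier G"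
  by (auto simp: continuous_map_def)

lemma continuous_finprod:
  assumes "finite v" "\<And>j. j \<in> v \<Longrightarrow> continuous_map X T (f j)"
  shows "continuous_map X T (\<lambda>z. finprod G (\<lambda>j. f j z) v)"
  using assms
proof (induction v rule: finite_induct)
  case empty
  then show ?case by simp
next
  case (insert a v)
  have *: "continuous_map X T (\<lambda>z. f a z \<otimes> finprod G (\<lambda>j. f j z) v)"
    using insert by (intro continuous_mult) auto
  have "finprod G (\<lambda>j. f j z) (insert a v) = f a z \<otimes> finprod G (\<lambda>j. f j z) v"
    if "z \<in> topspace X" for z
    using insert that by (intro finprod_insert) (auto intro: continuous_carrier)
  \<comment> \<open>\<open>finprod_insert\<close> needs its factors in the group, so the two
    functions agree only on the space of \<open>X\<close>; continuity depends on no other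
    points.\<close>
  then show ?case
    by (intro continuous_map_eq[OF *]) simp
qed

lemma continuous_finprod_proj:
  assumes "finite v" "v \<subseteq> I" "continuous_map X (PT I) g"
  shows "continuous_map X T (\<lambda>z. finprod G (g z) v)"
proof -
  have "continuous_map X T (\<lambda>z. g z j)" if "j \<in> v" for j
    using continuous_map_compose[OF assms(3) continuous_map_product_projection[of j I "\<lambda>_. T"]] that assms(2)
    by (auto simp: o_def)
  from continuous_finprod[OF assms(1), of X "\<lambda>j z. g z j"] this show ?thesis by simp
qed

lemma continuous_translate: "a \<in> carrier G \<Longrightarrow> continuous_map T T (\<lambda>x. a \<otimes> x)"
  by (intro continuous_mult) auto

lemma measurable_translate: "a \<in> carrier G \<Longrightarrow> (\<lambda>x. a \<otimes> x) \<in> \<mu> \<rightarrow>\<^sub>M \<mu>"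
  using continuous_map_measurable[OF pspace_mu continuous_translate] measurable_cong_sets[OF refl sets_mu]
  by blast

lemma distr_translate: assumes a: "a \<in> carrier G" shows "distr \<mu> \<mu> (\<lambda>x. a \<otimes> x) = \<mu>"
proof (rule measure_eqI)
  fix S assume "S \<in> sets (distr \<mu> \<mu> (\<lambda>x. a \<otimes> x))"
  then have S: "S \<in> sets \<mu>" by simp
  have SG: "S \<subseteq> carrier G" using sets.sets_into_space[OF S] by simp
  let ?P = "(\<lambda>x. a \<otimes> x) -` S \<inter> space \<mu>"
  have P: "?P \<in> sets \<mu>" by (rule measurable_sets[OF measurable_translate[OF a] S])
  \<comment> \<open>Haar invariance is given for images, a push-forward uses preimages. A set is the
    translate of its own preimage because translation is onto.\<close>
  have "(\<lambda>x. a \<otimes> x) ` ?P = S"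
  proof (intro equalityI subsetI)
    fix s assume s: "s \<in> S"
    then have "s = a \<otimes> (inv a \<otimes> s)" "inv a \<otimes> s \<in> carrier G"
      using a SG by (auto simp: m_assoc[symmetric])
    then show "s \<in> (\<lambda>x. a \<otimes> x) ` ?P" using s by (intro image_eqI[of _ _ "inv a \<otimes> s"]) auto
  qed auto
  then have "emeasure \<mu> S = emeasure \<mu> ((\<lambda>x. a \<otimes> x) ` ?P)" by simp
  also have "\<dots> = emeasure \<mu> ?P" using haar a P by (simp add: haar_prob_def)
  also have "\<dots> = emeasure (distr \<mu> \<mu> (\<lambda>x. a \<otimes> x)) S"
    by (rule emeasure_distr[OF measurable_translate[OF a] S, symmetric])
  finally show "emeasure (distr \<mu> \<mu> (\<lambda>x. a \<otimes> x)) S = emeasure \<mu> S" by simp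
qed simp

lemma measurable_translate_PM:
  assumes "t \<in> I \<rightarrow> carrier G"
  shows "(\<lambda>r. \<lambda>j\<in>I. t j \<otimes> r j) \<in> PM I \<rightarrow>\<^sub>M PM I"
proof (rule measurable_restrict)
  fix j assume j: "j \<in> I"
  show "(\<lambda>r. t j \<otimes> r j) \<in> PM I \<rightarrow>\<^sub>M \<mu>"
    by (rule measurable_compose[OF measurable_component_singleton[OF j] measurable_translate])
      (use assms j in auto)
qed

text \<open>Finite product measures are determined by boxes, and translation acts on each side of a
  box separately.\<close>

lemma distr_translate_PM:
  assumes I: "finite I" and t: "t \<in> I \<rightarrow> carrier G"
  shows "distr (PM I) (PM I) (\<lambda>r. \<lambda>j\<in>I. t j \<otimes> r j) = PM I"
proof -
  interpret M: prob_space \<mu> by (rule prob_mu)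
  interpret product_prob_space "\<lambda>_. \<mu>" I by unfold_locales
  show ?thesis
  proof (rule PiM_eqI[OF I])
    fix A assume A: "\<And>i. i \<in> I \<Longrightarrow> A i \<in> sets \<mu>"
    have "(\<lambda>r. \<lambda>j\<in>I. t j \<otimes> r j) -` Pi\<^sub>E I A \<inter> space (PM I) =
        Pi\<^sub>E I (\<lambda>j. (\<lambda>x. t j \<otimes> x) -` A j \<inter> space \<mu>)"
      by (auto simp: space_PiM PiE_iff)
    moreover have "emeasure (PM I) (Pi\<^sub>E I (\<lambda>j. (\<lambda>x. t j \<otimes> x) -` A j \<inter> space \<mu>)) =
        (\<Prod>j\<in>I. emeasure \<mu> ((\<lambda>x. t j \<otimes> x) -` A j \<inter> space \<mu>))"
      using t A by (intro emeasure_PiM I measurable_sets[OF measurable_translate]) auto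
    moreover have "emeasure \<mu> ((\<lambda>x. t j \<otimes> x) -` A j \<inter> space \<mu>) = emeasure \<mu> (A j)" if "j \<in> I" for j
      using t A that emeasure_distr[OF measurable_translate[of "t j"] A[OF that]] distr_translate[of "t j"]
      by (auto simp: Pi_iff)
    ultimately show "emeasure (distr (PM I) (PM I) (\<lambda>r. \<lambda>j\<in>I. t j \<otimes> r j)) (Pi\<^sub>E I A) =
        (\<Prod>i\<in>I. emeasure \<mu> (A i))"
      using A by (subst emeasure_distr[OF measurable_translate_PM[OF t]]) (auto intro!: sets_PiM_I_finite I)
  qed simp
qed

lemma continuous_translate_PM:
  assumes t: "t \<in> I \<rightarrow> carrier G"
  shows "continuous_map (PT I) (PT I) (\<lambda>r. \<lambda>j\<in>I. t j \<otimes> r j)"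
  unfolding continuous_map_componentwise
proof (intro conjI ballI)
  fix k assume k: "k \<in> I"
  then have "continuous_map (PT I) T (\<lambda>r. t k \<otimes> r k)"
    using t by (intro continuous_mult continuous_map_product_projection) auto
  then show "continuous_map (PT I) T (\<lambda>r. (\<lambda>j\<in>I. t j \<otimes> r j) k)" using k by simp
qed auto

lemma continuous_upd:
  "continuous_map (prod_topology T (PT I)) (PT (insert j I)) (\<lambda>p. (snd p)(j := fst p))"
  unfolding continuous_map_componentwise
proof (intro conjI ballI)
  show "(\<lambda>p. (snd p)(j := fst p)) ` topspace (prod_topology T (PT I)) \<subseteq> extensional (insert j I)"
    by (auto simp: extensional_def PiE_iff)
  fix k assume k: "k \<in> insert j I"
  show "continuous_map (prod_topology T (PT I)) T (\<lambda>p. ((snd p)(j := fst p)) k)"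
  proof (cases "k = j")
    case False
    then have "continuous_map (prod_topology T (PT I)) T (\<lambda>p. snd p k)"
      using k by (intro continuous_map_prod_snd) auto
    with False show ?thesis by simp
  qed (simp add: continuous_map_fst)
qed

text \<open>One coordinate is split off the product measure; this later isolates a single direction
  of a cube.\<close>

lemma measure_upd:
  assumes U: "openin (PT (insert j I)) U" and I: "finite I"
  shows "measure (PM (insert j I)) U =
    measure (\<mu> \<Otimes>\<^sub>M PM I) ((\<lambda>p. (snd p)(j := fst p)) -` U \<inter> topspace (prod_topology T (PT I)))"
proof -
  have ps: "pspace (PT (insert j I)) (PM (insert j I))" by (rule pspace_PM) (use I in simp)
  have eq: "distr (\<mu> \<Otimes>\<^sub>M PM I) (PM (insert j I)) (\<lambda>(x, X). X(j := x)) = PM (insert j I)"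
    by (rule distr_pair_PiM_eq_PiM) (auto simp: prob_mu)
  have sp: "space (\<mu> \<Otimes>\<^sub>M PM I) = topspace (prod_topology T (PT I))"
    by (simp add: space_pair_measure space_PiM)
  have "(\<lambda>(x, X). X(j := x)) \<in> \<mu> \<Otimes>\<^sub>M PM I \<rightarrow>\<^sub>M PM (insert j I)"
    unfolding case_prod_beta by (rule measurable_fun_upd[where J=I]) auto
  from measure_distr[OF this, of U] show ?thesis
    unfolding eq sp using U ps by (simp add: pspace_def case_prod_unfold)
qed

lemma continuous_shift:
  assumes "finite v" "v \<subseteq> I"
  shows "continuous_map (prod_topology T (PT I)) T (\<lambda>p. fst p \<otimes> finprod G (snd p) v)"
  by (intro continuous_mult continuous_finprod_proj[OF assms] continuous_map_fst continuous_map_snd)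

lemma cube_in_cubes:
  "x \<in> carrier G \<Longrightarrow> t \<in> {..<n} \<rightarrow>\<^sub>E carrier G \<Longrightarrow> cube G n x t \<in> cubes G n"
  by (auto simp: cubes_def)

lemma cube_empty: "x \<in> carrier G \<Longrightarrow> cube G n x t {} = x"
  by (simp add: cube_def verts_def)

lemma continuous_cube:
  "continuous_map (prod_topology T (PT {..<n})) (cube_top G T n) (\<lambda>p. cube G n (fst p) (snd p))"
  unfolding cube_top_def continuous_map_in_subtopology continuous_map_componentwise
proof (intro conjI ballI)
  fix v assume v: "v \<in> verts n"
  then have "continuous_map (prod_topology T (PT {..<n})) T (\<lambda>p. fst p \<otimes> finprod G (snd p) v)"
    by (intro continuous_shift) (auto simp: verts_def finite_subset)
  then show "continuous_map (prod_topology T (PT {..<n})) T (\<lambda>p. cube G n (fst p) (snd p) v)"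
    using v unfolding cube_def by (simp only: restrict_apply if_True)
next
  show "(\<lambda>p. cube G n (fst p) (snd p)) \<in> topspace (prod_topology T (PT {..<n})) \<rightarrow> cubes G n"
  proof (rule funcsetI)
    fix p assume "p \<in> topspace (prod_topology T (PT {..<n}))"
    then have "fst p \<in> carrier G" "snd p \<in> {..<n} \<rightarrow>\<^sub>E carrier G"
      by (simp_all only: topspace_prod_topology topspace_product_topology topspace_T mem_Times_iff)
    then show "cube G n (fst p) (snd p) \<in> cubes G n" by (rule cube_in_cubes)
  qed
qed (simp_all only: cube_def image_subset_iff restrict_extensional Ball_def simp_thms)

lemma continuous_cube_at:
  assumes x: "x \<in> carrier G"
  shows "continuous_map (PT {..<n}) (cube_at_top G T n x) (cube G n x)"
  unfolding cube_at_top_def continuous_map_in_subtopology continuous_map_componentwise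
proof (intro conjI ballI)
  fix v assume v: "v \<in> verts n"
  then have "continuous_map (PT {..<n}) T (\<lambda>t. x \<otimes> finprod G t v)"
    using x by (intro continuous_mult continuous_finprod_proj[where g="\<lambda>t. t" and I="{..<n}"])
      (auto simp: verts_def finite_subset)
  then show "continuous_map (PT {..<n}) T (\<lambda>t. cube G n x t v)"
    using v unfolding cube_def by (simp only: restrict_apply if_True)
next
  show "cube G n x \<in> topspace (PT {..<n}) \<rightarrow> cubes_at G n x"
  proof (rule funcsetI)
    fix t assume "t \<in> topspace (PT {..<n})"
    then have "t \<in> {..<n} \<rightarrow>\<^sub>E carrier G" by simp
    with x show "cube G n x t \<in> cubes_at G n x"
      using cube_in_cubes[OF x] cube_empty[OF x] by (simp add: cubes_at_def)
  qed
qed (simp_all only: cube_def image_subset_iff restrict_extensional Ball_def simp_thms)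

lemma pspace_cube: "pspace (cube_top G T n) (cube_haar G T \<mu> n)"
  and measure_cube: "openin (cube_top G T n) U \<Longrightarrow> measure (cube_haar G T \<mu> n) U =
    measure (\<mu> \<Otimes>\<^sub>M PM {..<n}) ((\<lambda>p. cube G n (fst p) (snd p)) -` U \<inter> topspace (prod_topology T (PT {..<n})))"
proof -
  have 1: "pspace (prod_topology T (PT {..<n})) (\<mu> \<Otimes>\<^sub>M PM {..<n})"
    by (intro pspace_pair pspace_mu pspace_PM) simp
  have "second_countable (PT (verts n))"
    using pspace_PM[of "verts n"] by (simp add: pspace_def verts_def)
  then have 2: "second_countable (cube_top G T n)"
    unfolding cube_top_def by (rule second_countable_subtopology)
  have 3: "cube_haar G T \<mu> n = distr (\<mu> \<Otimes>\<^sub>M PM {..<n}) (borel_of (cube_top G T n)) (\<lambda>p. cube G n (fst p) (snd p))"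
    by (simp add: cube_haar_def case_prod_unfold)
  show "pspace (cube_top G T n) (cube_haar G T \<mu> n)"
    unfolding 3 by (rule pspace_distr(1)[OF 1 2 continuous_cube])
  show "openin (cube_top G T n) U \<Longrightarrow> measure (cube_haar G T \<mu> n) U =
    measure (\<mu> \<Otimes>\<^sub>M PM {..<n}) ((\<lambda>p. cube G n (fst p) (snd p)) -` U \<inter> topspace (prod_topology T (PT {..<n})))"
    unfolding 3 by (rule pspace_distr(2)[OF 1 2 continuous_cube])
qed

lemma pspace_cube_at: "x \<in> carrier G \<Longrightarrow> pspace (cube_at_top G T n x) (cube_at_haar G T \<mu> n x)"
  and measure_cube_at: "x \<in> carrier G \<Longrightarrow> openin (cube_at_top G T n x) U \<Longrightarrow>
    measure (cube_at_haar G T \<mu> n x) U = measure (PM {..<n}) (cube G n x -` U \<inter> topspace (PT {..<n}))"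
proof -
  assume x: "x \<in> carrier G"
  have 1: "pspace (PT {..<n}) (PM {..<n})"
    by (intro pspace_PM) simp
  have "second_countable (PT (verts n))"
    using pspace_PM[of "verts n"] by (simp add: pspace_def verts_def)
  then have 2: "second_countable (cube_at_top G T n x)"
    unfolding cube_at_top_def by (rule second_countable_subtopology)
  show "pspace (cube_at_top G T n x) (cube_at_haar G T \<mu> n x)"
    unfolding cube_at_haar_def by (rule pspace_distr(1)[OF 1 2 continuous_cube_at[OF x]])
  show "openin (cube_at_top G T n x) U \<Longrightarrow>
    measure (cube_at_haar G T \<mu> n x) U = measure (PM {..<n}) (cube G n x -` U \<inter> topspace (PT {..<n}))"
    unfolding cube_at_haar_def by (rule pspace_distr(2)[OF 1 2 continuous_cube_at[OF x]])
qed

lemma continuous_eval_cube_top: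
  "v \<in> verts n \<Longrightarrow> continuous_map (cube_top G T n) T (\<lambda>c. c v)"
  unfolding cube_top_def
  by (rule continuous_map_from_subtopology[OF continuous_map_product_projection])

lemma continuous_eval_cube_at_top:
  "v \<in> verts n \<Longrightarrow> continuous_map (cube_at_top G T n x) T (\<lambda>c. c v)"
  unfolding cube_at_top_def
  by (rule continuous_map_from_subtopology[OF continuous_map_product_projection])

lemma topspace_cube_top: "topspace (cube_top G T n) = cubes G n"
proof -
  have "cube G n x t \<in> topspace (PT (verts n))" if "x \<in> carrier G" "t \<in> {..<n} \<rightarrow>\<^sub>E carrier G" for x t
    using that by (auto simp: cube_def verts_def intro!: m_closed finprod_closed)
  then have "cubes G n \<subseteq> topspace (PT (verts n))" by (auto simp: cubes_def)
  then show ?thesis by (auto simp: cube_top_def)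
qed

end

section \<open>Ultraproducts of compact groups\<close>

context ultra begin

lemma umap2_uclass: "umap2 m (uclass \<omega> f) (uclass \<omega> g) = uclass \<omega> (\<lambda>i. m i (f i) (g i))"
  unfolding umap2_def uclass_eq_iff using urep_uclass[of f] urep_uclass[of g]
  by eventually_elim simp

lemma space_LE:
  assumes "x \<in> space (L T M)"
  obtains f where "x = uclass \<omega> f" "eventually (\<lambda>i. f i \<in> topspace (T i)) \<omega>"
  using uprod_urep[OF assms[unfolded space_L]] that[of "urep x"] by simp

lemma integral_umap:
  assumes "uspace T M" "uspace T' M'"
    and cont: "eventually (\<lambda>i. continuous_map (T i) (T' i) (h i)) \<omega>"
    and "eventually (\<lambda>i. \<forall>U. openin (T' i) U \<longrightarrow>
        measure (M' i) U = measure (M i) (h i -` U \<inter> topspace (T i))) \<omega>"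
    and H: "bm (L T' M') H"
  shows "(\<integral>y. H y \<partial>L T' M') = (\<integral>x. H (umap h x) \<partial>L T M)"
proof -
  have "(\<integral>y. H y \<partial>L T' M') = (\<integral>y. H y \<partial>distr (L T M) (L T' M') (umap h))"
    by (simp add: distr_umap[OF assms(1-4)])
  also have "\<dots> = (\<integral>x. H (umap h x) \<partial>L T M)"
    by (rule integral_distr[OF measurable_umap[OF cont] bm_meas[OF H]])
  finally show ?thesis .
qed

lemma integral_umap2:
  assumes us: "uspace T1 M1" "uspace T2 M2" "uspace T3 M3"
    and cont: "eventually (\<lambda>i. continuous_map (prod_topology (T1 i) (T2 i)) (T3 i) (\<lambda>p. m i (fst p) (snd p))) \<omega>"
    and meas: "eventually (\<lambda>i. \<forall>U. openin (T3 i) U \<longrightarrow> measure (M3 i) U =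
        measure (M1 i \<Otimes>\<^sub>M M2 i) ((\<lambda>p. m i (fst p) (snd p)) -` U \<inter> topspace (prod_topology (T1 i) (T2 i)))) \<omega>"
    and H: "bm (L T3 M3) H"
  shows "(\<integral>z. H z \<partial>L T3 M3) = (\<integral>x. (\<integral>y. H (umap2 m x y) \<partial>L T2 M2) \<partial>L T1 M1)"
proof -
  have "(\<integral>z. H z \<partial>L T3 M3) = (\<integral>z. H (umap2 m (ufst z) (usnd z)) \<partial>L (pT T1 T2) (pM M1 M2))"
    unfolding umap2_proj by (rule integral_umap[OF uspace_pair[OF us(1,2)] us(3) cont meas H])
  also have "\<dots> = (\<integral>x. (\<integral>y. H (umap2 m x y) \<partial>L T2 M2) \<partial>L T1 M1)"
    by (rule jbm_iterated(3)[OF us(1,2) jbm_umap2[OF H cont]])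
  finally show ?thesis .
qed

end

text \<open>Cauchy-Schwarz for the moduli, with the squared norms written as integrals of a function
  times its conjugate, the form in which Gowers inner products factor over faces.\<close>

lemma integral_cauchy_schwarz:
  assumes "finite_measure M" "bm M f" "bm M g"
  shows "(cmod (\<integral>x. f x * cnj (g x) \<partial>M))\<^sup>2 \<le>
    cmod (\<integral>x. f x * cnj (f x) \<partial>M) * cmod (\<integral>x. g x * cnj (g x) \<partial>M)"
proof -
  interpret finite_measure M by fact
  have [measurable]: "f \<in> borel_measurable M" "g \<in> borel_measurable M" using assms by (auto simp: bm_def)
  have i: "integrable M (\<lambda>x. cmod (h x) * cmod (k x))" if "bm M h" "bm M k" for h k
    using integrable_norm[OF bm_integrable[OF assms(1) bm_mult[OF that]]] by (simp add: norm_mult)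
  have nn: "(\<integral>\<^sup>+x. ennreal (cmod (h x)) * ennreal (cmod (k x)) \<partial>M) = ennreal (\<integral>x. cmod (h x) * cmod (k x) \<partial>M)"
    if "bm M h" "bm M k" for h k
    using nn_integral_eq_integral[OF i[OF that]] by (simp add: ennreal_mult')
  have sq: "cmod (\<integral>x. h x * cnj (h x) \<partial>M) = (\<integral>x. cmod (h x) * cmod (h x) \<partial>M)" if "bm M h" for h
  proof -
    have "(\<integral>x. h x * cnj (h x) \<partial>M) = (\<integral>x. complex_of_real (cmod (h x) * cmod (h x)) \<partial>M)"
      by (simp add: complex_norm_square[symmetric] power2_eq_square[symmetric])
    also have "\<dots> = complex_of_real (\<integral>x. cmod (h x) * cmod (h x) \<partial>M)"
      by (rule integral_complex_of_real)
    finally show ?thesis by (simp add: integral_nonneg_AE)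
  qed
  have "cmod (\<integral>x. f x * cnj (g x) \<partial>M) \<le> (\<integral>x. cmod (f x * cnj (g x)) \<partial>M)"
    by (rule integral_norm_bound)
  then have "cmod (\<integral>x. f x * cnj (g x) \<partial>M) \<le> (\<integral>x. cmod (f x) * cmod (g x) \<partial>M)"
    by (simp add: norm_mult)
  then have "(cmod (\<integral>x. f x * cnj (g x) \<partial>M))\<^sup>2 \<le> (\<integral>x. cmod (f x) * cmod (g x) \<partial>M)\<^sup>2"
    by (intro power_mono) auto
  also have "\<dots> \<le> (\<integral>x. cmod (f x) * cmod (f x) \<partial>M) * (\<integral>x. cmod (g x) * cmod (g x) \<partial>M)"
  proof -
    have "(\<integral>\<^sup>+x. ennreal (cmod (f x)) * ennreal (cmod (g x)) \<partial>M)\<^sup>2 \<le>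
        (\<integral>\<^sup>+x. (ennreal (cmod (f x)))\<^sup>2 \<partial>M) * (\<integral>\<^sup>+x. (ennreal (cmod (g x)))\<^sup>2 \<partial>M)"
      by (rule Cauchy_Schwarz_nn_integral) measurable
    then have "ennreal ((\<integral>x. cmod (f x) * cmod (g x) \<partial>M)\<^sup>2) \<le>
      ennreal ((\<integral>x. cmod (f x) * cmod (f x) \<partial>M) * (\<integral>x. cmod (g x) * cmod (g x) \<partial>M))"
      unfolding power2_eq_square nn[OF assms(2,3)] nn[OF assms(2,2)] nn[OF assms(3,3)]
      by (simp add: ennreal_mult' integral_nonneg_AE)
    then show ?thesis by (subst (asm) ennreal_le_iff) (auto intro!: integral_nonneg_AE mult_nonneg_nonneg)
  qed
  finally show ?thesis using assms by (simp add: sq)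
qed

section \<open>The ultraproduct group and its cubes\<close>

locale ultra_haar = ultra +
  fixes G :: "nat \<Rightarrow> 'a monoid" and T :: "nat \<Rightarrow> 'a topology" and \<mu> :: "nat \<Rightarrow> 'a measure"
  assumes hg: "\<And>i. haar_group (G i) (T i) (\<mu> i)"
begin

abbreviation "VT I \<equiv> (\<lambda>i. product_topology (\<lambda>_. T i) I)"
abbreviation "VM I \<equiv> (\<lambda>i. PiM I (\<lambda>_. \<mu> i))"
abbreviation "V I \<equiv> L (VT I) (VM I)"
abbreviation "CT n \<equiv> (\<lambda>i. cube_top (G i) (T i) n)"
abbreviation "CM n \<equiv> (\<lambda>i. cube_haar (G i) (T i) (\<mu> i) n)"
abbreviation "A \<equiv> L T \<mu>"
abbreviation "C n \<equiv> L (CT n) (CM n)"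

lemma group_G: "comm_group (G i)"
  using hg[of i] by (simp add: haar_group_def compact_abelian_group_def)

lemma us_A: "uspace T \<mu>"
  unfolding uspace_def by (intro always_eventually allI haar_group.pspace_mu[OF hg])

lemma us_V: "finite I \<Longrightarrow> uspace (VT I) (VM I)"
  unfolding uspace_def by (intro always_eventually allI haar_group.pspace_PM[OF hg])

lemma us_C: "uspace (CT n) (CM n)"
  unfolding uspace_def by (intro always_eventually allI haar_group.pspace_cube[OF hg])

lemma top_T: "topspace (T i) = carrier (G i)"
  by (rule haar_group.topspace_T[OF hg])

lemma space_A: "space A = uprod \<omega> (\<lambda>i. carrier (G i))"
  by (simp add: space_L top_T)

lemma A_E:
  assumes "x \<in> space A"
  obtains f where "x = uclass \<omega> f" "eventually (\<lambda>i. f i \<in> carrier (G i)) \<omega>"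
  using space_LE[OF assms] by (metis (no_types, lifting) top_T eventually_mono)

lemma V_E:
  assumes "t \<in> space (V I)"
  obtains f where "t = uclass \<omega> f" "eventually (\<lambda>i. f i \<in> I \<rightarrow>\<^sub>E carrier (G i)) \<omega>"
  using space_LE[OF assms] by (auto simp: top_T)

lemma fm_A: "finite_measure A"
  using prob_space_L[OF us_A] by (rule prob_space.finite_measure)

lemma fm_V: "finite I \<Longrightarrow> finite_measure (V I)"
  using prob_space_L[OF us_V] by (rule prob_space.finite_measure)

lemma fm_C: "finite_measure (C n)"
  using prob_space_L[OF us_C] by (rule prob_space.finite_measure)

text \<open>The vertex \<open>v\<close> of the cube with base point \<open>x\<close> and directions
  \<open>t\<close>. The directions form one point of an ultraproduct of powers, not a tuple of
  points of the group, because \<open>V I\<close> carries the larger \<sigma>-algebra.\<close>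

definition sh :: "nat set \<Rightarrow> 'a upoint \<Rightarrow> (nat \<Rightarrow> 'a) upoint \<Rightarrow> 'a upoint" where
  "sh v = umap2 (\<lambda>i x t. x \<otimes>\<^bsub>G i\<^esub> finprod (G i) t v)"

definition fp :: "nat set \<Rightarrow> (nat \<Rightarrow> 'a) upoint \<Rightarrow> 'a upoint" where
  "fp v = umap (\<lambda>i t. finprod (G i) t v)"

definition upd :: "nat \<Rightarrow> 'a upoint \<Rightarrow> (nat \<Rightarrow> 'a) upoint \<Rightarrow> (nat \<Rightarrow> 'a) upoint" where
  "upd j = umap2 (\<lambda>i s t. t(j := s))"

definition vmul :: "nat set \<Rightarrow> (nat \<Rightarrow> 'a) upoint \<Rightarrow> (nat \<Rightarrow> 'a) upoint \<Rightarrow> (nat \<Rightarrow> 'a) upoint" where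
  "vmul I = umap2 (\<lambda>i t r. \<lambda>j\<in>I. t j \<otimes>\<^bsub>G i\<^esub> r j)"

definition ucube :: "nat \<Rightarrow> 'a upoint \<Rightarrow> (nat \<Rightarrow> 'a) upoint \<Rightarrow> (nat set \<Rightarrow> 'a) upoint" where
  "ucube n = umap2 (\<lambda>i x t. cube (G i) n x t)"

abbreviation "add \<equiv> uadd \<omega> G"

lemma add_umap2: "add = umap2 (\<lambda>i x y. x \<otimes>\<^bsub>G i\<^esub> y)"
  by (intro ext) (simp add: uadd_def umap2_def)

lemma psi_umap: "psi \<omega> v = umap (\<lambda>i c. c v)"
  by (intro ext) (simp add: psi_def umap_def)

lemma psi_ucube: "v \<in> verts n \<Longrightarrow> psi \<omega> v (ucube n x t) = sh v x t"
  unfolding psi_umap ucube_def umap2_def umap_uclass sh_def by (simp add: cube_def)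

lemma sh_eq_add: "sh v x t = add x (fp v t)"
  unfolding sh_def add_umap2 fp_def
  unfolding umap2_def umap_def uclass_eq_iff
  using urep_uclass[of "\<lambda>i. finprod (G i) (urep t i) v"] by eventually_elim simp

lemma add_closed: assumes "x \<in> space A" "y \<in> space A" shows "add x y \<in> space A"
proof -
  obtain f where f: "x = uclass \<omega> f" "eventually (\<lambda>i. f i \<in> carrier (G i)) \<omega>" by (rule A_E[OF assms(1)])
  obtain g where g: "y = uclass \<omega> g" "eventually (\<lambda>i. g i \<in> carrier (G i)) \<omega>" by (rule A_E[OF assms(2)])
  show ?thesis
    unfolding f(1) g(1) add_umap2 umap2_uclass space_A uclass_in_uprod
    using f(2) g(2)
  proof eventually_elim
    case (elim i)
    interpret comm_group "G i" by (rule group_G)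
    show ?case using elim by simp
  qed
qed

lemma add_commute: assumes "x \<in> space A" "y \<in> space A" shows "add x y = add y x"
proof -
  obtain f where f: "x = uclass \<omega> f" "eventually (\<lambda>i. f i \<in> carrier (G i)) \<omega>" by (rule A_E[OF assms(1)])
  obtain g where g: "y = uclass \<omega> g" "eventually (\<lambda>i. g i \<in> carrier (G i)) \<omega>" by (rule A_E[OF assms(2)])
  show ?thesis
    unfolding f(1) g(1) add_umap2 umap2_uclass uclass_eq_iff
    using f(2) g(2)
  proof eventually_elim
    case (elim i)
    interpret comm_group "G i" by (rule group_G)
    show ?case using elim by (rule m_comm)
  qed
qed

lemma add_assoc:
  assumes "x \<in> space A" "y \<in> space A" "z \<in> space A" shows "add (add x y) z = add x (add y z)"
proof -
  obtain f where f: "x = uclass \<omega> f" "eventually (\<lambda>i. f i \<in> carrier (G i)) \<omega>" by (rule A_E[OF assms(1)])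
  obtain g where g: "y = uclass \<omega> g" "eventually (\<lambda>i. g i \<in> carrier (G i)) \<omega>" by (rule A_E[OF assms(2)])
  obtain h where h: "z = uclass \<omega> h" "eventually (\<lambda>i. h i \<in> carrier (G i)) \<omega>" by (rule A_E[OF assms(3)])
  show ?thesis
    unfolding f(1) g(1) h(1) add_umap2 umap2_uclass uclass_eq_iff
    using f(2) g(2) h(2)
  proof eventually_elim
    case (elim i)
    interpret comm_group "G i" by (rule group_G)
    show ?case using elim by (rule m_assoc)
  qed
qed

lemma add_inverse:
  assumes "s \<in> space A"
  obtains s' where "s' \<in> space A" "\<And>x. x \<in> space A \<Longrightarrow> add (add x s) s' = x"
    "\<And>x. x \<in> space A \<Longrightarrow> add (add x s') s = x"
proof -
  obtain f where f: "s = uclass \<omega> f" "eventually (\<lambda>i. f i \<in> carrier (G i)) \<omega>" by (rule A_E[OF assms(1)])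
  define s' where "s' = uclass \<omega> (\<lambda>i. inv\<^bsub>G i\<^esub> f i)"
  have "s' \<in> space A"
    unfolding s'_def space_A uclass_in_uprod using f(2)
  proof eventually_elim
    case (elim i)
    interpret comm_group "G i" by (rule group_G)
    show ?case using elim by simp
  qed
  moreover have "add (add x s) s' = x" "add (add x s') s = x" if x: "x \<in> space A" for x
  proof -
    obtain g where g: "x = uclass \<omega> g" "eventually (\<lambda>i. g i \<in> carrier (G i)) \<omega>" by (rule A_E[OF x])
    have *: "eventually (\<lambda>i. (g i \<otimes>\<^bsub>G i\<^esub> f i) \<otimes>\<^bsub>G i\<^esub> inv\<^bsub>G i\<^esub> f i = g i \<and>
        (g i \<otimes>\<^bsub>G i\<^esub> inv\<^bsub>G i\<^esub> f i) \<otimes>\<^bsub>G i\<^esub> f i = g i) \<omega>"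
      using f(2) g(2)
    proof eventually_elim
      case (elim i)
      interpret comm_group "G i" by (rule group_G)
      show ?case using elim by (simp add: m_assoc)
    qed
    show "add (add x s) s' = x" "add (add x s') s = x"
      unfolding f(1) g(1) s'_def add_umap2 umap2_uclass uclass_eq_iff
      using * by (auto elim: eventually_mono)
  qed
  ultimately show thesis by (rule that)
qed

lemma fp_closed: assumes "t \<in> space (V I)" "v \<subseteq> I" shows "fp v t \<in> space A"
proof -
  obtain f where f: "t = uclass \<omega> f" "eventually (\<lambda>i. f i \<in> I \<rightarrow>\<^sub>E carrier (G i)) \<omega>" by (rule V_E[OF assms(1)])
  show ?thesis
    unfolding f(1) fp_def umap_uclass space_A uclass_in_uprod
    using f(2)
  proof eventually_elim
    case (elim i)
    interpret comm_group "G i" by (rule group_G)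
    show ?case using elim assms(2) by (intro finprod_closed) (auto simp: PiE_iff)
  qed
qed

lemma sh_empty: assumes "x \<in> space A" shows "sh {} x t = x"
proof -
  obtain f where f: "x = uclass \<omega> f" "eventually (\<lambda>i. f i \<in> carrier (G i)) \<omega>" by (rule A_E[OF assms(1)])
  have "umap2 (\<lambda>i x t. x \<otimes>\<^bsub>G i\<^esub> finprod (G i) t {}) (uclass \<omega> f) t = uclass \<omega> f"
    unfolding umap2_def uclass_eq_iff using f(2) urep_uclass[of f]
  proof eventually_elim
    case (elim i)
    interpret comm_group "G i" by (rule group_G)
    show ?case using elim by simp
  qed
  then show ?thesis by (simp add: f(1) sh_def)
qed

text \<open>An edge in direction \<open>j\<close> is absorbed into the base point. The vertices
  containing \<open>j\<close> thus form a cube with directions \<open>t\<close> based at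
  \<open>add x s\<close>, and the others one based at \<open>x\<close>.\<close>

lemma sh_upd:
  assumes x: "x \<in> space A" and s: "s \<in> space A" and t: "t \<in> space (V I)"
    and v: "v \<subseteq> insert j I" "j \<notin> I" and I: "finite I"
  shows "sh v x (upd j s t) = (if j \<in> v then sh (v - {j}) (add x s) t else sh v x t)"
proof -
  obtain f where f: "x = uclass \<omega> f" "eventually (\<lambda>i. f i \<in> carrier (G i)) \<omega>" by (rule A_E[OF x])
  obtain g where g: "s = uclass \<omega> g" "eventually (\<lambda>i. g i \<in> carrier (G i)) \<omega>" by (rule A_E[OF s])
  obtain h where h: "t = uclass \<omega> h" "eventually (\<lambda>i. h i \<in> I \<rightarrow>\<^sub>E carrier (G i)) \<omega>" by (rule V_E[OF t])
  have ev: "eventually (\<lambda>i. f i \<otimes>\<^bsub>G i\<^esub> finprod (G i) ((h i)(j := g i)) v =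
      (if j \<in> v then (f i \<otimes>\<^bsub>G i\<^esub> g i) \<otimes>\<^bsub>G i\<^esub> finprod (G i) (h i) (v - {j})
       else f i \<otimes>\<^bsub>G i\<^esub> finprod (G i) (h i) v)) \<omega>"
    using f(2) g(2) h(2)
  proof eventually_elim
    case (elim i)
    interpret comm_group "G i" by (rule group_G)
    have vf: "finite v" using v(1) I finite_subset by blast
    have hc: "h i k \<in> carrier (G i)" if "k \<in> v" "k \<noteq> j" for k
      using elim(3) v(1) that by (auto simp: PiE_iff)
    have cong: "finprod (G i) ((h i)(j := g i)) (v - {j}) = finprod (G i) (h i) (v - {j})"
      by (rule finprod_cong') (auto simp: hc)
    show ?case
    proof (cases "j \<in> v")
      case True
      have "finprod (G i) ((h i)(j := g i)) (insert j (v - {j})) =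
          ((h i)(j := g i)) j \<otimes>\<^bsub>G i\<^esub> finprod (G i) ((h i)(j := g i)) (v - {j})"
        by (rule finprod_insert) (use vf elim hc in auto)
      then have "finprod (G i) ((h i)(j := g i)) v = g i \<otimes>\<^bsub>G i\<^esub> finprod (G i) (h i) (v - {j})"
        using True by (simp add: insert_absorb cong)
      moreover have "finprod (G i) (h i) (v - {j}) \<in> carrier (G i)"
        by (rule finprod_closed) (auto simp: hc)
      ultimately show ?thesis using True elim by (simp add: m_assoc)
    next
      case False
      then have "v - {j} = v" by simp
      with cong False show ?thesis by simp
    qed
  qed
  show ?thesis
    unfolding f(1) g(1) h(1) sh_def upd_def add_umap2 umap2_uclass
    using ev by (auto simp: uclass_eq_iff elim: eventually_mono)
qed

text \<open>Commutativity separates the contributions of \<open>t\<close> and \<open>r\<close>: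
  changing the directions of a cube by \<open>r\<close> moves each vertex by its own increment and
  keeps the base point.\<close>

lemma sh_vmul:
  assumes x: "x \<in> space A" and t: "t \<in> space (V I)" and r: "r \<in> space (V I)" and v: "v \<subseteq> I"
  shows "sh v x (vmul I t r) = sh v (sh v x t) r"
proof -
  obtain f where f: "x = uclass \<omega> f" "eventually (\<lambda>i. f i \<in> carrier (G i)) \<omega>" by (rule A_E[OF x])
  obtain g where g: "t = uclass \<omega> g" "eventually (\<lambda>i. g i \<in> I \<rightarrow>\<^sub>E carrier (G i)) \<omega>" by (rule V_E[OF t])
  obtain h where h: "r = uclass \<omega> h" "eventually (\<lambda>i. h i \<in> I \<rightarrow>\<^sub>E carrier (G i)) \<omega>" by (rule V_E[OF r])
  show ?thesis
    unfolding f(1) g(1) h(1) sh_def vmul_def umap2_uclass uclass_eq_iff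
    using f(2) g(2) h(2)
  proof eventually_elim
    case (elim i)
    interpret comm_group "G i" by (rule group_G)
    have c: "g i \<in> v \<rightarrow> carrier (G i)" "h i \<in> v \<rightarrow> carrier (G i)"
      using elim v by (auto simp: PiE_iff)
    have "finprod (G i) (\<lambda>j\<in>I. g i j \<otimes>\<^bsub>G i\<^esub> h i j) v = finprod (G i) (\<lambda>j. g i j \<otimes>\<^bsub>G i\<^esub> h i j) v"
      by (rule finprod_cong') (use c v in auto)
    also have "\<dots> = finprod (G i) (g i) v \<otimes>\<^bsub>G i\<^esub> finprod (G i) (h i) v"
      by (rule finprod_multf[OF c])
    finally show ?case using elim finprod_closed[OF c(1)] finprod_closed[OF c(2)] by (simp add: m_assoc)
  qed
qed

text \<open>The cubes are parametrised at each index, so a base point and directions can be chosen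
  coordinatewise.\<close>

lemma cube_E:
  assumes "c \<in> space (C n)"
  obtains x t where "x \<in> space A" "t \<in> space (V {..<n})" "c = ucube n x t"
proof -
  obtain f where f: "c = uclass \<omega> f" "eventually (\<lambda>i. f i \<in> cubes (G i) n) \<omega>"
    using space_LE[OF assms] by (auto simp: haar_group.topspace_cube_top[OF hg])
  define P where "P i p \<longleftrightarrow> fst p \<in> carrier (G i) \<and> snd p \<in> {..<n} \<rightarrow>\<^sub>E carrier (G i) \<and>
      f i = cube (G i) n (fst p) (snd p)" for i p
  define p where "p i = (SOME p. P i p)" for i
  have p: "eventually (\<lambda>i. P i (p i)) \<omega>"
    using f(2)
  proof eventually_elim
    case (elim i)
    then obtain x t where "x \<in> carrier (G i)" "t \<in> {..<n} \<rightarrow>\<^sub>E carrier (G i)" "f i = cube (G i) n x t"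
      by (auto simp: cubes_def)
    then have "P i (x, t)" by (simp add: P_def)
    then show ?case unfolding p_def by (rule someI)
  qed
  show thesis
  proof (rule that)
    show "uclass \<omega> (\<lambda>i. fst (p i)) \<in> space A"
      unfolding space_A uclass_in_uprod using p by eventually_elim (simp add: P_def)
    show "uclass \<omega> (\<lambda>i. snd (p i)) \<in> space (V {..<n})"
      unfolding space_L uclass_in_uprod using p by eventually_elim (simp add: P_def top_T)
    show "c = ucube n (uclass \<omega> (\<lambda>i. fst (p i))) (uclass \<omega> (\<lambda>i. snd (p i)))"
      unfolding f(1) ucube_def umap2_uclass uclass_eq_iff using p by eventually_elim (simp add: P_def)
  qed
qed

lemma measurable_psi: "v \<in> verts n \<Longrightarrow> psi \<omega> v \<in> C n \<rightarrow>\<^sub>M A"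
  unfolding psi_umap
  by (rule measurable_umap) (intro always_eventually allI haar_group.continuous_eval_cube_top[OF hg])

lemma jbm_sh:
  assumes "bm A f" "finite v" "v \<subseteq> I"
  shows "jbm T \<mu> (VT I) (VM I) (\<lambda>x t. f (sh v x t))"
  unfolding sh_def
  by (rule jbm_umap2[OF assms(1)])
    (intro always_eventually allI haar_group.continuous_shift[OF hg] assms(2,3))

lemma integral_add:
  assumes a: "a \<in> space A" and f: "bm A f"
  shows "bm A (\<lambda>x. f (add a x))" "(\<integral>x. f (add a x) \<partial>A) = (\<integral>x. f x \<partial>A)"
proof -
  have ev: "eventually (\<lambda>i. urep a i \<in> carrier (G i)) \<omega>"
    using ev_topspace[OF a] by (simp add: top_T)
  have eq: "add a = umap (\<lambda>i x. urep a i \<otimes>\<^bsub>G i\<^esub> x)"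
    unfolding add_umap2 by (intro ext) (simp add: umap2_def umap_def)
  have cont: "eventually (\<lambda>i. continuous_map (T i) (T i) (\<lambda>x. urep a i \<otimes>\<^bsub>G i\<^esub> x)) \<omega>"
    using ev by eventually_elim (rule haar_group.continuous_translate[OF hg])
  show "bm A (\<lambda>x. f (add a x))" unfolding eq by (rule bm_compose[OF f measurable_umap[OF cont]])
  have "eventually (\<lambda>i. \<forall>U. openin (T i) U \<longrightarrow> measure (\<mu> i) U =
      measure (\<mu> i) ((\<lambda>x. urep a i \<otimes>\<^bsub>G i\<^esub> x) -` U \<inter> topspace (T i))) \<omega>"
    using ev
  proof eventually_elim
    case (elim i)
    interpret haar_group "G i" "T i" "\<mu> i" by (rule hg)
    show ?case
      using measure_distr[OF measurable_translate[OF elim]] distr_translate[OF elim] pspace_mu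
      by (simp add: pspace_def)
  qed
  from integral_umap[OF us_A us_A cont this f] show "(\<integral>x. f (add a x) \<partial>A) = (\<integral>x. f x \<partial>A)"
    by (simp add: eq)
qed

lemma integral_vmul:
  assumes t: "t \<in> space (V I)" and f: "bm (V I) f" and I: "finite I"
  shows "(\<integral>r. f (vmul I t r) \<partial>V I) = (\<integral>r. f r \<partial>V I)"
proof -
  have ev: "eventually (\<lambda>i. urep t i \<in> I \<rightarrow> carrier (G i)) \<omega>"
    using ev_topspace[OF t] by (auto simp: top_T PiE_def elim: eventually_mono)
  have eq: "vmul I t = umap (\<lambda>i r. \<lambda>j\<in>I. urep t i j \<otimes>\<^bsub>G i\<^esub> r j)"
    unfolding vmul_def by (intro ext) (simp add: umap2_def umap_def)
  have cont: "eventually (\<lambda>i. continuous_map (VT I i) (VT I i) (\<lambda>r. \<lambda>j\<in>I. urep t i j \<otimes>\<^bsub>G i\<^esub> r j)) \<omega>"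
    using ev by eventually_elim (rule haar_group.continuous_translate_PM[OF hg])
  have "eventually (\<lambda>i. \<forall>U. openin (VT I i) U \<longrightarrow> measure (VM I i) U =
      measure (VM I i) ((\<lambda>r. \<lambda>j\<in>I. urep t i j \<otimes>\<^bsub>G i\<^esub> r j) -` U \<inter> topspace (VT I i))) \<omega>"
    using ev
  proof eventually_elim
    case (elim i)
    interpret haar_group "G i" "T i" "\<mu> i" by (rule hg)
    show ?case
      using measure_distr[OF measurable_translate_PM[OF elim]] distr_translate_PM[OF I elim] pspace_PM[OF I]
      by (simp add: pspace_def)
  qed
  from integral_umap[OF us_V[OF I] us_V[OF I] cont this f] show ?thesis by (simp add: eq)
qed

lemma upd_split:
  assumes I: "finite I" and H: "bm (V (insert j I)) H"
  shows "(\<integral>t. H t \<partial>V (insert j I)) = (\<integral>s. (\<integral>t. H (upd j s t) \<partial>V I) \<partial>A)"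
    and "jbm T \<mu> (VT I) (VM I) (\<lambda>s t. H (upd j s t))"
proof -
  have us: "uspace (VT (insert j I)) (VM (insert j I))" by (rule us_V) (use I in simp)
  have cont: "eventually (\<lambda>i. continuous_map (prod_topology (T i) (VT I i)) (VT (insert j I) i)
      (\<lambda>p. (snd p)(j := fst p))) \<omega>"
    by (intro always_eventually allI haar_group.continuous_upd[OF hg])
  have meas: "eventually (\<lambda>i. \<forall>U. openin (VT (insert j I) i) U \<longrightarrow> measure (VM (insert j I) i) U =
        measure (\<mu> i \<Otimes>\<^sub>M VM I i) ((\<lambda>p. (snd p)(j := fst p)) -` U \<inter> topspace (prod_topology (T i) (VT I i)))) \<omega>"
    by (intro always_eventually allI impI haar_group.measure_upd[OF hg] I)
  show "(\<integral>t. H t \<partial>V (insert j I)) = (\<integral>s. (\<integral>t. H (upd j s t) \<partial>V I) \<partial>A)"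
    unfolding upd_def by (rule integral_umap2[OF us_A us_V[OF I] us cont meas H])
  show "jbm T \<mu> (VT I) (VM I) (\<lambda>s t. H (upd j s t))"
    unfolding upd_def by (rule jbm_umap2[OF H cont])
qed

lemma cube_split:
  assumes H: "bm (C n) H"
  shows "(\<integral>c. H c \<partial>C n) = (\<integral>x. (\<integral>t. H (ucube n x t) \<partial>V {..<n}) \<partial>A)"
  unfolding ucube_def
  by (rule integral_umap2[OF us_A us_V us_C _ _ H])
    (intro always_eventually allI impI finite_lessThan
      haar_group.continuous_cube[OF hg] haar_group.measure_cube[OF hg])+

text \<open>The measure on the cubes based at \<open>x\<close> is a push-forward from the
  directions. The representatives \<open>urep x i\<close> lie in the group only for almost all
  \<open>i\<close>, which suffices for \<open>uspace\<close>.\<close>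

lemma bracket_eq:
  assumes x: "x \<in> space A" and F: "\<And>v. v \<in> K n \<Longrightarrow> bm A (F v)"
  shows "bracket \<omega> G T \<mu> n F x = (\<integral>t. (\<Prod>v\<in>K n. (cnj ^^ card v) (F v (sh v x t))) \<partial>V {..<n})"
proof -
  let ?T = "\<lambda>i. cube_at_top (G i) (T i) n (urep x i)"
  let ?M = "\<lambda>i. cube_at_haar (G i) (T i) (\<mu> i) n (urep x i)"
  have ev: "eventually (\<lambda>i. urep x i \<in> carrier (G i)) \<omega>"
    using ev_topspace[OF x] by (simp add: top_T)
  have us: "uspace ?T ?M"
    unfolding uspace_def using ev by eventually_elim (rule haar_group.pspace_cube_at[OF hg])
  have cont: "eventually (\<lambda>i. continuous_map (VT {..<n} i) (?T i) (cube (G i) n (urep x i))) \<omega>"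
    using ev by eventually_elim (rule haar_group.continuous_cube_at[OF hg])
  have meas: "eventually (\<lambda>i. \<forall>U. openin (?T i) U \<longrightarrow> measure (?M i) U =
      measure (VM {..<n} i) (cube (G i) n (urep x i) -` U \<inter> topspace (VT {..<n} i))) \<omega>"
    using ev by eventually_elim (intro allI impI haar_group.measure_cube_at[OF hg])
  have psi_m: "psi \<omega> v \<in> L ?T ?M \<rightarrow>\<^sub>M A" if "v \<in> K n" for v
    unfolding psi_umap
    by (rule measurable_umap)
      (use that in \<open>intro always_eventually allI haar_group.continuous_eval_cube_at_top[OF hg], simp add: K_def\<close>)
  have H: "bm (L ?T ?M) (\<lambda>c. \<Prod>v\<in>K n. (cnj ^^ card v) (F v (psi \<omega> v c)))"
    by (intro bm_prod bm_cnj_pow bm_compose[OF F psi_m])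
  have "bracket \<omega> G T \<mu> n F x = (\<integral>c. (\<Prod>v\<in>K n. (cnj ^^ card v) (F v (psi \<omega> v c))) \<partial>L ?T ?M)"
    by (simp add: bracket_def Cube_at_def)
  also have "\<dots> = (\<integral>t. (\<Prod>v\<in>K n. (cnj ^^ card v) (F v (psi \<omega> v (umap (\<lambda>i. cube (G i) n (urep x i)) t)))) \<partial>V {..<n})"
    by (rule integral_umap[OF us_V us cont meas H]) simp
  also have "\<dots> = (\<integral>t. (\<Prod>v\<in>K n. (cnj ^^ card v) (F v (sh v x t))) \<partial>V {..<n})"
  proof (intro Bochner_Integration.integral_cong refl prod.cong)
    fix t v assume "v \<in> K n"
    have "umap (\<lambda>i. cube (G i) n (urep x i)) t = ucube n x t"
      by (simp add: umap_def ucube_def umap2_def)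
    then show "(cnj ^^ card v) (F v (psi \<omega> v (umap (\<lambda>i. cube (G i) n (urep x i)) t))) = (cnj ^^ card v) (F v (sh v x t))"
      using \<open>v \<in> K n\<close> by (simp add: psi_ucube K_def)
  qed
  finally show ?thesis .
qed

end

section \<open>The Gowers--Cauchy--Schwarz inequality\<close>

lemma finite_verts [simp]: "finite (verts n)"
  by (simp add: verts_def)

lemma finite_K [simp]: "finite (K n)"
  by (simp add: K_def)

lemma verts_K: "verts n = insert {} (K n)" "{} \<notin> K n"
  by (auto simp: verts_def K_def)

lemma card_verts: "card (verts n) = 2 ^ n"
  by (simp add: verts_def card_Pow)

lemma cnj_pow_cases: "(cnj ^^ n) z = (if even n then z else cnj z)"
  by (induction n) auto

lemma cnj_pow_mult: "(cnj ^^ n) (a * b) = (cnj ^^ n) a * (cnj ^^ n) b"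
  and cnj_pow_add: "(cnj ^^ n) (a + b) = (cnj ^^ n) a + (cnj ^^ n) b"
  and cmod_cnj_pow [simp]: "cmod ((cnj ^^ n) a) = cmod a"
  by (simp_all add: cnj_pow_cases)

lemma prod_if_subset:
  assumes "S \<subseteq> V" "finite V"
  shows "(\<Prod>v\<in>V. p v (if v \<in> S then f else g)) = (\<Prod>v\<in>S. p v f) * (\<Prod>v\<in>V - S. p v g)"
proof -
  have "(\<Prod>v\<in>V. p v (if v \<in> S then f else g)) = (\<Prod>v\<in>S \<union> (V - S). p v (if v \<in> S then f else g))"
    using assms by (intro prod.cong) auto
  also have "\<dots> = (\<Prod>v\<in>S. p v (if v \<in> S then f else g)) * (\<Prod>v\<in>V - S. p v (if v \<in> S then f else g))"
    using assms by (intro prod.union_disjoint) (auto intro: finite_subset)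
  finally show ?thesis by simp
qed

context ultra_haar begin

text \<open>The Gowers inner product of a family of functions, one for each vertex. For a constant
  family and \<open>n\<close> at least 1 it is the \<open>2 ^ n\<close>-th power of the Gowers
  norm.\<close>

definition ip :: "nat \<Rightarrow> (nat set \<Rightarrow> 'a upoint \<Rightarrow> complex) \<Rightarrow> complex" where
  "ip n F = (\<integral>c. (\<Prod>v\<in>verts n. (cnj ^^ card v) (F v (psi \<omega> v c))) \<partial>C n)"

lemma ip_cong: "(\<And>v. v \<in> verts n \<Longrightarrow> F v = F' v) \<Longrightarrow> ip n F = ip n F'"
  unfolding ip_def by (intro Bochner_Integration.integral_cong refl prod.cong) simp

lemma jbm_prod_sh:
  assumes "\<And>v. v \<in> P \<Longrightarrow> bm A (f v)" "P \<subseteq> Pow I" "finite I"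
  shows "jbm T \<mu> (VT I) (VM I) (\<lambda>x t. \<Prod>v\<in>P. f v (sh v x t))"
proof (rule jbm_prod)
  fix v assume "v \<in> P"
  with assms(2) have "v \<subseteq> I" by auto
  with assms \<open>v \<in> P\<close> show "jbm T \<mu> (VT I) (VM I) (\<lambda>x t. f v (sh v x t))"
    by (intro jbm_sh) (auto intro: finite_subset)
qed

lemma bm_cube_prod:
  assumes "\<And>v. v \<in> P \<Longrightarrow> bm A (f v)" "P \<subseteq> verts n"
  shows "bm (C n) (\<lambda>c. \<Prod>v\<in>P. f v (psi \<omega> v c))"
  using assms by (intro bm_prod bm_compose[OF _ measurable_psi]) auto

lemma integral_cube_prod:
  assumes f: "\<And>v. v \<in> P \<Longrightarrow> bm A (f v)" and P: "P \<subseteq> verts n"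
  shows "(\<integral>c. (\<Prod>v\<in>P. f v (psi \<omega> v c)) \<partial>C n) = (\<integral>x. (\<integral>t. (\<Prod>v\<in>P. f v (sh v x t)) \<partial>V {..<n}) \<partial>A)"
proof -
  have "(\<integral>c. (\<Prod>v\<in>P. f v (psi \<omega> v c)) \<partial>C n) =
      (\<integral>x. (\<integral>t. (\<Prod>v\<in>P. f v (psi \<omega> v (ucube n x t))) \<partial>V {..<n}) \<partial>A)"
    by (rule cube_split[OF bm_cube_prod[OF assms]])
  also have "\<dots> = (\<integral>x. (\<integral>t. (\<Prod>v\<in>P. f v (sh v x t)) \<partial>V {..<n}) \<partial>A)"
    by (intro Bochner_Integration.integral_cong refl prod.cong arg_cong[where f="f _"] psi_ucube) (use P in auto)
  finally show ?thesis .
qed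

text \<open>The vertices without \<open>j\<close> and those with \<open>j\<close> form two parallel
  faces with the same remaining directions \<open>t\<close>. Replacing the direction
  \<open>s\<close> by the base point \<open>add x s\<close> of the second face makes the two base
  points independent, so the integral over them factors for each \<open>t\<close>.\<close>

lemma integral_direction_split:
  assumes f: "\<And>v. v \<in> verts n \<Longrightarrow> bm A (f v)" and j: "j < n"
  defines "I \<equiv> {..<n} - {j}"
  shows "(\<integral>c. (\<Prod>v\<in>verts n. f v (psi \<omega> v c)) \<partial>C n) =
    (\<integral>t. (\<integral>x. (\<Prod>v\<in>Pow I. f v (sh v x t)) \<partial>A) *
       (\<integral>y. (\<Prod>v\<in>Pow I. f (insert j v) (sh v y t)) \<partial>A) \<partial>V I)"
proof -
  have I: "finite I" "j \<notin> I" "insert j I = {..<n}" using j by (auto simp: I_def)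
  define a where "a x t = (\<Prod>v\<in>Pow I. f v (sh v x t))" for x t
  define b where "b y t = (\<Prod>v\<in>Pow I. f (insert j v) (sh v y t))" for y t
  define B where "B t = (\<integral>y. b y t \<partial>A)" for t
  note usI = us_V[OF I(1)]
  have ja: "jbm T \<mu> (VT I) (VM I) a"
    unfolding a_def by (rule jbm_prod_sh) (use f I in \<open>auto simp: verts_def\<close>)
  have jb: "jbm T \<mu> (VT I) (VM I) b"
    unfolding b_def
  proof (rule jbm_prod_sh[where f="\<lambda>v. f (insert j v)"])
    show "bm A (f (insert j v))" if "v \<in> Pow I" for v
      using that j by (intro f) (auto simp: verts_def I_def)
  qed (use I in auto)
  have bB: "bm (V I) B"
    unfolding B_def by (rule jbm_iterated(2)[OF usI us_A jbm_swap[OF jb]])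
  have bb: "bm A (\<lambda>y. b y t)" if "t \<in> space (V I)" for t
    by (rule jbm_iterated(1)[OF usI us_A jbm_swap[OF jb] that])
  have inner: "(\<integral>t. (\<Prod>v\<in>verts n. f v (sh v x t)) \<partial>V {..<n}) = (\<integral>t. a x t * B t \<partial>V I)"
    if x: "x \<in> space A" for x
  proof -
    define H where "H t = (\<Prod>v\<in>verts n. f v (sh v x t))" for t
    have "jbm T \<mu> (VT {..<n}) (VM {..<n}) (\<lambda>x t. \<Prod>v\<in>verts n. f v (sh v x t))"
      by (rule jbm_prod_sh) (use f in \<open>auto simp: verts_def\<close>)
    from jbm_iterated(1)[OF us_A us_V this x] have H: "bm (V (insert j I)) H"
      by (simp add: H_def[abs_def] I(3))
    have "(\<integral>t. H t \<partial>V {..<n}) = (\<integral>s. (\<integral>t. H (upd j s t) \<partial>V I) \<partial>A)"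
      using upd_split(1)[OF I(1) H] by (simp add: I(3))
    also have "\<dots> = (\<integral>t. (\<integral>s. H (upd j s t) \<partial>A) \<partial>V I)"
      by (rule fubini[OF us_A usI upd_split(2)[OF I(1) H]])
    also have "\<dots> = (\<integral>t. a x t * B t \<partial>V I)"
    proof (rule Bochner_Integration.integral_cong[OF refl])
      fix t assume t: "t \<in> space (V I)"
      have "H (upd j s t) = a x t * b (add x s) t" if s: "s \<in> space A" for s
      proof -
        have V: "verts n = Pow I \<union> insert j ` Pow I"
          by (simp add: verts_def I(3)[symmetric] Pow_insert)
        have "H (upd j s t) = (\<Prod>v\<in>Pow I. f v (sh v x (upd j s t))) *
            (\<Prod>v\<in>insert j ` Pow I. f v (sh v x (upd j s t)))"
          unfolding H_def V using I by (intro prod.union_disjoint) auto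
        also have "(\<Prod>v\<in>Pow I. f v (sh v x (upd j s t))) = a x t"
          unfolding a_def
        proof (intro prod.cong refl)
          fix v assume "v \<in> Pow I"
          then have v: "v \<subseteq> insert j I" "j \<notin> v" using I(2) by auto
          show "f v (sh v x (upd j s t)) = f v (sh v x t)"
            using sh_upd[OF x s t v(1) I(2,1)] v(2) by simp
        qed
        also have "(\<Prod>v\<in>insert j ` Pow I. f v (sh v x (upd j s t))) =
            (\<Prod>v\<in>Pow I. f (insert j v) (sh (insert j v) x (upd j s t)))"
          using I(2) by (subst prod.reindex) (auto intro!: inj_onI simp: o_def)
        also have "\<dots> = b (add x s) t"
          unfolding b_def
        proof (intro prod.cong refl)
          fix v assume "v \<in> Pow I"
          then have v: "insert j v \<subseteq> insert j I" "insert j v - {j} = v" using I(2) by auto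
          show "f (insert j v) (sh (insert j v) x (upd j s t)) = f (insert j v) (sh v (add x s) t)"
            using sh_upd[OF x s t v(1) I(2,1)] v(2) by simp
        qed
        finally show ?thesis .
      qed
      then have "(\<integral>s. H (upd j s t) \<partial>A) = (\<integral>s. a x t * b (add x s) t \<partial>A)"
        by (intro Bochner_Integration.integral_cong) auto
      also have "\<dots> = a x t * (\<integral>s. b (add x s) t \<partial>A)" by simp
      \<comment> \<open>Invariance of Haar measure removes the dependence on
        \<open>x\<close>.\<close>
      also have "(\<integral>s. b (add x s) t \<partial>A) = B t"
        unfolding B_def by (rule integral_add(2)[OF x bb[OF t]])
      finally show "(\<integral>s. H (upd j s t) \<partial>A) = a x t * B t" .
    qed
    finally show ?thesis by (simp add: H_def)
  qed
  have "(\<integral>c. (\<Prod>v\<in>verts n. f v (psi \<omega> v c)) \<partial>C n) = (\<integral>x. (\<integral>t. a x t * B t \<partial>V I) \<partial>A)"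
  proof -
    have "(\<integral>c. (\<Prod>v\<in>verts n. f v (psi \<omega> v c)) \<partial>C n) =
        (\<integral>x. (\<integral>t. (\<Prod>v\<in>verts n. f v (sh v x t)) \<partial>V {..<n}) \<partial>A)"
      by (rule integral_cube_prod[OF f order_refl])
    also have "\<dots> = (\<integral>x. (\<integral>t. a x t * B t \<partial>V I) \<partial>A)"
      by (rule Bochner_Integration.integral_cong[OF refl inner])
    finally show ?thesis .
  qed
  also have "\<dots> = (\<integral>t. (\<integral>x. a x t * B t \<partial>A) \<partial>V I)"
    by (rule fubini[OF us_A usI jbm_mult[OF ja jbm_snd[OF bB]]])
  also have "\<dots> = (\<integral>t. (\<integral>x. a x t \<partial>A) * B t \<partial>V I)" by simp
  finally show ?thesis by (simp add: a_def B_def b_def)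
qed

text \<open>The factors on a face of the cube \<open>x + v \<cdot> t\<close>, whose directions are those in \<open>I\<close>, integrated
  over the base point of the face.\<close>

definition face :: "nat set \<Rightarrow> (nat set \<Rightarrow> 'a upoint \<Rightarrow> complex) \<Rightarrow> (nat \<Rightarrow> 'a) upoint \<Rightarrow> complex" where
  "face I F t = (\<integral>x. (\<Prod>v\<in>Pow I. (cnj ^^ card v) (F v (sh v x t))) \<partial>A)"

lemma face_cong: "(\<And>v. v \<in> Pow I \<Longrightarrow> F v = F' v) \<Longrightarrow> face I F = face I F'"
  unfolding face_def by (intro ext Bochner_Integration.integral_cong refl prod.cong) simp

lemma bm_face:
  assumes "\<And>v. v \<in> Pow I \<Longrightarrow> bm A (F v)" "finite I"
  shows "bm (V I) (face I F)"
proof -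
  have "jbm T \<mu> (VT I) (VM I) (\<lambda>x t. \<Prod>v\<in>Pow I. (cnj ^^ card v) (F v (sh v x t)))"
    by (rule jbm_prod_sh[where f="\<lambda>v z. (cnj ^^ card v) (F v z)"]) (use assms in auto)
  from jbm_iterated(2)[OF us_V[OF assms(2)] us_A jbm_swap[OF this]] show ?thesis
    by (simp add: face_def[abs_def])
qed

text \<open>Adding \<open>j\<close> to a vertex changes the parity of its cardinality, so the
  factors on the second face are conjugated once more. The inner product becomes a Hermitian pairing
  of two face functions.\<close>

lemma ip_face:
  assumes F: "\<And>v. v \<in> verts n \<Longrightarrow> bm A (F v)" and j: "j < n"
  defines "I \<equiv> {..<n} - {j}"
  shows "ip n F = (\<integral>t. face I F t * cnj (face I (\<lambda>v. F (insert j v)) t) \<partial>V I)"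
proof -
  have "ip n F = (\<integral>t. (\<integral>x. (\<Prod>v\<in>Pow I. (cnj ^^ card v) (F v (sh v x t))) \<partial>A) *
       (\<integral>y. (\<Prod>v\<in>Pow I. (cnj ^^ card (insert j v)) (F (insert j v) (sh v y t))) \<partial>A) \<partial>V I)"
    unfolding ip_def I_def
    by (rule integral_direction_split[where f="\<lambda>v z. (cnj ^^ card v) (F v z)", OF bm_cnj_pow[OF F] j])
  also have "\<dots> = (\<integral>t. face I F t * cnj (face I (\<lambda>v. F (insert j v)) t) \<partial>V I)"
  proof (intro Bochner_Integration.integral_cong refl)
    fix t
    have "(\<Prod>v\<in>Pow I. (cnj ^^ card (insert j v)) (F (insert j v) (sh v y t))) =
        cnj (\<Prod>v\<in>Pow I. (cnj ^^ card v) (F (insert j v) (sh v y t)))" for y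
      unfolding cnj_prod
    proof (intro prod.cong refl)
      fix v assume "v \<in> Pow I"
      then have "finite v" "j \<notin> v" by (auto simp: I_def intro: finite_subset[of _ "{..<n} - {j}"])
      then show "(cnj ^^ card (insert j v)) (F (insert j v) (sh v y t)) =
          cnj ((cnj ^^ card v) (F (insert j v) (sh v y t)))" by simp
    qed
    then show "(\<integral>x. (\<Prod>v\<in>Pow I. (cnj ^^ card v) (F v (sh v x t))) \<partial>A) *
       (\<integral>y. (\<Prod>v\<in>Pow I. (cnj ^^ card (insert j v)) (F (insert j v) (sh v y t))) \<partial>A) =
       face I F t * cnj (face I (\<lambda>v. F (insert j v)) t)"
      by (simp only: face_def Bochner_Integration.integral_cnj)
  qed
  finally show ?thesis .
qed

text \<open>With the same function on both faces the pairing is the integral of a squared modulus. A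
  direction to split along exists only for \<open>n\<close> at least 1.\<close>

lemma ip_const_nonneg:
  assumes f: "bm A f" and n: "n \<ge> 1"
  shows "ip n (\<lambda>_. f) = of_real (cmod (ip n (\<lambda>_. f)))"
proof -
  let ?I = "{..<n} - {0}"
  have "ip n (\<lambda>_. f) = (\<integral>t. face ?I (\<lambda>_. f) t * cnj (face ?I (\<lambda>_. f) t) \<partial>V ?I)"
    by (rule ip_face) (use f n in auto)
  also have "\<dots> = (\<integral>t. complex_of_real ((cmod (face ?I (\<lambda>_. f) t))\<^sup>2) \<partial>V ?I)"
    by (simp add: complex_norm_square[symmetric])
  also have "\<dots> = complex_of_real (\<integral>t. (cmod (face ?I (\<lambda>_. f) t))\<^sup>2 \<partial>V ?I)"
    by (rule integral_complex_of_real)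
  finally show ?thesis by (simp add: integral_nonneg_AE)
qed

text \<open>Each factor on the right copies one face of \<open>F\<close> onto the other:
  \<open>v - {j}\<close> always reads the face without \<open>j\<close>, and
  \<open>insert j v\<close> the face with it.\<close>

lemma ip_cauchy_schwarz:
  assumes F: "\<And>v. v \<in> verts n \<Longrightarrow> bm A (F v)" and j: "j < n"
  shows "(cmod (ip n F))\<^sup>2 \<le> cmod (ip n (\<lambda>v. F (v - {j}))) * cmod (ip n (\<lambda>v. F (insert j v)))"
proof -
  define I where "I = {..<n} - {j}"
  let ?F1 = "\<lambda>v. F (insert j v)"
  have sub: "Pow I \<subseteq> verts n" "\<And>v. v \<in> verts n \<Longrightarrow> v - {j} \<in> verts n"
    "\<And>v. v \<in> verts n \<Longrightarrow> insert j v \<in> verts n" using j by (auto simp: verts_def I_def)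
  have fI: "finite I" by (simp add: I_def)
  have b0: "bm (V I) (face I F)" by (rule bm_face) (use F sub fI in auto)
  have b1: "bm (V I) (face I ?F1)" by (rule bm_face) (use F sub fI in auto)
  \<comment> \<open>\<open>face I\<close> evaluates only vertices without \<open>j\<close>, where
    removing \<open>j\<close> changes nothing.\<close>
  have c: "face I (\<lambda>v. F (v - {j})) = face I F" "face I (\<lambda>v. F (insert j v - {j})) = face I F"
    by (rule face_cong, rule arg_cong[where f=F], auto simp: I_def)+
  have e: "ip n F = (\<integral>t. face I F t * cnj (face I ?F1 t) \<partial>V I)"
    unfolding I_def by (rule ip_face[OF F j])
  have e0: "ip n (\<lambda>v. F (v - {j})) = (\<integral>t. face I F t * cnj (face I F t) \<partial>V I)"
    using ip_face[of n "\<lambda>v. F (v - {j})" j] F sub j unfolding I_def[symmetric] by (simp add: c)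
  have e1: "ip n ?F1 = (\<integral>t. face I ?F1 t * cnj (face I ?F1 t) \<partial>V I)"
    using ip_face[of n ?F1 j] F sub j unfolding I_def[symmetric] by simp
  show ?thesis
    unfolding e e0 e1 by (rule integral_cauchy_schwarz[OF fm_V[OF fI] b0 b1])
qed

text \<open>Cauchy-Schwarz is applied to one direction after another, and each application doubles
  both the exponent and the number of factors. Powers on both sides avoid roots during the
  induction.\<close>

lemma gowers_cauchy_schwarz_power:
  assumes F: "\<And>v. v \<in> verts n \<Longrightarrow> bm A (F v)"
  shows "cmod (ip n F) ^ (2 ^ n) \<le> (\<Prod>w\<in>verts n. cmod (ip n (\<lambda>_. F w)))"
proof -
  \<comment> \<open>The first \<open>m\<close> coordinates of the vertex are overwritten by
    \<open>w\<close>; after \<open>n\<close> rounds \<open>F w\<close> stands at every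
    vertex.\<close>
  define Fm where "Fm m w = (\<lambda>v. F ((v - {..<m}) \<union> w))" for m w
  have step: "cmod (ip n F) ^ (2 ^ m) \<le> (\<Prod>w\<in>Pow {..<m}. cmod (ip n (Fm m w)))" if "m \<le> n" for m
    using that
  proof (induction m)
    case 0
    then show ?case by (simp add: Fm_def)
  next
    case (Suc m)
    have "cmod (ip n F) ^ (2 ^ Suc m) = (cmod (ip n F) ^ (2 ^ m))\<^sup>2"
      by (simp add: power_mult[symmetric] mult.commute)
    also have "\<dots> \<le> (\<Prod>w\<in>Pow {..<m}. cmod (ip n (Fm m w)))\<^sup>2"
      by (rule power_mono) (use Suc in auto)
    also have "\<dots> = (\<Prod>w\<in>Pow {..<m}. (cmod (ip n (Fm m w)))\<^sup>2)"
      by (rule prod_power_distrib)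
    also have "\<dots> \<le> (\<Prod>w\<in>Pow {..<m}. cmod (ip n (Fm (Suc m) w)) * cmod (ip n (Fm (Suc m) (insert m w))))"
    proof (rule prod_mono, intro conjI)
      fix w assume w: "w \<in> Pow {..<m}"
      have "(cmod (ip n (Fm m w)))\<^sup>2 \<le>
          cmod (ip n (\<lambda>v. Fm m w (v - {m}))) * cmod (ip n (\<lambda>v. Fm m w (insert m v)))"
        by (rule ip_cauchy_schwarz)
          (use Suc.prems w in \<open>auto simp: Fm_def verts_def intro!: F[unfolded verts_def]\<close>)
      moreover have "(\<lambda>v. Fm m w (v - {m})) = Fm (Suc m) w"
        by (rule ext) (auto simp: Fm_def lessThan_Suc intro!: arg_cong[where f=F])
      moreover have "(\<lambda>v. Fm m w (insert m v)) = Fm (Suc m) (insert m w)"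
        by (rule ext) (auto simp: Fm_def lessThan_Suc intro!: arg_cong[where f=F])
      ultimately show "(cmod (ip n (Fm m w)))\<^sup>2 \<le>
          cmod (ip n (Fm (Suc m) w)) * cmod (ip n (Fm (Suc m) (insert m w)))" by simp
    qed simp
    also have "\<dots> = (\<Prod>w\<in>Pow {..<m}. cmod (ip n (Fm (Suc m) w))) *
        (\<Prod>w\<in>insert m ` Pow {..<m}. cmod (ip n (Fm (Suc m) w)))"
      by (subst prod.reindex) (auto simp: prod.distrib o_def intro!: inj_onI)
    also have "\<dots> = (\<Prod>w\<in>Pow {..<m} \<union> insert m ` Pow {..<m}. cmod (ip n (Fm (Suc m) w)))"
      by (rule prod.union_disjoint[symmetric]) auto
    also have "Pow {..<m} \<union> insert m ` Pow {..<m} = Pow {..<Suc m}"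
      by (simp add: lessThan_Suc Pow_insert)
    finally show ?case .
  qed
  have "ip n (Fm n w) = ip n (\<lambda>_. F w)" for w
    by (rule ip_cong) (auto simp: Fm_def verts_def intro!: arg_cong[where f=F])
  with step[of n] show ?thesis by (simp add: verts_def)
qed

section \<open>Seminorm properties of the Gowers norms\<close>

abbreviation "gn \<equiv> gowers_norm \<omega> G T \<mu>"

lemma gn_eq:
  assumes "bm A f" "n \<ge> 1"
  shows "gn n f = root (2 ^ n) (cmod (ip n (\<lambda>_. f)))"
  using arg_cong[OF ip_const_nonneg[OF assms], of Re]
  by (simp add: gowers_norm_def Cube_def ip_def)

lemma gn_power:
  assumes "bm A f" "n \<ge> 1"
  shows "gn n f ^ (2 ^ n) = cmod (ip n (\<lambda>_. f))" "gn n f \<ge> 0"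
  using assms by (simp_all add: gn_eq real_root_pow_pos2)

lemma gowers_cauchy_schwarz:
  assumes F: "\<And>v. v \<in> verts n \<Longrightarrow> bm A (F v)" and n: "n \<ge> 1"
  shows "cmod (ip n F) \<le> (\<Prod>w\<in>verts n. gn n (F w))"
proof (rule power_le_imp_le_base)
  have "cmod (ip n F) ^ (2 ^ n) \<le> (\<Prod>w\<in>verts n. cmod (ip n (\<lambda>_. F w)))"
    by (rule gowers_cauchy_schwarz_power[OF F])
  also have "\<dots> = (\<Prod>w\<in>verts n. gn n (F w)) ^ (2 ^ n)"
    unfolding prod_power_distrib by (intro prod.cong refl gn_power(1)[symmetric] F n)
  \<comment> \<open>The exponent is written as a successor, the form expected by
    \<open>power_le_imp_le_base\<close>.\<close>
  finally show "cmod (ip n F) ^ Suc (2 ^ n - 1) \<le> (\<Prod>w\<in>verts n. gn n (F w)) ^ Suc (2 ^ n - 1)" by simp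
  show "0 \<le> (\<Prod>w\<in>verts n. gn n (F w))" by (intro prod_nonneg gn_power(2) F n)
qed

lemma ip_eq_0:
  assumes F: "\<And>v. v \<in> verts n \<Longrightarrow> bm A (F v)" and n: "n \<ge> 1" and w: "w \<in> verts n" "gn n (F w) = 0"
  shows "ip n F = 0"
proof -
  have "(\<Prod>w\<in>verts n. gn n (F w)) = 0" using w by auto
  with gowers_cauchy_schwarz[of n F, OF F n] have "cmod (ip n F) \<le> 0" by linarith
  then show ?thesis by simp
qed

lemma gn_scale:
  assumes f: "bm A f" and n: "n \<ge> 1"
  shows "gn n (\<lambda>x. a * f x) = cmod a * gn n f"
proof -
  have "ip n (\<lambda>_ x. a * f x) = (\<Prod>v\<in>verts n. (cnj ^^ card v) a) * ip n (\<lambda>_. f)"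
    by (simp add: ip_def cnj_pow_mult prod.distrib)
  then have "cmod (ip n (\<lambda>_ x. a * f x)) = cmod a ^ (2 ^ n) * cmod (ip n (\<lambda>_. f))"
    by (simp add: norm_mult prod_norm[symmetric] card_verts)
  moreover have "bm A (\<lambda>x. a * f x)" using f by auto
  ultimately show ?thesis
    using f n by (simp add: gn_eq real_root_mult real_root_power_cancel)
qed

text \<open>Expanding the product over the vertices gives one inner product for each set
  \<open>S\<close> of vertices that receive \<open>f\<close>. Gowers-Cauchy-Schwarz bounds it by a
  product of norms, and these bounds are the terms in the expansion of the power of the right
  side.\<close>

lemma gn_triangle:
  assumes f: "bm A f" and g: "bm A g" and n: "n \<ge> 1"
  shows "gn n (\<lambda>x. f x + g x) \<le> gn n f + gn n g"
proof (rule power_le_imp_le_base)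
  have fg: "bm A (\<lambda>x. f x + g x)" using f g by auto
  define H where "H S v = (if v \<in> S then f else g)" for S :: "nat set set" and v
  have Hb: "bm A (H S v)" for S v using f g by (simp add: H_def)
  have "ip n (\<lambda>_ x. f x + g x) = (\<integral>c. (\<Sum>S\<in>Pow (verts n). (\<Prod>v\<in>verts n. (cnj ^^ card v) (H S v (psi \<omega> v c)))) \<partial>C n)"
    unfolding ip_def
    by (intro Bochner_Integration.integral_cong refl)
      (simp add: cnj_pow_add prod_add H_def
        prod_if_subset[where p="\<lambda>v h. (cnj ^^ card v) (h (psi \<omega> v _))"])
  also have "\<dots> = (\<Sum>S\<in>Pow (verts n). ip n (H S))"
    unfolding ip_def
    by (intro Bochner_Integration.integral_sum bm_integrable[OF fm_C] bm_cube_prod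
        [where f="\<lambda>v z. (cnj ^^ card v) (H _ v z)"] bm_cnj_pow Hb order_refl)
  finally have "cmod (ip n (\<lambda>_ x. f x + g x)) \<le> (\<Sum>S\<in>Pow (verts n). cmod (ip n (H S)))"
    by (simp add: norm_sum)
  also have "\<dots> \<le> (\<Sum>S\<in>Pow (verts n). \<Prod>v\<in>verts n. gn n (H S v))"
    by (intro sum_mono gowers_cauchy_schwarz Hb n)
  also have "\<dots> = (\<Sum>S\<in>Pow (verts n). (\<Prod>v\<in>S. gn n f) * (\<Prod>v\<in>verts n - S. gn n g))"
    unfolding H_def by (intro sum.cong refl prod_if_subset[where p="\<lambda>_. gn n"]) auto
  also have "\<dots> = (\<Prod>v\<in>verts n. gn n f + gn n g)"
    by (rule prod_add[symmetric]) simp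
  also have "\<dots> = (gn n f + gn n g) ^ (2 ^ n)" by (simp add: card_verts)
  finally show "gn n (\<lambda>x. f x + g x) ^ Suc (2 ^ n - 1) \<le> (gn n f + gn n g) ^ Suc (2 ^ n - 1)"
    using gn_power(1)[OF fg n] by simp
  show "0 \<le> gn n f + gn n g" using gn_power(2) f g n by simp
qed

section \<open>Brackets\<close>

abbreviation "br \<equiv> bracket \<omega> G T \<mu>"

abbreviation "kprod n F x t \<equiv> \<Prod>v\<in>K n. (cnj ^^ card v) (F v (sh v x t))"

lemma jbm_kprod:
  assumes "\<And>v. v \<in> K n \<Longrightarrow> bm A (F v)"
  shows "jbm T \<mu> (VT {..<n}) (VM {..<n}) (kprod n F)"
  by (rule jbm_prod_sh[where f="\<lambda>v z. (cnj ^^ card v) (F v z)"])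
    (use assms in \<open>auto simp: K_def verts_def\<close>)

lemma bm_kprod:
  assumes "\<And>v. v \<in> K n \<Longrightarrow> bm A (F v)" "x \<in> space A"
  shows "bm (V {..<n}) (kprod n F x)"
  by (rule jbm_iterated(1)[OF us_A us_V jbm_kprod[OF assms(1)] assms(2)]) simp_all

lemma bm_bracket:
  assumes F: "\<And>v. v \<in> K n \<Longrightarrow> bm A (F v)"
  shows "bm A (br n F)"
proof -
  from jbm_iterated(2)[OF us_A us_V jbm_kprod[OF F]] show ?thesis
    using bracket_eq[OF _ F] by (subst bm_cong) auto
qed

text \<open>The cube measure disintegrates over the base point, which is the vertex 0. A bracket is
  the integral of the remaining factors over the fibre, so it represents them against any function
  of that vertex.\<close>

lemma integral_bracket:
  assumes g: "bm A g" and F: "\<And>v. v \<in> K n \<Longrightarrow> bm A (F v)"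
  shows "(\<integral>x. g x * br n F x \<partial>A) =
    (\<integral>c. g (psi \<omega> {} c) * (\<Prod>v\<in>K n. (cnj ^^ card v) (F v (psi \<omega> v c))) \<partial>C n)"
proof -
  \<comment> \<open>\<open>g\<close> is placed at the vertex 0, so that the formula for products
    over all vertices applies.\<close>
  define f where "f v z = (if v = {} then g z else (cnj ^^ card v) (F v z))" for v z
  have f: "bm A (f v)" if "v \<in> verts n" for v
  proof (cases "v = {}")
    case True
    then have "f v = g" by (auto simp: f_def)
    then show ?thesis using g by simp
  next
    case False
    then have "f v = (\<lambda>z. (cnj ^^ card v) (F v z))" "v \<in> K n" using that by (auto simp: f_def K_def)
    then show ?thesis using F by auto
  qed
  have split: "(\<Prod>v\<in>verts n. f v (h v)) = g (h {}) * (\<Prod>v\<in>K n. (cnj ^^ card v) (F v (h v)))" for h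
  proof -
    have "(\<Prod>v\<in>verts n. f v (h v)) = f {} (h {}) * (\<Prod>v\<in>K n. f v (h v))"
      unfolding verts_K(1) by (rule prod.insert) (simp_all add: verts_K(2))
    also have "(\<Prod>v\<in>K n. f v (h v)) = (\<Prod>v\<in>K n. (cnj ^^ card v) (F v (h v)))"
      by (rule prod.cong) (auto simp: f_def K_def)
    finally show ?thesis by (simp add: f_def)
  qed
  have "(\<integral>c. g (psi \<omega> {} c) * (\<Prod>v\<in>K n. (cnj ^^ card v) (F v (psi \<omega> v c))) \<partial>C n) =
      (\<integral>c. (\<Prod>v\<in>verts n. f v (psi \<omega> v c)) \<partial>C n)"
    by (simp add: split)
  also have "\<dots> = (\<integral>x. (\<integral>t. (\<Prod>v\<in>verts n. f v (sh v x t)) \<partial>V {..<n}) \<partial>A)"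
    by (rule integral_cube_prod[OF f]) auto
  also have "\<dots> = (\<integral>x. g x * br n F x \<partial>A)"
  proof (rule Bochner_Integration.integral_cong[OF refl])
    fix x assume x: "x \<in> space A"
    have "(\<integral>t. (\<Prod>v\<in>verts n. f v (sh v x t)) \<partial>V {..<n}) =
        (\<integral>t. g x * kprod n F x t \<partial>V {..<n})"
      by (simp add: split sh_empty[OF x])
    then show "(\<integral>t. (\<Prod>v\<in>verts n. f v (sh v x t)) \<partial>V {..<n}) = g x * br n F x"
      using bracket_eq[OF x F] by simp
  qed
  finally show ?thesis by simp
qed

lemma ip_bracket:
  assumes F: "\<And>v. v \<in> verts n \<Longrightarrow> bm A (F v)"
  shows "ip n F = (\<integral>x. F {} x * br n F x \<partial>A)"
  unfolding ip_def using integral_bracket[of "F {}" n F] F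
  by (simp add: verts_K)

text \<open>For fixed directions the vertex is a translate of the base point, hence distributed by
  the same invariant measure.\<close>

lemma integral_psi:
  assumes f: "bm A f" and v: "v \<in> verts n"
  shows "(\<integral>c. f (psi \<omega> v c) \<partial>C n) = (\<integral>x. f x \<partial>A)"
proof -
  have v': "finite v" "v \<subseteq> {..<n}" using v by (auto simp: verts_def finite_subset)
  interpret P: prob_space "V {..<n}" by (rule prob_space_L[OF us_V]) simp
  have "(\<integral>c. f (psi \<omega> v c) \<partial>C n) = (\<integral>x. (\<integral>t. f (sh v x t) \<partial>V {..<n}) \<partial>A)"
    using integral_cube_prod[of "{v}" "\<lambda>_. f" n] f v by simp
  also have "\<dots> = (\<integral>t. (\<integral>x. f (sh v x t) \<partial>A) \<partial>V {..<n})"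
    by (rule fubini[OF us_A us_V jbm_sh[OF f v']]) simp
  also have "\<dots> = (\<integral>t. (\<integral>x. f x \<partial>A) \<partial>V {..<n})"
  proof (rule Bochner_Integration.integral_cong[OF refl])
    fix t assume t: "t \<in> space (V {..<n})"
    have ft: "fp v t \<in> space A" by (rule fp_closed[OF t v'(2)])
    have "(\<integral>x. f (sh v x t) \<partial>A) = (\<integral>x. f (add (fp v t) x) \<partial>A)"
      by (rule Bochner_Integration.integral_cong) (auto simp: sh_eq_add add_commute ft)
    also have "\<dots> = (\<integral>x. f x \<partial>A)" by (rule integral_add(2)[OF ft f])
    finally show "(\<integral>x. f (sh v x t) \<partial>A) = (\<integral>x. f x \<partial>A)" .
  qed
  finally show ?thesis by (simp add: P.prob_space)
qed

lemma distr_psi: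
  assumes v: "v \<in> verts n"
  shows "distr (C n) A (psi \<omega> v) = A"
proof (rule measure_eqI)
  interpret PA: prob_space A by (rule prob_space_L[OF us_A])
  interpret PC: prob_space "C n" by (rule prob_space_L[OF us_C])
  fix S assume "S \<in> sets (distr (C n) A (psi \<omega> v))"
  then have S: "S \<in> sets A" by simp
  have m: "psi \<omega> v -` S \<inter> space (C n) \<in> sets (C n)" by (rule measurable_sets[OF measurable_psi[OF v] S])
  have "complex_of_real (measure (C n) (psi \<omega> v -` S \<inter> space (C n))) = (\<integral>c. indicator S (psi \<omega> v c) \<partial>C n)"
  proof -
    have "(\<integral>c. indicator S (psi \<omega> v c) \<partial>C n) =
      (\<integral>c. complex_of_real (indicator (psi \<omega> v -` S \<inter> space (C n)) c) \<partial>C n)"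
      by (rule Bochner_Integration.integral_cong) (auto simp: indicator_def)
    then show ?thesis using m by (simp add: integral_complex_of_real)
  qed
  also have "\<dots> = (\<integral>x. indicator S x \<partial>A)" by (rule integral_psi[OF bm_indicator[OF S] v])
  also have "\<dots> = (\<integral>x. complex_of_real (indicator S x) \<partial>A)"
    by (rule Bochner_Integration.integral_cong) (auto simp: indicator_def)
  also have "\<dots> = complex_of_real (measure A S)"
    using S by (simp add: integral_complex_of_real)
  finally show "emeasure (distr (C n) A (psi \<omega> v)) S = emeasure A S"
    by (simp add: emeasure_distr[OF measurable_psi[OF v] S] PA.emeasure_eq_measure PC.emeasure_eq_measure)
qed simp

lemma AE_psi:
  assumes "AE x in A. P x" "v \<in> verts n"
  shows "AE c in C n. P (psi \<omega> v c)"
  by (rule AE_distrD[OF measurable_psi[OF assms(2)]]) (unfold distr_psi[OF assms(2)], rule assms(1))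

text \<open>Every vertex of a random cube has the distribution of a random point, so the cubes with
  some vertex in a given null set form a null set. This lets members of \<open>L_infty\<close> be
  replaced by bounded representatives.\<close>

lemma gn_cong_AE:
  assumes "f \<in> borel_measurable A" "g \<in> borel_measurable A" "AE x in A. f x = g x"
  shows "gn n f = gn n g"
proof -
  have m: "(\<lambda>c. \<Prod>v\<in>verts n. (cnj ^^ card v) (h (psi \<omega> v c))) \<in> borel_measurable (C n)"
    if "h \<in> borel_measurable A" for h
  proof (rule borel_measurable_prod)
    fix v assume v: "v \<in> verts n"
    have "(cnj ^^ card v) \<in> borel_measurable borel"
      by (intro borel_measurable_continuous_onI)
        (cases "even (card v)"; simp add: cnj_pow_cases continuous_intros)
    then show "(\<lambda>c. (cnj ^^ card v) (h (psi \<omega> v c))) \<in> borel_measurable (C n)"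
      using measurable_compose[OF measurable_compose[OF measurable_psi[OF v] that]] by auto
  qed
  have "AE c in C n. \<forall>v\<in>verts n. f (psi \<omega> v c) = g (psi \<omega> v c)"
    by (intro AE_finite_allI AE_psi[OF assms(3)]) auto
  then have "AE c in C n. (\<Prod>v\<in>verts n. (cnj ^^ card v) (f (psi \<omega> v c))) =
      (\<Prod>v\<in>verts n. (cnj ^^ card v) (g (psi \<omega> v c)))"
    by eventually_elim simp
  from integral_cong_AE[OF m[OF assms(1)] m[OF assms(2)] this] show ?thesis
    by (simp add: gowers_norm_def Cube_def)
qed

end

section \<open>Orthogonality to a sub-\<open>\<sigma>\<close>-algebra\<close>

text \<open>Testing on indicators involves no choice of a version of a conditional expectation and
  can be verified on a generating family that is closed under intersections.\<close>

definition perp :: "'a measure \<Rightarrow> 'a measure \<Rightarrow> ('a \<Rightarrow> complex) \<Rightarrow> bool" where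
  "perp M N f \<longleftrightarrow> (\<forall>S\<in>sets N. (\<integral>x. indicator S x *\<^sub>R f x \<partial>M) = 0)"

lemma bm_AE_eq_0:
  assumes "finite_measure M" "bm M g" "(\<integral>x. g x * cnj (g x) \<partial>M) = 0"
  shows "AE x in M. g x = 0"
proof -
  have i: "integrable M (\<lambda>x. (cmod (g x))\<^sup>2)"
    using integrable_norm[OF bm_integrable[OF assms(1) bm_mult[OF assms(2,2)]]]
    by (simp add: norm_mult power2_eq_square)
  have "(\<integral>x. g x * cnj (g x) \<partial>M) = (\<integral>x. complex_of_real ((cmod (g x))\<^sup>2) \<partial>M)"
    by (simp add: complex_norm_square[symmetric])
  also have "\<dots> = complex_of_real (\<integral>x. (cmod (g x))\<^sup>2 \<partial>M)" by (rule integral_complex_of_real)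
  finally have "(\<integral>x. (cmod (g x))\<^sup>2 \<partial>M) = 0" using assms(3) by simp
  then have "AE x in M. (cmod (g x))\<^sup>2 = 0"
    using integral_nonneg_eq_0_iff_AE[OF i] by simp
  then show ?thesis by eventually_elim simp
qed

lemma sym_diff_null_iff:
  assumes "X \<in> sets M" "Y \<in> sets M"
  shows "sym_diff X Y \<in> null_sets M \<longleftrightarrow> (AE x in M. x \<in> X \<longleftrightarrow> x \<in> Y)"
proof -
  have "sym_diff X Y \<in> sets M" using assms by auto
  then have "sym_diff X Y \<in> null_sets M \<longleftrightarrow> (AE x in M. x \<notin> sym_diff X Y)"
    by (rule AE_iff_null_sets)
  also have "\<dots> \<longleftrightarrow> (AE x in M. x \<in> X \<longleftrightarrow> x \<in> Y)" by (rule AE_cong) auto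
  finally show ?thesis .
qed

context finite_measure_subalgebra begin

lemma real_perp_iff:
  assumes "integrable M f"
  shows "(\<forall>S\<in>sets F. (\<integral>x. indicator S x *\<^sub>R f x \<partial>M) = 0) \<longleftrightarrow> (AE x in M. real_cond_exp M F f x = 0)"
proof
  assume *: "\<forall>S\<in>sets F. (\<integral>x. indicator S x *\<^sub>R f x \<partial>M) = 0"
  show "AE x in M. real_cond_exp M F f x = 0"
    by (rule real_cond_exp_charact) (use * assms in \<open>auto simp: set_lebesgue_integral_def\<close>)
next
  assume *: "AE x in M. real_cond_exp M F f x = 0"
  show "\<forall>S\<in>sets F. (\<integral>x. indicator S x *\<^sub>R f x \<partial>M) = 0"
  proof
    fix S assume S: "S \<in> sets F"
    then have SM: "S \<in> sets M" using subalg by (auto simp: subalgebra_def)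
    have "(\<integral>x. indicator S x *\<^sub>R f x \<partial>M) = (\<integral>x. indicator S x *\<^sub>R real_cond_exp M F f x \<partial>M)"
      using real_cond_exp_intA[OF assms S] by (simp add: set_lebesgue_integral_def)
    also have "\<dots> = (\<integral>x. 0 \<partial>M)"
      by (rule integral_cong_AE) (use * SM in auto)
    finally show "(\<integral>x. indicator S x *\<^sub>R f x \<partial>M) = 0" by simp
  qed
qed

lemma bm_Re_Im:
  assumes "bm M f" shows "integrable M (\<lambda>x. Re (f x))" "integrable M (\<lambda>x. Im (f x))"
  using bm_integrable[OF finite_measure_axioms assms] by auto

text \<open>A complex integral vanishes exactly when the integrals of the real and imaginary parts
  do, which reduces the claim to \<open>real_cond_exp\<close>.\<close>

lemma perp_iff:
  assumes f: "bm M f"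
  shows "perp M F f \<longleftrightarrow> (AE x in M. complex_cond_exp M F f x = 0)"
proof -
  have ind: "bm M (\<lambda>x. indicator S x *\<^sub>R f x)" if "S \<in> sets F" for S
  proof -
    have "S \<in> sets M" using that subalg by (auto simp: subalgebra_def)
    from bm_mult[OF bm_indicator[OF this] f] show ?thesis
      by (rule bm_cong[THEN iffD1, rotated]) (simp add: indicator_def)
  qed
  have "(\<integral>x. indicator S x *\<^sub>R f x \<partial>M) = 0 \<longleftrightarrow>
      (\<integral>x. indicator S x *\<^sub>R Re (f x) \<partial>M) = 0 \<and> (\<integral>x. indicator S x *\<^sub>R Im (f x) \<partial>M) = 0"
    if S: "S \<in> sets F" for S
    using integral_Re[OF bm_integrable[OF finite_measure_axioms ind[OF S]]]
      integral_Im[OF bm_integrable[OF finite_measure_axioms ind[OF S]]]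
    by (simp add: complex_eq_iff)
  then have "perp M F f \<longleftrightarrow> (\<forall>S\<in>sets F. (\<integral>x. indicator S x *\<^sub>R Re (f x) \<partial>M) = 0) \<and>
      (\<forall>S\<in>sets F. (\<integral>x. indicator S x *\<^sub>R Im (f x) \<partial>M) = 0)"
    unfolding perp_def by blast
  also have "\<dots> \<longleftrightarrow> (AE x in M. complex_cond_exp M F f x = 0)"
    unfolding real_perp_iff[OF bm_Re_Im(1)[OF f]] real_perp_iff[OF bm_Re_Im(2)[OF f]]
    by (simp add: complex_cond_exp_def complex_eq_iff)
  finally show ?thesis .
qed

text \<open>Orthogonality to indicators extends to bounded measurable functions because a measurable
  factor can be pulled out of a conditional expectation. Real and imaginary parts give four real
  products of this kind.\<close>

lemma perp_integral:
  assumes f: "bm M f" and p: "perp M F f" and h: "bm F h"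
  shows "(\<integral>x. f x * h x \<partial>M) = 0"
proof -
  have hM: "bm M h" by (rule bm_subalg[OF subalg h])
  have "AE x in M. complex_cond_exp M F f x = 0" using perp_iff[OF f] p by simp
  then have E: "AE x in M. real_cond_exp M F (\<lambda>x. Re (f x)) x = 0" "AE x in M. real_cond_exp M F (\<lambda>x. Im (f x)) x = 0"
    by (eventually_elim, simp add: complex_cond_exp_def complex_eq_iff)+
  have hm: "(\<lambda>x. Re (h x)) \<in> borel_measurable F" "(\<lambda>x. Im (h x)) \<in> borel_measurable F"
    using bm_meas[OF h] by auto
  have fm: "(\<lambda>x. Re (f x)) \<in> borel_measurable M" "(\<lambda>x. Im (f x)) \<in> borel_measurable M"
    using bm_meas[OF f] by auto
  have hb: "bm M (\<lambda>x. complex_of_real (Re (h x)))" "bm M (\<lambda>x. complex_of_real (Im (h x)))"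
    and fb: "bm M (\<lambda>x. complex_of_real (Re (f x)))" "bm M (\<lambda>x. complex_of_real (Im (f x)))"
  proof -
    have "bm M (\<lambda>x. complex_of_real (Re (k x)))" "bm M (\<lambda>x. complex_of_real (Im (k x)))" if k: "bm M k" for k
    proof -
      obtain C where C: "\<And>x. x \<in> space M \<Longrightarrow> cmod (k x) \<le> C" using k by (rule bmE) blast
      have [measurable]: "k \<in> borel_measurable M" by (rule bm_meas[OF k])
      show "bm M (\<lambda>x. complex_of_real (Re (k x)))" "bm M (\<lambda>x. complex_of_real (Im (k x)))"
        by (rule bmI[where C=C], measurable,
            use C in \<open>auto intro: order.trans[OF abs_Re_le_cmod] order.trans[OF abs_Im_le_cmod]\<close>)+
    qed
    then show "bm M (\<lambda>x. complex_of_real (Re (h x)))" "bm M (\<lambda>x. complex_of_real (Im (h x)))"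
      "bm M (\<lambda>x. complex_of_real (Re (f x)))" "bm M (\<lambda>x. complex_of_real (Im (f x)))"
      using hM f by auto
  qed
  have zero: "(\<integral>x. a x * b x \<partial>M) = 0"
    if a: "a \<in> borel_measurable F" and b: "b \<in> borel_measurable M"
      and ab: "bm M (\<lambda>x. complex_of_real (a x))" "bm M (\<lambda>x. complex_of_real (b x))"
      and z: "AE x in M. real_cond_exp M F b x = 0" for a b :: "'a \<Rightarrow> real"
  proof -
    have "integrable M (\<lambda>x. a x * b x)"
      using integrable_Re[OF bm_integrable[OF finite_measure_axioms bm_mult[OF ab]]] by simp
    from real_cond_exp_intg(2)[OF this a b]
    have "(\<integral>x. a x * b x \<partial>M) = (\<integral>x. a x * real_cond_exp M F b x \<partial>M)" by simp
    also have "\<dots> = (\<integral>x. 0 \<partial>M)"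
      by (rule integral_cong_AE) (use z a measurable_from_subalg[OF subalg a] in auto)
    finally show ?thesis by simp
  qed
  have int: "integrable M (\<lambda>x. f x * h x)" by (rule bm_integrable[OF finite_measure_axioms bm_mult[OF f hM]])
  have ii: "integrable M (\<lambda>x. a x * b x)"
    if "bm M (\<lambda>x. complex_of_real (a x))" "bm M (\<lambda>x. complex_of_real (b x))" for a b
    using integrable_Re[OF bm_integrable[OF finite_measure_axioms bm_mult[OF that]]] by simp
  have "Re (\<integral>x. f x * h x \<partial>M) = (\<integral>x. Re (h x) * Re (f x) - Im (h x) * Im (f x) \<partial>M)"
    using integral_Re[OF int] by (simp add: mult.commute)
  also have "\<dots> = 0"
    using zero[OF hm(1) fm(1) hb(1) fb(1) E(1)] zero[OF hm(2) fm(2) hb(2) fb(2) E(2)]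
    by (subst Bochner_Integration.integral_diff) (auto intro: ii hb fb)
  finally have re: "Re (\<integral>x. f x * h x \<partial>M) = 0" .
  have "Im (\<integral>x. f x * h x \<partial>M) = (\<integral>x. Im (h x) * Re (f x) + Re (h x) * Im (f x) \<partial>M)"
    using integral_Im[OF int] by (simp add: algebra_simps)
  also have "\<dots> = 0"
    using zero[OF hm(2) fm(1) hb(2) fb(1) E(1)] zero[OF hm(1) fm(2) hb(1) fb(2) E(2)]
    by (subst Bochner_Integration.integral_add) (auto intro: ii hb fb)
  finally show ?thesis using re by (simp add: complex_eq_iff)
qed

text \<open>The library function \<open>real_cond_exp\<close> is bounded only almost everywhere.\<close>

lemma ex_projection:
  assumes f: "bm M f"
  shows "\<exists>E. bm F E \<and> perp M F (\<lambda>x. f x - E x)"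
proof -
  obtain C where C: "C \<ge> 0" "\<And>x. x \<in> space M \<Longrightarrow> cmod (f x) \<le> C" using f by (rule bmE) blast
  have r: "\<exists>E. E \<in> borel_measurable F \<and> (\<forall>x. \<bar>E x\<bar> \<le> C) \<and> (AE x in M. real_cond_exp M F g x = E x)"
    if g: "integrable M g" "\<And>x. x \<in> space M \<Longrightarrow> \<bar>g x\<bar> \<le> C" for g :: "'a \<Rightarrow> real"
  proof (intro exI conjI)
    let ?E = "\<lambda>x. max (-C) (min C (real_cond_exp M F g x))"
    show "?E \<in> borel_measurable F" by measurable
    show "\<forall>x. \<bar>?E x\<bar> \<le> C" using C(1) by auto
    have "g x \<le> C" "g x \<ge> -C" if "x \<in> space M" for x using g(2)[OF that] by auto
    then have "AE x in M. g x \<le> C" "AE x in M. g x \<ge> -C" by (auto intro!: AE_I2)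
    then have "AE x in M. real_cond_exp M F g x \<le> C" "AE x in M. real_cond_exp M F g x \<ge> -C"
      using real_cond_exp_le_c[OF g(1)] real_cond_exp_ge_c[OF g(1)] by auto
    then show "AE x in M. real_cond_exp M F g x = ?E x" by eventually_elim auto
  qed
  obtain E1 where E1: "E1 \<in> borel_measurable F" "\<And>x. \<bar>E1 x\<bar> \<le> C"
      "AE x in M. real_cond_exp M F (\<lambda>x. Re (f x)) x = E1 x"
    using r[OF bm_Re_Im(1)[OF f]] C(2) abs_Re_le_cmod order.trans by meson
  obtain E2 where E2: "E2 \<in> borel_measurable F" "\<And>x. \<bar>E2 x\<bar> \<le> C"
      "AE x in M. real_cond_exp M F (\<lambda>x. Im (f x)) x = E2 x"
    using r[OF bm_Re_Im(2)[OF f]] C(2) abs_Im_le_cmod order.trans by meson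
  define E where "E x = Complex (E1 x) (E2 x)" for x
  have E: "bm F E"
  proof (rule bmI)
    have "(\<lambda>x. complex_of_real (E1 x) + \<i> * complex_of_real (E2 x)) \<in> borel_measurable F"
      using E1(1) E2(1) by measurable
    then show "E \<in> borel_measurable F" by (simp add: E_def[abs_def] Complex_eq)
    show "cmod (E x) \<le> C + C" for x
      using cmod_le[of "E x"] E1(2)[of x] E2(2)[of x] by (simp add: E_def)
  qed
  have EM: "bm M E" by (rule bm_subalg[OF subalg E])
  have d: "AE x in M. real_cond_exp M F (\<lambda>x. g x - e x) x = 0"
    if "integrable M g" "integrable M e" "e \<in> borel_measurable F"
      "AE x in M. real_cond_exp M F g x = e x" for g e :: "'a \<Rightarrow> real"
    using real_cond_exp_diff[OF that(1,2)] real_cond_exp_F_meas[OF that(2,3)] that(4)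
    by eventually_elim simp
  have "AE x in M. complex_cond_exp M F (\<lambda>x. f x - E x) x = 0"
    using d[OF bm_Re_Im(1)[OF f] _ E1(1,3)] d[OF bm_Re_Im(2)[OF f] _ E2(1,3)] bm_Re_Im[OF EM]
    by (simp add: complex_cond_exp_def complex_eq_iff E_def)
  then have "perp M F (\<lambda>x. f x - E x)" using perp_iff[OF bm_diff[OF f EM]] by simp
  with E show ?thesis by blast
qed

lemma perp_cnj: assumes "perp M F f" shows "perp M F (\<lambda>x. cnj (f x))"
  unfolding perp_def
proof
  fix S assume S: "S \<in> sets F"
  have "(\<integral>x. indicator S x *\<^sub>R cnj (f x) \<partial>M) = (\<integral>x. cnj (indicator S x *\<^sub>R f x) \<partial>M)" by simp
  also have "\<dots> = cnj (\<integral>x. indicator S x *\<^sub>R f x \<partial>M)" by (rule Bochner_Integration.integral_cnj)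
  finally show "(\<integral>x. indicator S x *\<^sub>R cnj (f x) \<partial>M) = 0" using assms S by (simp add: perp_def)
qed

text \<open>Membership by duality: the remainder \<open>g\<close> after projection is orthogonal to
  \<open>F\<close>, so its conjugate is an admissible test function. It pairs to zero with
  \<open>h\<close> by hypothesis and with \<open>E\<close> by orthogonality, whence the integral of
  the squared modulus of \<open>g\<close> vanishes.\<close>

lemma AE_eq_measurable_if_perp:
  assumes h: "bm M h" and *: "\<And>g. bm M g \<Longrightarrow> perp M F g \<Longrightarrow> (\<integral>x. g x * h x \<partial>M) = 0"
  shows "\<exists>E. bm F E \<and> (AE x in M. h x = E x)"
proof -
  obtain E where E: "bm F E" "perp M F (\<lambda>x. h x - E x)" using ex_projection[OF h] by blast
  have EM: "bm M E" by (rule bm_subalg[OF subalg E(1)])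
  define g where "g x = h x - E x" for x
  have g: "bm M g" unfolding g_def using h EM by auto
  have gc: "bm M (\<lambda>x. cnj (g x))" using g by auto
  have pg: "perp M F (\<lambda>x. cnj (g x))" unfolding g_def by (rule perp_cnj[OF E(2)])
  have "(\<integral>x. g x * cnj (g x) \<partial>M) = (\<integral>x. cnj (g x) * h x - cnj (g x) * E x \<partial>M)"
    by (simp add: g_def algebra_simps)
  also have "\<dots> = (\<integral>x. cnj (g x) * h x \<partial>M) - (\<integral>x. cnj (g x) * E x \<partial>M)"
    using gc h EM by (intro Bochner_Integration.integral_diff bm_integrable[OF finite_measure_axioms]) auto
  also have "\<dots> = 0" using *[OF gc pg] perp_integral[OF gc pg E(1)] by simp
  finally have "AE x in M. g x = 0" by (rule bm_AE_eq_0[OF finite_measure_axioms g])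
  with E(1) show ?thesis by (intro exI[of _ E]) (auto simp: g_def)
qed

end

section \<open>The \<open>\<sigma>\<close>-algebras \<open>\<F>\<^sub>k\<close>\<close>

context ultra_haar begin

abbreviation "\<Phi> \<equiv> Fk \<omega> G T \<mu>"
abbreviation "JK n \<B> \<equiv> join_K \<omega> (C n) n \<B>"

text \<open>The join as a measurable space of its own, so that it can serve as the subalgebra in
  \<open>finite_measure_subalgebra\<close>.\<close>

definition JM :: "nat \<Rightarrow> 'a upoint measure \<Rightarrow> (nat set \<Rightarrow> 'a) upoint measure" where
  "JM n N = sigma (space (C n)) (\<Union>v\<in>K n. pull \<omega> (C n) v (sets N))"

lemma space_JM [simp]: "space (JM n N) = space (C n)"
  and sets_JM: "sets (JM n N) = JK n (sets N)"
proof -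
  have "(\<Union>v\<in>K n. pull \<omega> (C n) v (sets N)) \<subseteq> Pow (space (C n))" by (auto simp: pull_def)
  then show "space (JM n N) = space (C n)" "sets (JM n N) = JK n (sets N)"
    by (simp_all add: JM_def join_K_def)
qed

lemma measurable_psi_JM:
  assumes "v \<in> K n" "space N = space A"
  shows "psi \<omega> v \<in> JM n N \<rightarrow>\<^sub>M N"
proof (rule measurableI)
  fix c assume "c \<in> space (JM n N)"
  then show "psi \<omega> v c \<in> space N"
    using measurable_space[OF measurable_psi] assms by (auto simp: K_def)
next
  fix S assume "S \<in> sets N"
  then have "psi \<omega> v -` S \<inter> space (C n) \<in> (\<Union>v\<in>K n. pull \<omega> (C n) v (sets N))"
    using assms(1) by (auto simp: pull_def)
  then show "psi \<omega> v -` S \<inter> space (JM n N) \<in> sets (JM n N)"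
    unfolding sets_JM space_JM join_K_def by (rule sigma_sets.Basic)
qed

lemma subalgebra_JM:
  assumes "subalgebra A N"
  shows "subalgebra (C n) (JM n N)"
proof -
  have "(\<Union>v\<in>K n. pull \<omega> (C n) v (sets N)) \<subseteq> sets (C n)"
    using assms measurable_sets[OF measurable_psi] by (auto simp: pull_def subalgebra_def K_def)
  then have "JK n (sets N) \<subseteq> sets (C n)"
    unfolding join_K_def by (rule sets.sigma_sets_subset)
  then show ?thesis by (simp add: subalgebra_def sets_JM)
qed

lemma fms_C: "subalgebra A N \<Longrightarrow> finite_measure_subalgebra (C n) (JM n N)"
  using fm_C subalgebra_JM by (simp add: finite_measure_subalgebra_def finite_measure_subalgebra_axioms_def)

lemma fms_A: "subalgebra A N \<Longrightarrow> finite_measure_subalgebra A N"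
  using fm_A by (simp add: finite_measure_subalgebra_def finite_measure_subalgebra_axioms_def)

lemma bounded_family_iff: "bounded_family A n F \<longleftrightarrow> (\<forall>v\<in>K n. bm A (F v))"
  by (simp add: bounded_family_def bm_def)

abbreviation "gens k \<equiv> {br (k + 1) F -` B \<inter> space A | F B. (\<forall>v\<in>K (k + 1). bm A (F v)) \<and> B \<in> sets borel}"

lemma space_Fk: "space (\<Phi> k) = space A"
  and sets_Fk: "sets (\<Phi> k) = sigma_sets (space A)
    (gens k)"
proof -
  have "gens k \<subseteq> Pow (space A)"
    by auto
  then show "space (\<Phi> k) = space A" "sets (\<Phi> k) = sigma_sets (space A)
      (gens k)"
    unfolding Fk_def UA_def bounded_family_iff by (rule space_measure_of, rule sets_measure_of)
qed

lemma subalgebra_Fk: "subalgebra A (\<Phi> k)"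
proof -
  have "sets (\<Phi> k) \<subseteq> sets A"
    unfolding sets_Fk
    by (rule sets.sigma_sets_subset) (auto intro!: measurable_sets bm_meas bm_bracket)
  then show ?thesis by (simp add: subalgebra_def space_Fk)
qed

lemma bm_Fk_bracket:
  assumes F: "\<And>v. v \<in> K (k + 1) \<Longrightarrow> bm A (F v)"
  shows "bm (\<Phi> k) (br (k + 1) F)"
proof -
  have "br (k + 1) F \<in> borel_measurable (\<Phi> k)"
  proof (rule measurableI)
    fix B :: "complex set" assume "B \<in> sets borel"
    then show "br (k + 1) F -` B \<inter> space (\<Phi> k) \<in> sets (\<Phi> k)"
      unfolding sets_Fk space_Fk using F by (intro sigma_sets.Basic) blast
  qed simp
  with bm_bracket[of "k + 1" F] F show ?thesis by (auto simp: bm_def space_Fk)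
qed

subsection \<open>Shift invariance\<close>

lemma bm_translate:
  assumes "s \<in> space A" "bm A f" shows "bm A (\<lambda>x. f (add x s))"
  using integral_add(1)[OF assms]
  by (rule bm_cong[THEN iffD1, rotated]) (simp add: add_commute assms(1))

lemma sh_add:
  assumes "x \<in> space A" "s \<in> space A" "t \<in> space (V I)" "v \<subseteq> I"
  shows "sh v (add x s) t = add (sh v x t) s"
proof -
  have f: "fp v t \<in> space A" by (rule fp_closed[OF assms(3,4)])
  show ?thesis unfolding sh_eq_add
    using add_assoc[OF assms(1,2) f] add_assoc[OF assms(1) f assms(2)] add_commute[OF assms(2) f] by simp
qed

text \<open>Translating the base point translates every vertex, so the shift can be moved into the
  functions. Hence translates of generators of \<open>\<Phi> k\<close> are generators again.\<close>

lemma bracket_translate: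
  assumes F: "\<And>v. v \<in> K n \<Longrightarrow> bm A (F v)" and x: "x \<in> space A" and s: "s \<in> space A"
  shows "br n F (add x s) = br n (\<lambda>v y. F v (add y s)) x"
proof -
  have "br n F (add x s) = (\<integral>t. (\<Prod>v\<in>K n. (cnj ^^ card v) (F v (sh v (add x s) t))) \<partial>V {..<n})"
    by (rule bracket_eq[OF add_closed[OF x s] F])
  also have "\<dots> = (\<integral>t. (\<Prod>v\<in>K n. (cnj ^^ card v) (F v (add (sh v x t) s))) \<partial>V {..<n})"
  proof (intro Bochner_Integration.integral_cong refl prod.cong)
    fix t v assume t: "t \<in> space (V {..<n})" and "v \<in> K n"
    then have "v \<subseteq> {..<n}" by (auto simp: K_def verts_def)
    then show "(cnj ^^ card v) (F v (sh v (add x s) t)) = (cnj ^^ card v) (F v (add (sh v x t) s))"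
      using sh_add[OF x s t] by simp
  qed
  also have "\<dots> = br n (\<lambda>v y. F v (add y s)) x"
    by (rule bracket_eq[OF x bm_translate[OF s F], symmetric])
  finally show ?thesis .
qed

lemma measurable_translate_Fk:
  assumes s: "s \<in> space A"
  shows "(\<lambda>x. add x s) \<in> \<Phi> k \<rightarrow>\<^sub>M \<Phi> k"
proof (rule measurable_sigma_sets[OF sets_Fk])
  show "gens k \<subseteq> Pow (space A)"
    by auto
  show "(\<lambda>x. add x s) \<in> space (\<Phi> k) \<rightarrow> space A" using s by (auto simp: space_Fk add_closed)
  fix S assume "S \<in> gens k"
  then obtain F B where S: "S = br (k + 1) F -` B \<inter> space A" and F: "\<And>v. v \<in> K (k + 1) \<Longrightarrow> bm A (F v)"
    and B: "B \<in> sets borel" by blast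
  have "(\<lambda>x. add x s) -` S \<inter> space (\<Phi> k) = br (k + 1) (\<lambda>v y. F v (add y s)) -` B \<inter> space (\<Phi> k)"
    using bracket_translate[OF F _ s] s by (auto simp: S space_Fk add_closed)
  also have "\<dots> \<in> sets (\<Phi> k)"
    by (rule measurable_sets[OF bm_meas[OF bm_Fk_bracket] B]) (rule bm_translate[OF s F])
  finally show "(\<lambda>x. add x s) -` S \<inter> space (\<Phi> k) \<in> sets (\<Phi> k)" .
qed

lemma measurable_translate_A:
  assumes s: "s \<in> space A"
  shows "(\<lambda>x. add x s) \<in> A \<rightarrow>\<^sub>M A"
proof (rule measurableI)
  show "add x s \<in> space A" if "x \<in> space A" for x by (rule add_closed[OF that s])
  fix S assume S: "S \<in> sets A"
  \<comment> \<open>The preimage of \<open>S\<close> is the level set at 1 of the translated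
    indicator.\<close>
  have "bm A (\<lambda>x. indicator S (add x s))" by (rule bm_translate[OF s bm_indicator[OF S]])
  from measurable_sets[OF bm_meas[OF this], of "{1}"]
  have "(\<lambda>x. indicator S (add x s) :: complex) -` {1} \<inter> space A \<in> sets A" by simp
  moreover have "(\<lambda>x. indicator S (add x s) :: complex) -` {1} \<inter> space A = (\<lambda>x. add x s) -` S \<inter> space A"
    by (auto simp: indicator_def)
  ultimately show "(\<lambda>x. add x s) -` S \<inter> space A \<in> sets A" by simp
qed

lemma shift_invariant_Fk: "shift_invariant \<omega> G (sets (\<Phi> k))"
  unfolding shift_invariant_def space_A[symmetric]
proof (intro ballI)
  fix S t assume S: "S \<in> sets (\<Phi> k)" and t: "t \<in> space A"
  have SA: "S \<subseteq> space A" using sets.sets_into_space[OF S] by (simp add: space_Fk)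
  obtain t' where t': "t' \<in> space A" "\<And>x. x \<in> space A \<Longrightarrow> add (add x t) t' = x"
    "\<And>x. x \<in> space A \<Longrightarrow> add (add x t') t = x"
    by (rule add_inverse[OF t]) blast
  \<comment> \<open>The shift by \<open>t'\<close> undoes the shift by \<open>t\<close>, so the
    image is a preimage and measurability of shifts applies.\<close>
  have "(\<lambda>x. add x t) ` S = (\<lambda>x. add x t') -` S \<inter> space (\<Phi> k)"
  proof (intro equalityI subsetI)
    fix y assume "y \<in> (\<lambda>x. add x t) ` S"
    then show "y \<in> (\<lambda>x. add x t') -` S \<inter> space (\<Phi> k)"
      using SA t'(2) t by (auto simp: space_Fk add_closed subset_eq)
  next
    fix y assume "y \<in> (\<lambda>x. add x t') -` S \<inter> space (\<Phi> k)"
    then show "y \<in> (\<lambda>x. add x t) ` S"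
      using t'(3)[of y] by (intro image_eqI[of _ _ "add y t'"]) (auto simp: space_Fk)
  qed
  also have "\<dots> \<in> sets (\<Phi> k)" by (rule measurable_sets[OF measurable_translate_Fk[OF t'(1)] S])
  finally show "(\<lambda>x. add x t) ` S \<in> sets (\<Phi> k)" .
qed

subsection \<open>Brackets at the base point of a cube\<close>

text \<open>Any cube with the given base point may serve as origin for the directions: replacing
  \<open>r\<close> by \<open>vmul {..<n} t r\<close> preserves the integral and turns each vertex
  into the corresponding vertex of \<open>c\<close>, moved along \<open>r\<close>. The value at the
  base point is thereby expressed through the other vertices only.\<close>

lemma bracket_psi_shift:
  assumes c: "c \<in> space (C n)" and F: "\<And>v. v \<in> K n \<Longrightarrow> bm A (F v)"
  shows "br n F (psi \<omega> {} c) = (\<integral>r. (\<Prod>v\<in>K n. (cnj ^^ card v) (F v (sh v (psi \<omega> v c) r))) \<partial>V {..<n})"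
proof -
  obtain x t where x: "x \<in> space A" and t: "t \<in> space (V {..<n})" and c_eq: "c = ucube n x t"
    by (rule cube_E[OF c])
  have sub: "v \<subseteq> {..<n}" "v \<in> verts n" if "v \<in> K n" for v using that by (auto simp: K_def verts_def)
  have p0: "psi \<omega> {} c = x" unfolding c_eq by (subst psi_ucube) (auto simp: verts_def sh_empty[OF x])
  let ?H = "\<lambda>r. \<Prod>v\<in>K n. (cnj ^^ card v) (F v (sh v x r))"
  have H: "bm (V {..<n}) ?H" by (rule bm_kprod[OF F x])
  have "br n F x = (\<integral>r. ?H r \<partial>V {..<n})" by (rule bracket_eq[OF x F])
  also have "\<dots> = (\<integral>r. ?H (vmul {..<n} t r) \<partial>V {..<n})" by (rule integral_vmul[OF t H, symmetric]) simp
  also have "\<dots> = (\<integral>r. (\<Prod>v\<in>K n. (cnj ^^ card v) (F v (sh v (psi \<omega> v c) r))) \<partial>V {..<n})"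
  proof (intro Bochner_Integration.integral_cong refl prod.cong)
    fix r v assume r: "r \<in> space (V {..<n})" and v: "v \<in> K n"
    show "(cnj ^^ card v) (F v (sh v x (vmul {..<n} t r))) = (cnj ^^ card v) (F v (sh v (psi \<omega> v c) r))"
      using sh_vmul[OF x t r sub(1)[OF v]] psi_ucube[OF sub(2)[OF v], of x t] by (simp add: c_eq)
  qed
  finally show ?thesis by (simp add: p0)
qed

text \<open>Reading off a vertex and moving it along \<open>r\<close> form one internal map of a
  cube and a direction vector. Its continuity at every index gives joint measurability in the
  ultraproduct of the products.\<close>

lemma jbm_sh_psi:
  assumes f: "bm A f" and v: "v \<in> verts n"
  shows "jbm (CT n) (CM n) (VT {..<n}) (VM {..<n}) (\<lambda>c r. f (sh v (psi \<omega> v c) r))"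
proof -
  have eq: "sh v (psi \<omega> v c) r = umap2 (\<lambda>i c r. c v \<otimes>\<^bsub>G i\<^esub> finprod (G i) r v) c r" for c r
    unfolding sh_def psi_umap umap2_def umap_def uclass_eq_iff
    using urep_uclass[of "\<lambda>i. urep c i v"] by eventually_elim simp
  show ?thesis
    unfolding eq
  proof (rule jbm_umap2[OF f], intro always_eventually allI)
    fix i
    interpret haar_group "G i" "T i" "\<mu> i" by (rule hg)
    show "continuous_map (prod_topology (CT n i) (VT {..<n} i)) (T i)
        (\<lambda>p. fst p v \<otimes>\<^bsub>G i\<^esub> finprod (G i) (snd p) v)"
      using v
      by (intro continuous_mult continuous_finprod_proj[where I="{..<n}"] continuous_map_snd
          continuous_map_compose[OF continuous_map_fst continuous_eval_cube_top, unfolded o_def])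
        (auto simp: verts_def finite_subset)
  qed
qed

text \<open>For fixed \<open>r\<close> each factor is a translate of \<open>F v\<close> at a vertex
  other than 0, which is why \<open>N\<close> has to be stable under shifts. The lemma serves both
  for \<open>A\<close> and for \<open>\<Phi> k\<close>.\<close>

lemma bracket_psi_measurable:
  assumes N: "subalgebra A N" and shift: "\<And>s. s \<in> space A \<Longrightarrow> (\<lambda>x. add x s) \<in> N \<rightarrow>\<^sub>M N"
    and F: "\<And>v. v \<in> K n \<Longrightarrow> bm N (F v)"
  shows "\<exists>E. bm (JM n N) E \<and> (AE c in C n. br n F (psi \<omega> {} c) = E c)"
proof (rule finite_measure_subalgebra.AE_eq_measurable_if_perp[OF fms_C[OF N]])
  interpret J: finite_measure_subalgebra "C n" "JM n N" by (rule fms_C[OF N])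
  have FA: "bm A (F v)" if "v \<in> K n" for v by (rule bm_subalg[OF N F[OF that]])
  have spN: "space N = space A" using N by (simp add: subalgebra_def)
  have Kv: "v \<in> verts n" "v \<subseteq> {..<n}" if "v \<in> K n" for v using that by (auto simp: K_def verts_def)
  have e: "{} \<in> verts n" by (simp add: verts_def)
  show "bm (C n) (\<lambda>c. br n F (psi \<omega> {} c))"
    by (rule bm_compose[OF bm_bracket measurable_psi[OF e]]) (rule FA)
  fix g assume g: "bm (C n) g" and perp: "perp (C n) (JM n N) g"
  let ?P = "\<lambda>c r. \<Prod>v\<in>K n. (cnj ^^ card v) (F v (sh v (psi \<omega> v c) r))"
  have j: "jbm (CT n) (CM n) (VT {..<n}) (VM {..<n}) (\<lambda>c r. g c * ?P c r)"
    by (intro jbm_mult jbm_fst[OF g] jbm_prod jbm_cnj_pow jbm_sh_psi FA Kv)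
  have "(\<integral>c. g c * br n F (psi \<omega> {} c) \<partial>C n) = (\<integral>c. (\<integral>r. g c * ?P c r \<partial>V {..<n}) \<partial>C n)"
    by (rule Bochner_Integration.integral_cong) (simp_all add: bracket_psi_shift FA)
  also have "\<dots> = (\<integral>r. (\<integral>c. g c * ?P c r \<partial>C n) \<partial>V {..<n})"
    by (rule fubini[OF us_C us_V j]) simp
  also have "\<dots> = (\<integral>r. 0 \<partial>V {..<n})"
  proof (rule Bochner_Integration.integral_cong[OF refl])
    fix r assume r: "r \<in> space (V {..<n})"
    have "bm (JM n N) (\<lambda>c. ?P c r)"
    proof (intro bm_prod bm_cnj_pow)
      fix v assume v: "v \<in> K n"
      have "fp v r \<in> space A" by (rule fp_closed[OF r Kv(2)[OF v]])
      then show "bm (JM n N) (\<lambda>c. F v (sh v (psi \<omega> v c) r))"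
        unfolding sh_eq_add
        by (intro bm_compose[OF bm_compose[OF F[OF v] shift] measurable_psi_JM[OF v spN]])
    qed
    from J.perp_integral[OF g perp this] show "(\<integral>c. g c * ?P c r \<partial>C n) = 0" .
  qed
  finally show "(\<integral>c. g c * br n F (psi \<omega> {} c) \<partial>C n) = 0" by simp
qed

text \<open>Agreement almost everywhere survives complements and countable unions, so it passes from
  preimages under brackets to the \<sigma>-algebra that they generate.\<close>

lemma Fk_psi_measurable:
  assumes N: "subalgebra (C (k + 1)) N"
    and E: "\<And>F. (\<And>v. v \<in> K (k + 1) \<Longrightarrow> bm A (F v)) \<Longrightarrow>
      \<exists>E. bm N E \<and> (AE c in C (k + 1). br (k + 1) F (psi \<omega> {} c) = E c)"
    and S: "S \<in> sets (\<Phi> k)"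
  shows "\<exists>B\<in>sets N. AE c in C (k + 1). psi \<omega> {} c \<in> S \<longleftrightarrow> c \<in> B"
  using S unfolding sets_Fk
proof (induction rule: sigma_sets.induct)
  case (Basic S)
  then obtain F B where S: "S = br (k + 1) F -` B \<inter> space A" and F: "\<And>v. v \<in> K (k + 1) \<Longrightarrow> bm A (F v)"
    and B: "B \<in> sets borel" by blast
  have "\<exists>E. bm N E \<and> (AE c in C (k + 1). br (k + 1) F (psi \<omega> {} c) = E c)" by (rule E) (rule F)
  then obtain E where E: "bm N E" "AE c in C (k + 1). br (k + 1) F (psi \<omega> {} c) = E c"
    by (elim exE conjE)
  have "E -` B \<inter> space N \<in> sets N" by (rule measurable_sets[OF bm_meas[OF E(1)] B])
  moreover have "AE c in C (k + 1). psi \<omega> {} c \<in> S \<longleftrightarrow> c \<in> E -` B \<inter> space N"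
    using E(2) AE_space
  proof eventually_elim
    case (elim c)
    have "psi \<omega> {} c \<in> space A"
      by (rule measurable_space[OF measurable_psi elim(2)]) (simp add: verts_def)
    then show ?case using elim N by (auto simp: S subalgebra_def)
  qed
  ultimately show ?case by blast
next
  case Empty
  then show ?case by (intro bexI[of _ "{}"]) auto
next
  case (Compl S)
  then obtain B where B: "B \<in> sets N" "AE c in C (k + 1). psi \<omega> {} c \<in> S \<longleftrightarrow> c \<in> B" by blast
  have "AE c in C (k + 1). psi \<omega> {} c \<in> space A - S \<longleftrightarrow> c \<in> space N - B"
    using B(2) AE_space
  proof eventually_elim
    case (elim c)
    have "psi \<omega> {} c \<in> space A"
      by (rule measurable_space[OF measurable_psi elim(2)]) (simp add: verts_def)
    then show ?case using elim N by (auto simp: subalgebra_def)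
  qed
  with B(1) show ?case by (intro bexI[of _ "space N - B"]) auto
next
  case (Union S)
  then have "\<forall>i. \<exists>B. B \<in> sets N \<and> (AE c in C (k + 1). psi \<omega> {} c \<in> S i \<longleftrightarrow> c \<in> B)" by blast
  from choice[OF this] obtain B where
    "\<forall>i. B i \<in> sets N \<and> (AE c in C (k + 1). psi \<omega> {} c \<in> S i \<longleftrightarrow> c \<in> B i)" by (elim exE)
  then have B: "\<And>i. B i \<in> sets N" "\<And>i. AE c in C (k + 1). psi \<omega> {} c \<in> S i \<longleftrightarrow> c \<in> B i" by auto
  have "AE c in C (k + 1). \<forall>i. psi \<omega> {} c \<in> S i \<longleftrightarrow> c \<in> B i" using B(2) by (simp add: AE_all_countable)
  then have "AE c in C (k + 1). psi \<omega> {} c \<in> (\<Union>i. S i) \<longleftrightarrow> c \<in> (\<Union>i. B i)" by eventually_elim auto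
  with B(1) show ?case by (intro bexI[of _ "\<Union>i. B i"]) auto
qed

lemma subalgebra_A: "subalgebra A A"
  by (simp add: subalgebra_def)

lemma Fk_psi_JM_A:
  assumes "S \<in> sets (\<Phi> k)"
  shows "\<exists>B\<in>sets (JM (k + 1) A). AE c in C (k + 1). psi \<omega> {} c \<in> S \<longleftrightarrow> c \<in> B"
  by (rule Fk_psi_measurable[OF subalgebra_JM[OF subalgebra_A] _ assms])
    (rule bracket_psi_measurable[OF subalgebra_A measurable_translate_A])

text \<open>The bracket of the indicators of the sets \<open>S v\<close>, paired with
  \<open>g\<close>, is the integral of \<open>g\<close> at the vertex 0 over the cubes with every
  other vertex \<open>v\<close> in \<open>S v\<close>. Such sets of cubes generate the join, and a
  Dynkin class argument reaches its other members.\<close>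

lemma perp_psi_JM:
  assumes g: "bm A g" and zero: "\<And>F. (\<And>v. v \<in> K n \<Longrightarrow> bm A (F v)) \<Longrightarrow> (\<integral>x. g x * br n F x \<partial>A) = 0"
  shows "perp (C n) (JM n A) (\<lambda>c. g (psi \<omega> {} c))"
  unfolding perp_def sets_JM
proof
  define PS where "PS = {{c \<in> space (C n). \<forall>v\<in>K n. psi \<omega> v c \<in> S v} | S. \<forall>v\<in>K n. S v \<in> sets A}"
  let ?g = "\<lambda>c. g (psi \<omega> {} c)"
  have Kv: "v \<in> verts n" if "v \<in> K n" for v using that by (auto simp: K_def)
  have gb: "bm (C n) ?g" by (rule bm_compose[OF g measurable_psi]) (simp add: verts_def)
  have gi: "integrable (C n) ?g" by (rule bm_integrable[OF fm_C gb])
  have PS_sub: "PS \<subseteq> Pow (space (C n))" by (auto simp: PS_def)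
  have PS_C: "PS \<subseteq> sets (C n)"
  proof
    fix P assume "P \<in> PS"
    then obtain S where P: "P = {c \<in> space (C n). \<forall>v\<in>K n. psi \<omega> v c \<in> S v}"
      and S: "\<And>v. v \<in> K n \<Longrightarrow> S v \<in> sets A" by (auto simp: PS_def)
    show "P \<in> sets (C n)"
      unfolding P
    proof (rule sets.sets_Collect_finite_All)
      fix v assume v: "v \<in> K n"
      show "{c \<in> space (C n). psi \<omega> v c \<in> S v} \<in> sets (C n)"
        using measurable_sets[OF measurable_psi[OF Kv[OF v]] S[OF v]] by (simp add: vimage_def Int_def conj_commute)
    qed simp
  qed
  then have sC: "sigma_sets (space (C n)) PS \<subseteq> sets (C n)" by (rule sets.sigma_sets_subset)
  have stable: "Int_stable PS"
  proof (rule Int_stableI)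
    fix a b assume "a \<in> PS" "b \<in> PS"
    then obtain S S' where "a = {c \<in> space (C n). \<forall>v\<in>K n. psi \<omega> v c \<in> S v}" "\<forall>v\<in>K n. S v \<in> sets A"
      "b = {c \<in> space (C n). \<forall>v\<in>K n. psi \<omega> v c \<in> S' v}" "\<forall>v\<in>K n. S' v \<in> sets A"
      by (auto simp: PS_def)
    then show "a \<inter> b \<in> PS"
      unfolding PS_def by (intro CollectI exI[of _ "\<lambda>v. S v \<inter> S' v"]) auto
  qed
  have zero_PS: "(\<integral>c. indicator P c *\<^sub>R ?g c \<partial>C n) = 0" if "P \<in> PS" for P
  proof -
    from that obtain S where P: "P = {c \<in> space (C n). \<forall>v\<in>K n. psi \<omega> v c \<in> S v}"
      and S: "\<And>v. v \<in> K n \<Longrightarrow> S v \<in> sets A" by (auto simp: PS_def)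
    have "(\<integral>c. indicator P c *\<^sub>R ?g c \<partial>C n) =
        (\<integral>c. ?g c * (\<Prod>v\<in>K n. (cnj ^^ card v) (indicator (S v) (psi \<omega> v c))) \<partial>C n)"
    proof (rule Bochner_Integration.integral_cong[OF refl])
      fix c assume c: "c \<in> space (C n)"
      \<comment> \<open>Conjugation fixes the values 0 and 1, and a product of indicators is 1
        exactly when all conditions hold.\<close>
      have "(\<Prod>v\<in>K n. (cnj ^^ card v) (indicator (S v) (psi \<omega> v c))) = (\<Prod>v\<in>K n. indicator (S v) (psi \<omega> v c))"
        by (rule prod.cong) (auto simp: cnj_pow_cases indicator_def)
      also have "\<dots> = (if c \<in> P then 1 else 0)"
        using c by (auto simp: P indicator_def prod_zero_iff)
      finally show "indicator P c *\<^sub>R ?g c =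
          ?g c * (\<Prod>v\<in>K n. (cnj ^^ card v) (indicator (S v) (psi \<omega> v c)))" by simp
    qed
    also have "\<dots> = (\<integral>x. g x * br n (\<lambda>v. indicator (S v)) x \<partial>A)"
      by (rule integral_bracket[symmetric, OF g bm_indicator[OF S]])
    also have "\<dots> = 0" by (rule zero[OF bm_indicator[OF S]])
    finally show ?thesis .
  qed
  have "(\<Union>v\<in>K n. pull \<omega> (C n) v (sets A)) \<subseteq> PS"
  proof
    fix X assume "X \<in> (\<Union>v\<in>K n. pull \<omega> (C n) v (sets A))"
    then obtain v S where v: "v \<in> K n" "S \<in> sets A" "X = psi \<omega> v -` S \<inter> space (C n)" by (auto simp: pull_def)
    have "X = {c \<in> space (C n). \<forall>w\<in>K n. psi \<omega> w c \<in> (if w = v then S else space A)}"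
      using v measurable_space[OF measurable_psi[OF Kv]] by auto
    then show "X \<in> PS" unfolding PS_def using v by (intro CollectI exI[of _ "\<lambda>w. if w = v then S else space A"]) auto
  qed
  then have sub: "JK n (sets A) \<subseteq> sigma_sets (space (C n)) PS" unfolding join_K_def by (rule sigma_sets_mono')
  have "space (C n) \<in> PS"
    unfolding PS_def using measurable_space[OF measurable_psi[OF Kv]]
    by (intro CollectI exI[of _ "\<lambda>_. space A"]) auto
  \<comment> \<open>The space itself belongs to the generating family; the complement step below
    needs its integral.\<close>
  from zero_PS[OF this] have total: "(\<integral>c. ?g c \<partial>C n) = 0"
    by (simp cong: Bochner_Integration.integral_cong)
  fix B assume "B \<in> JK n (sets A)"
  then have "B \<in> sigma_sets (space (C n)) PS" using sub by auto
  with stable PS_sub show "(\<integral>c. indicator B c *\<^sub>R ?g c \<partial>C n) = 0"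
  proof (induction rule: sigma_sets_induct_disjoint)
    case (basic P)
    then show ?case by (rule zero_PS)
  next
    case empty
    show ?case by simp
  next
    case (compl B)
    then have B: "B \<in> sets (C n)" using sC by auto
    have "(\<integral>c. indicator (space (C n) - B) c *\<^sub>R ?g c \<partial>C n) = (\<integral>c. ?g c - indicator B c *\<^sub>R ?g c \<partial>C n)"
      by (rule Bochner_Integration.integral_cong) (auto simp: indicator_def)
    also have "\<dots> = (\<integral>c. ?g c \<partial>C n) - (\<integral>c. indicator B c *\<^sub>R ?g c \<partial>C n)"
      by (rule Bochner_Integration.integral_diff[OF gi]) (use B gi in \<open>auto intro: integrable_mult_indicator\<close>)
    finally show ?case using total compl by simp
  next
    case (union B)
    then have B: "B i \<in> sets (C n)" for i using sC by auto
    have "set_integrable (C n) (\<Union>i. B i) ?g"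
      unfolding set_integrable_def using B gi by (intro integrable_mult_indicator) auto
    from lebesgue_integral_countable_add[OF B _ this] union(1)
    have "(\<integral>c. indicator (\<Union>i. B i) c *\<^sub>R ?g c \<partial>C n) = (\<Sum>i. \<integral>c. indicator (B i) c *\<^sub>R ?g c \<partial>C n)"
      by (simp add: set_lebesgue_integral_def disjoint_family_on_def)
    then show ?case using union by simp
  qed
qed

text \<open>Products of brackets are not known to be brackets, so orthogonality to them does not
  directly reach the indicators of the sets that they generate. The detour through cubes does: the
  pullback of such a set agrees almost everywhere with a member of the join, where
  \<open>perp_psi_JM\<close> applies.\<close>

lemma perp_Fk_iff:
  assumes f: "bm A f"
  shows "perp A (\<Phi> k) f \<longleftrightarrow> (\<forall>F. (\<forall>v\<in>K (k + 1). bm A (F v)) \<longrightarrow> (\<integral>x. f x * br (k + 1) F x \<partial>A) = 0)"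
proof
  interpret FM: finite_measure_subalgebra A "\<Phi> k" by (rule fms_A[OF subalgebra_Fk])
  assume "perp A (\<Phi> k) f"
  then show "\<forall>F. (\<forall>v\<in>K (k + 1). bm A (F v)) \<longrightarrow> (\<integral>x. f x * br (k + 1) F x \<partial>A) = 0"
    using FM.perp_integral[OF f _ bm_Fk_bracket] by blast
next
  assume *: "\<forall>F. (\<forall>v\<in>K (k + 1). bm A (F v)) \<longrightarrow> (\<integral>x. f x * br (k + 1) F x \<partial>A) = 0"
  let ?C = "C (k + 1)"
  have e: "{} \<in> verts (k + 1)" by (simp add: verts_def)
  have p: "perp ?C (JM (k + 1) A) (\<lambda>c. f (psi \<omega> {} c))" by (rule perp_psi_JM[OF f]) (use * in blast)
  show "perp A (\<Phi> k) f"
    unfolding perp_def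
  proof
    fix S assume S: "S \<in> sets (\<Phi> k)"
    then have SA: "S \<in> sets A" using subalgebra_Fk by (auto simp: subalgebra_def)
    obtain B where B: "B \<in> sets (JM (k + 1) A)" "AE c in ?C. psi \<omega> {} c \<in> S \<longleftrightarrow> c \<in> B"
      using Fk_psi_JM_A[OF S] by blast
    then have BC: "B \<in> sets ?C" using subalgebra_JM[OF subalgebra_A] by (auto simp: subalgebra_def)
    have bS: "bm A (\<lambda>x. indicator S x *\<^sub>R f x)"
      using bm_mult[OF bm_indicator[OF SA] f] by (rule bm_cong[THEN iffD1, rotated]) (simp add: indicator_def)
    have "(\<integral>x. indicator S x *\<^sub>R f x \<partial>A) = (\<integral>c. indicator S (psi \<omega> {} c) *\<^sub>R f (psi \<omega> {} c) \<partial>?C)"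
      by (rule integral_psi[OF bS e, symmetric])
    also have "\<dots> = (\<integral>c. indicator B c *\<^sub>R f (psi \<omega> {} c) \<partial>?C)"
    proof (rule integral_cong_AE)
      show "(\<lambda>c. indicator S (psi \<omega> {} c) *\<^sub>R f (psi \<omega> {} c)) \<in> borel_measurable ?C"
        by (rule bm_meas[OF bm_compose[OF bS measurable_psi[OF e]]])
      show "(\<lambda>c. indicator B c *\<^sub>R f (psi \<omega> {} c)) \<in> borel_measurable ?C"
        using BC bm_meas[OF bm_compose[OF f measurable_psi[OF e]]] by (intro borel_measurable_scaleR) auto
      show "AE c in ?C. indicator S (psi \<omega> {} c) *\<^sub>R f (psi \<omega> {} c) = indicator B c *\<^sub>R f (psi \<omega> {} c)"
        using B(2) by eventually_elim (auto simp: indicator_def)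
    qed
    also have "\<dots> = 0" using p B(1) by (simp add: perp_def)
    finally show "(\<integral>x. indicator S x *\<^sub>R f x \<partial>A) = 0" .
  qed
qed

text \<open>By Gowers-Cauchy-Schwarz a vanishing norm kills every inner product with
  \<open>f\<close> at some vertex. Conversely, \<open>f\<close> paired with the bracket of the
  constant family \<open>f\<close> gives the power of the norm.\<close>

lemma gn_eq_0_iff_perp:
  assumes f: "bm A f"
  shows "gn (k + 1) f = 0 \<longleftrightarrow> perp A (\<Phi> k) f"
proof
  assume z: "gn (k + 1) f = 0"
  show "perp A (\<Phi> k) f"
    unfolding perp_Fk_iff[OF f]
  proof (intro allI impI)
    fix F assume F: "\<forall>v\<in>K (k + 1). bm A (F v)"
    \<comment> \<open>The entry at the vertex 0 is free, since brackets do not look at it.\<close>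
    define H where "H = F({} := f)"
    have H: "bm A (H v)" if "v \<in> verts (k + 1)" for v
      using that F f by (auto simp: H_def K_def)
    have "br (k + 1) F = br (k + 1) H"
      unfolding bracket_def by (intro ext Bochner_Integration.integral_cong refl prod.cong) (auto simp: H_def K_def)
    then have "(\<integral>x. f x * br (k + 1) F x \<partial>A) = ip (k + 1) H"
      using ip_bracket[of "k + 1" H] H by (simp add: H_def)
    also have "\<dots> = 0"
      by (rule ip_eq_0[where w="{}", OF H]) (use z in \<open>simp_all add: verts_def H_def\<close>)
    finally show "(\<integral>x. f x * br (k + 1) F x \<partial>A) = 0" .
  qed
next
  assume "perp A (\<Phi> k) f"
  then have "(\<integral>x. f x * br (k + 1) (\<lambda>_. f) x \<partial>A) = 0" using perp_Fk_iff[OF f] f by simp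
  then have "ip (k + 1) (\<lambda>_. f) = 0" using ip_bracket[of "k + 1" "\<lambda>_. f"] f by simp
  then show "gn (k + 1) f = 0" using gn_eq[OF f, of "k + 1"] by simp
qed

subsection \<open>Brackets of projections\<close>

text \<open>Brackets are additive in each entry, including entries that are conjugated.\<close>

lemma bracket_update_diff:
  assumes H: "\<And>v. v \<in> K n \<Longrightarrow> bm A (H v)" and h: "bm A h" and w: "w \<in> K n" and x: "x \<in> space A"
  shows "br n H x - br n (H(w := h)) x = br n (H(w := \<lambda>y. H w y - h y)) x"
proof -
  have b: "bm A ((H(w := f)) v)" if "bm A f" "v \<in> K n" for f v using H that by simp
  have i: "integrable (V {..<n}) (\<lambda>t. kprod n F x t)"
    if F: "\<And>v. v \<in> K n \<Longrightarrow> bm A (F v)" for F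
    by (rule bm_integrable[OF fm_V bm_kprod[OF F x]]) simp_all
  have p: "(\<Prod>v\<in>K n. (cnj ^^ card v) ((H(w := f)) v (sh v x t))) =
      (cnj ^^ card w) (f (sh w x t)) * (\<Prod>v\<in>K n - {w}. (cnj ^^ card v) (H v (sh v x t)))" for f t
    using w by (subst prod.remove[of _ w]) (auto intro!: prod.cong)
  have d: "(cnj ^^ m) (a - b) = (cnj ^^ m) a - (cnj ^^ m) b" for m a b by (simp add: cnj_pow_cases)
  have bd: "bm A (\<lambda>y. H w y - h y)" using H[OF w] h by auto
  have e1: "br n H x = (\<integral>t. (\<Prod>v\<in>K n. (cnj ^^ card v) (H v (sh v x t))) \<partial>V {..<n})"
    by (rule bracket_eq[OF x H])
  have e2: "br n (H(w := h)) x = (\<integral>t. (\<Prod>v\<in>K n. (cnj ^^ card v) ((H(w := h)) v (sh v x t))) \<partial>V {..<n})"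
    by (rule bracket_eq[OF x b[OF h]])
  have "br n H x - br n (H(w := h)) x =
      (\<integral>t. (\<Prod>v\<in>K n. (cnj ^^ card v) ((H(w := H w)) v (sh v x t))) -
        (\<Prod>v\<in>K n. (cnj ^^ card v) ((H(w := h)) v (sh v x t))) \<partial>V {..<n})"
    unfolding e1 e2 fun_upd_triv
    by (rule Bochner_Integration.integral_diff[symmetric, OF i[of H, OF H] i[of "H(w := h)", OF b[OF h]]])
  also have "\<dots> = (\<integral>t. (\<Prod>v\<in>K n. (cnj ^^ card v) ((H(w := \<lambda>y. H w y - h y)) v (sh v x t))) \<partial>V {..<n})"
    unfolding p by (simp add: d algebra_simps)
  also have "\<dots> = br n (H(w := \<lambda>y. H w y - h y)) x"
    by (rule bracket_eq[OF x b[OF bd], symmetric])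
  finally show ?thesis .
qed

text \<open>With the conjugate of the bracket itself at the vertex 0, the inner product becomes the
  integral of the squared modulus of the bracket, and the entry of norm zero makes it
  vanish.\<close>

lemma bracket_AE_0:
  assumes F: "\<And>v. v \<in> K n \<Longrightarrow> bm A (F v)" and w: "w \<in> K n" "gn n (F w) = 0" and n: "n \<ge> 1"
  shows "AE x in A. br n F x = 0"
proof (rule bm_AE_eq_0[OF fm_A bm_bracket[OF F]])
  define H where "H = F({} := \<lambda>x. cnj (br n F x))"
  have H: "bm A (H v)" if "v \<in> verts n" for v
    using that F bm_bracket[of n F] by (auto simp: H_def K_def)
  have w0: "w \<noteq> {}" "w \<in> verts n" using w by (auto simp: K_def)
  have "br n F = br n H"
    unfolding bracket_def by (intro ext Bochner_Integration.integral_cong refl prod.cong) (auto simp: H_def K_def)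
  then have "(\<integral>x. br n F x * cnj (br n F x) \<partial>A) = ip n H"
    using ip_bracket[of n H] H by (simp add: H_def mult.commute)
  also have "\<dots> = 0"
    by (rule ip_eq_0[OF H n w0(2)]) (use w w0 in \<open>simp_all add: H_def\<close>)
  finally show "(\<integral>x. br n F x * cnj (br n F x) \<partial>A) = 0" .
qed

text \<open>A function minus its projection is orthogonal to \<open>\<Phi> k\<close>, hence has norm
  zero, and a bracket with such an entry vanishes almost everywhere. Additivity then allows the
  entries to be exchanged one at a time.\<close>

lemma bracket_projection:
  assumes F: "\<And>v. v \<in> K (k + 1) \<Longrightarrow> bm A (F v)"
  shows "\<exists>F'. (\<forall>v\<in>K (k + 1). bm (\<Phi> k) (F' v)) \<and> (AE x in A. br (k + 1) F x = br (k + 1) F' x)"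
proof -
  let ?n = "k + 1"
  have "\<forall>v\<in>K ?n. \<exists>E. bm (\<Phi> k) E \<and> perp A (\<Phi> k) (\<lambda>x. F v x - E x)"
    using finite_measure_subalgebra.ex_projection[OF fms_A[OF subalgebra_Fk] F] by blast
  from bchoice[OF this] obtain F' where
    "\<forall>v\<in>K ?n. bm (\<Phi> k) (F' v) \<and> perp A (\<Phi> k) (\<lambda>x. F v x - F' v x)" by (elim exE)
  then have F': "\<And>v. v \<in> K ?n \<Longrightarrow> bm (\<Phi> k) (F' v)"
    "\<And>v. v \<in> K ?n \<Longrightarrow> perp A (\<Phi> k) (\<lambda>x. F v x - F' v x)" by auto
  have F'A: "bm A (F' v)" if "v \<in> K ?n" for v by (rule bm_subalg[OF subalgebra_Fk F'(1)[OF that]])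
  \<comment> \<open>\<open>W\<close> collects the vertices whose entries have been replaced so
    far.\<close>
  define H where "H W v = (if v \<in> W then F' v else F v)" for W v
  have H: "bm A (H W v)" if "v \<in> K ?n" for W v using that F F'A by (simp add: H_def)
  have "AE x in A. br ?n F x = br ?n (H W) x" if "finite W" "W \<subseteq> K ?n" for W
    using that
  proof (induction W rule: finite_induct)
    case empty
    have "H {} = F" by (rule ext) (simp add: H_def)
    then show ?case by simp
  next
    case (insert w W)
    then have w: "w \<in> K ?n" by simp
    have eq: "H (insert w W) = (H W)(w := F' w)" by (rule ext) (simp add: H_def)
    have d: "AE x in A. br ?n ((H W)(w := \<lambda>y. H W w y - F' w y)) x = 0"
    proof (rule bracket_AE_0[OF _ w])
      have bd: "bm A (\<lambda>y. H W w y - F' w y)" using H[OF w] F'A[OF w] by auto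
      then show "bm A (((H W)(w := \<lambda>y. H W w y - F' w y)) v)" if "v \<in> K ?n" for v
        using H[OF that] by simp
      have "perp A (\<Phi> k) (\<lambda>y. H W w y - F' w y)" using F'(2)[OF w] insert by (simp add: H_def)
      then show "gn ?n (((H W)(w := \<lambda>y. H W w y - F' w y)) w) = 0"
        using gn_eq_0_iff_perp[OF bd] by simp
    qed simp
    have "AE x in A. br ?n F x = br ?n (H W) x" using insert by simp
    then show ?case
      using d AE_space
    proof eventually_elim
      case (elim x)
      then show ?case
        using bracket_update_diff[of ?n "H W" "F' w" w x, OF H F'A[OF w] w] unfolding eq
        by (metis eq_iff_diff_eq_0)
    qed
  qed
  from this[of "K ?n"] have "AE x in A. br ?n F x = br ?n (H (K ?n)) x" by simp
  moreover have "\<forall>v\<in>K ?n. bm (\<Phi> k) (H (K ?n) v)" using F'(1) by (simp add: H_def)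
  ultimately show ?thesis by blast
qed

text \<open>Projecting the entries changes a bracket only on a null set of the group; since the
  vertex 0 of a random cube has the distribution of a random point, the change is also null on
  cubes.\<close>

lemma Fk_psi_JM_Fk:
  assumes "S \<in> sets (\<Phi> k)"
  shows "\<exists>B\<in>sets (JM (k + 1) (\<Phi> k)). AE c in C (k + 1). psi \<omega> {} c \<in> S \<longleftrightarrow> c \<in> B"
proof (rule Fk_psi_measurable[OF subalgebra_JM[OF subalgebra_Fk] _ assms])
  fix F :: "nat set \<Rightarrow> 'a upoint \<Rightarrow> complex"
  assume F: "\<And>v. v \<in> K (k + 1) \<Longrightarrow> bm A (F v)"
  have "\<exists>F'. (\<forall>v\<in>K (k + 1). bm (\<Phi> k) (F' v)) \<and> (AE x in A. br (k + 1) F x = br (k + 1) F' x)"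
    by (rule bracket_projection) (rule F)
  then obtain F' where F'_all: "\<forall>v\<in>K (k + 1). bm (\<Phi> k) (F' v)" and F'_eq: "AE x in A. br (k + 1) F x = br (k + 1) F' x"
    by (elim exE conjE)
  have "\<exists>E. bm (JM (k + 1) (\<Phi> k)) E \<and> (AE c in C (k + 1). br (k + 1) F' (psi \<omega> {} c) = E c)"
    by (rule bracket_psi_measurable[OF subalgebra_Fk measurable_translate_Fk]) (use F'_all in auto)
  then obtain E where E: "bm (JM (k + 1) (\<Phi> k)) E" "AE c in C (k + 1). br (k + 1) F' (psi \<omega> {} c) = E c"
    by (elim exE conjE)
  have "AE c in C (k + 1). br (k + 1) F (psi \<omega> {} c) = br (k + 1) F' (psi \<omega> {} c)"
    by (rule AE_psi[OF F'_eq]) (simp add: verts_def)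
  with E(2) have "AE c in C (k + 1). br (k + 1) F (psi \<omega> {} c) = E c" by eventually_elim simp
  with E(1) show "\<exists>E. bm (JM (k + 1) (\<Phi> k)) E \<and> (AE c in C (k + 1). br (k + 1) F (psi \<omega> {} c) = E c)" by blast
qed

text \<open>Let \<open>g\<close> be the indicator of \<open>S\<close> minus its projection to
  \<open>\<Phi> k\<close>. On cubes, \<open>g\<close> at the vertex 0 is orthogonal to the join,
  while the indicator at that vertex agrees almost everywhere with that of \<open>B\<close>. So
  \<open>g\<close> is orthogonal to the indicator as well as to its projection, hence to
  itself.\<close>

lemma Fk_if_psi_JM_A:
  assumes S: "S \<in> sets A" and B: "B \<in> sets (JM (k + 1) A)"
    and SB: "AE c in C (k + 1). psi \<omega> {} c \<in> S \<longleftrightarrow> c \<in> B"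
  shows "\<exists>S'\<in>sets (\<Phi> k). AE x in A. x \<in> S \<longleftrightarrow> x \<in> S'"
proof -
  let ?C = "C (k + 1)"
  interpret FM: finite_measure_subalgebra A "\<Phi> k" by (rule fms_A[OF subalgebra_Fk])
  let ?f = "indicator S :: 'a upoint \<Rightarrow> complex"
  have e: "{} \<in> verts (k + 1)" by (simp add: verts_def)
  have f: "bm A ?f" by (rule bm_indicator[OF S])
  have BC: "B \<in> sets ?C" using B subalgebra_JM[OF subalgebra_A] by (auto simp: subalgebra_def)
  obtain E where E: "bm (\<Phi> k) E" "perp A (\<Phi> k) (\<lambda>x. ?f x - E x)" using FM.ex_projection[OF f] by blast
  have EA: "bm A E" by (rule bm_subalg[OF subalgebra_Fk E(1)])
  define g where "g x = ?f x - E x" for x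
  have g: "bm A g" unfolding g_def using f EA by auto
  have pg: "perp A (\<Phi> k) g" unfolding g_def by (rule E(2))
  have "perp ?C (JM (k + 1) A) (\<lambda>c. g (psi \<omega> {} c))"
    by (rule perp_psi_JM[OF g]) (use pg perp_Fk_iff[OF g] in blast)
  with B have z: "(\<integral>c. indicator B c *\<^sub>R g (psi \<omega> {} c) \<partial>?C) = 0" by (simp add: perp_def)
  have "(\<integral>x. g x * ?f x \<partial>A) = (\<integral>c. g (psi \<omega> {} c) * ?f (psi \<omega> {} c) \<partial>?C)"
    by (rule integral_psi[OF bm_mult[OF g f] e, symmetric])
  also have "\<dots> = (\<integral>c. indicator B c *\<^sub>R g (psi \<omega> {} c) \<partial>?C)"
  proof (rule integral_cong_AE)
    show "(\<lambda>c. g (psi \<omega> {} c) * ?f (psi \<omega> {} c)) \<in> borel_measurable ?C"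
      by (rule bm_meas[OF bm_compose[OF bm_mult[OF g f] measurable_psi[OF e]]])
    show "(\<lambda>c. indicator B c *\<^sub>R g (psi \<omega> {} c)) \<in> borel_measurable ?C"
      using BC bm_meas[OF bm_compose[OF g measurable_psi[OF e]]] by (intro borel_measurable_scaleR) auto
    show "AE c in ?C. g (psi \<omega> {} c) * ?f (psi \<omega> {} c) = indicator B c *\<^sub>R g (psi \<omega> {} c)"
      using SB by eventually_elim (auto simp: indicator_def)
  qed
  finally have gf: "(\<integral>x. g x * ?f x \<partial>A) = 0" using z by simp
  \<comment> \<open>The indicator is real, so the conjugate of \<open>g\<close> is the indicator
    minus the conjugate of \<open>E\<close>.\<close>
  have "(\<integral>x. g x * cnj (g x) \<partial>A) = (\<integral>x. g x * ?f x - g x * cnj (E x) \<partial>A)"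
    by (rule Bochner_Integration.integral_cong) (auto simp: g_def indicator_def algebra_simps)
  also have "\<dots> = (\<integral>x. g x * ?f x \<partial>A) - (\<integral>x. g x * cnj (E x) \<partial>A)"
    using g f EA by (intro Bochner_Integration.integral_diff bm_integrable[OF fm_A]) auto
  also have "\<dots> = 0" using gf FM.perp_integral[OF g pg bm_cnj[OF E(1)]] by simp
  finally have "AE x in A. g x = 0" by (rule bm_AE_eq_0[OF fm_A g])
  \<comment> \<open>The projection equals the indicator almost everywhere, so its level set at 1
    recovers \<open>S\<close> up to a null set.\<close>
  then have "AE x in A. x \<in> S \<longleftrightarrow> x \<in> E -` {1} \<inter> space (\<Phi> k)"
    using AE_space by eventually_elim (auto simp: g_def indicator_def space_Fk split: if_splits)
  moreover have "E -` {1} \<inter> space (\<Phi> k) \<in> sets (\<Phi> k)"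
    by (rule measurable_sets[OF bm_meas[OF E(1)]]) simp
  ultimately show ?thesis by blast
qed

subsection \<open>The trivial case and monotonicity in \<open>k\<close>\<close>

text \<open>The last direction is integrated on the outside, which exposes what happens when it is
  the only one and when no function depends on it.\<close>

lemma bracket_Suc:
  assumes F: "\<And>v. v \<in> K (Suc n) \<Longrightarrow> bm A (F v)" and x: "x \<in> space A"
  shows "br (Suc n) F x = (\<integral>s. (\<integral>t. (\<Prod>v\<in>K (Suc n). (cnj ^^ card v)
    (F v (if n \<in> v then sh (v - {n}) (add x s) t else sh v x t))) \<partial>V {..<n}) \<partial>A)"
proof -
  let ?H = "\<lambda>t. \<Prod>v\<in>K (Suc n). (cnj ^^ card v) (F v (sh v x t))"
  have H: "bm (V (insert n {..<n})) ?H"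
    using bm_kprod[of "Suc n" F, OF F x] by (simp add: lessThan_Suc)
  have "br (Suc n) F x = (\<integral>t. ?H t \<partial>V (insert n {..<n}))"
    using bracket_eq[OF x F] by (simp add: lessThan_Suc)
  also have "\<dots> = (\<integral>s. (\<integral>t. ?H (upd n s t) \<partial>V {..<n}) \<partial>A)"
    by (rule upd_split(1)[OF _ H]) simp
  also have "\<dots> = (\<integral>s. (\<integral>t. (\<Prod>v\<in>K (Suc n). (cnj ^^ card v)
      (F v (if n \<in> v then sh (v - {n}) (add x s) t else sh v x t))) \<partial>V {..<n}) \<partial>A)"
  proof (intro Bochner_Integration.integral_cong refl prod.cong)
    fix s t v assume s: "s \<in> space A" and t: "t \<in> space (V {..<n})" and v: "v \<in> K (Suc n)"
    have "v \<subseteq> insert n {..<n}" using v by (auto simp: K_def verts_def lessThan_Suc)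
    then show "(cnj ^^ card v) (F v (sh v x (upd n s t))) =
        (cnj ^^ card v) (F v (if n \<in> v then sh (v - {n}) (add x s) t else sh v x t))"
      using sh_upd[OF x s t] by simp
  qed
  finally show ?thesis .
qed

text \<open>The only nonzero vertex is uniformly distributed whatever the base point, so the bracket
  is an integral over the whole group.\<close>

lemma bracket_1_const:
  assumes F: "\<And>v. v \<in> K 1 \<Longrightarrow> bm A (F v)" and x: "x \<in> space A"
  shows "br 1 F x = (\<integral>y. cnj (F {0} y) \<partial>A)"
proof -
  interpret P: prob_space "V {..<0::nat}" by (rule prob_space_L[OF us_V]) simp
  have K1: "K (Suc 0) = {{0}}" by (auto simp: K_def verts_def lessThan_Suc)
  have F0: "bm A (\<lambda>y. cnj (F {0} y))" using F[of "{0}"] K1 by auto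
  have "br 1 F x = (\<integral>s. (\<integral>t. cnj (F {0} (sh {} (add x s) t)) \<partial>V {..<0::nat}) \<partial>A)"
    using bracket_Suc[of 0 F x] F x by (simp add: K1)
  also have "\<dots> = (\<integral>s. (\<integral>t. cnj (F {0} (add x s)) \<partial>V {..<0::nat}) \<partial>A)"
    using x by (intro Bochner_Integration.integral_cong refl) (simp add: sh_empty add_closed)
  also have "\<dots> = (\<integral>s. cnj (F {0} (add x s)) \<partial>A)" using P.prob_space by simp
  also have "\<dots> = (\<integral>y. cnj (F {0} y) \<partial>A)" by (rule integral_add(2)[OF x F0])
  finally show ?thesis .
qed

lemma sets_Fk_0: "sets (\<Phi> 0) = {{}, space A}"
proof -
  have "S \<in> {{}, space A}" if "S \<in> sets (\<Phi> 0)" for S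
    using that unfolding sets_Fk
  proof (induction rule: sigma_sets.induct)
    case (Basic S)
    then obtain F B where S: "S = br 1 F -` B \<inter> space A" and F: "\<And>v. v \<in> K 1 \<Longrightarrow> bm A (F v)" by auto
    \<comment> \<open>A preimage under a constant function is empty or the whole space.\<close>
    show ?case using bracket_1_const[OF F] by (auto simp: S)
  next
    case (Union S)
    then show ?case by (cases "\<exists>i. S i = space A") auto
  qed auto
  moreover have "{} \<in> sets (\<Phi> 0)" "space A \<in> sets (\<Phi> 0)"
    using sets.top[of "\<Phi> 0"] by (auto simp: space_Fk)
  ultimately show ?thesis by blast
qed

text \<open>The constant 1 removes the factors at all vertices using the new direction
  \<open>n\<close>. Nothing else depends on this direction, and it integrates out with total mass
  1.\<close>

lemma bracket_extend:
  assumes F: "\<And>v. v \<in> K n \<Longrightarrow> bm A (F v)" and x: "x \<in> space A"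
  shows "br (Suc n) (\<lambda>v. if v \<subseteq> {..<n} then F v else (\<lambda>_. 1)) x = br n F x"
proof -
  interpret PA: prob_space A by (rule prob_space_L[OF us_A])
  let ?F = "\<lambda>v. if v \<subseteq> {..<n} then F v else (\<lambda>_. 1)"
  have F': "bm A (?F v)" if "v \<in> K (Suc n)" for v
    using that F by (auto simp: K_def verts_def)
  have KK: "K n \<subseteq> K (Suc n)" by (auto simp: K_def verts_def)
  have p: "(\<Prod>v\<in>K (Suc n). (cnj ^^ card v) (?F v (if n \<in> v then sh (v - {n}) (add x s) t else sh v x t))) =
      kprod n F x t" for s t
  proof -
    have "(\<Prod>v\<in>K (Suc n). (cnj ^^ card v) (?F v (if n \<in> v then sh (v - {n}) (add x s) t else sh v x t))) =
      (\<Prod>v\<in>K n. (cnj ^^ card v) (?F v (if n \<in> v then sh (v - {n}) (add x s) t else sh v x t)))"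
    proof (rule prod.mono_neutral_right[OF _ KK], simp, rule ballI)
      fix v assume "v \<in> K (Suc n) - K n"
      then have "\<not> v \<subseteq> {..<n}" by (auto simp: K_def verts_def)
      then show "(cnj ^^ card v) (?F v (if n \<in> v then sh (v - {n}) (add x s) t else sh v x t)) = 1"
        by (simp add: cnj_pow_cases)
    qed
    also have "\<dots> = kprod n F x t"
    proof (rule prod.cong[OF refl])
      fix v assume "v \<in> K n"
      then have "v \<subseteq> {..<n}" "n \<notin> v" by (auto simp: K_def verts_def)
      then show "(cnj ^^ card v) (?F v (if n \<in> v then sh (v - {n}) (add x s) t else sh v x t)) =
          (cnj ^^ card v) (F v (sh v x t))" by simp
    qed
    finally show ?thesis .
  qed
  have "br (Suc n) ?F x = (\<integral>s. (\<integral>t. kprod n F x t \<partial>V {..<n}) \<partial>A)"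
    by (rule trans[OF bracket_Suc[of n ?F, OF F' x]]) (simp_all only: p)
  also have "\<dots> = br n F x"
    using bracket_eq[OF x, of n F] F PA.prob_space by simp
  finally show ?thesis .
qed

lemma sets_Fk_mono: "sets (\<Phi> k) \<subseteq> sets (\<Phi> (Suc k))"
  unfolding sets_Fk[of k]
proof -
  have "gens k \<subseteq> sets (\<Phi> (Suc k))"
  proof
    fix S assume "S \<in> gens k"
    then obtain F B where S: "S = br (k + 1) F -` B \<inter> space A" and F: "\<And>v. v \<in> K (k + 1) \<Longrightarrow> bm A (F v)"
      and B: "B \<in> sets borel" by blast
    let ?F = "\<lambda>v. if v \<subseteq> {..<k + 1} then F v else (\<lambda>_. 1)"
    have F': "bm A (?F v)" if "v \<in> K (Suc k + 1)" for v
      using that F by (auto simp: K_def verts_def)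
    have "S = br (Suc k + 1) ?F -` B \<inter> space (\<Phi> (Suc k))"
      using bracket_extend[of "k + 1" F, OF F] by (auto simp: S space_Fk)
    also have "\<dots> \<in> sets (\<Phi> (Suc k))"
      by (rule measurable_sets[OF bm_meas[OF bm_Fk_bracket] B]) (rule F')
    finally show "S \<in> sets (\<Phi> (Suc k))" .
  qed
  from sets.sigma_sets_subset[OF this]
  show "sigma_sets (space A) (gens k) \<subseteq> sets (\<Phi> (Suc k))"
    by (simp add: space_Fk)
qed

text \<open>Both wedge identities are instances, with \<open>N = A\<close> and with
  \<open>N = \<Phi> k\<close>. The assumption \<open>sub\<close> gives one inclusion. For the other,
  the join of \<open>N\<close> lies in the join of \<open>A\<close>, so
  \<open>Fk_if_psi_JM_A\<close> covers both instances.\<close>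

lemma eq_mod_null_wedge:
  assumes N: "subalgebra A N"
    and sub: "\<And>S. S \<in> sets (\<Phi> k) \<Longrightarrow>
      \<exists>B\<in>sets (JM (k + 1) N). AE c in C (k + 1). psi \<omega> {} c \<in> S \<longleftrightarrow> c \<in> B"
  shows "eq_mod_null (C (k + 1)) (pull \<omega> (C (k + 1)) {} (sets (\<Phi> k)))
    (wedge (C (k + 1)) (pull \<omega> (C (k + 1)) {} (sets A)) (JK (k + 1) (sets N)))"
  unfolding eq_mod_null_def
proof (intro conjI ballI)
  let ?C = "C (k + 1)"
  have e: "{} \<in> verts (k + 1)" by (simp add: verts_def)
  have JN: "B \<in> sets ?C" if "B \<in> sets (JM (k + 1) N)" for B
    using subalgebra_JM[OF N] that by (auto simp: subalgebra_def)
  have pm: "psi \<omega> {} -` S \<inter> space ?C \<in> sets ?C" if "S \<in> sets A" for S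
    by (rule measurable_sets[OF measurable_psi[OF e] that])
  have FA: "S \<in> sets A" if "S \<in> sets (\<Phi> k)" for S using subalgebra_Fk that by (auto simp: subalgebra_def)
  show "\<exists>S'\<in>wedge ?C (pull \<omega> ?C {} (sets A)) (JK (k + 1) (sets N)). sym_diff X S' \<in> null_sets ?C"
    if "X \<in> pull \<omega> ?C {} (sets (\<Phi> k))" for X
  proof -
    obtain S where S: "S \<in> sets (\<Phi> k)" "X = psi \<omega> {} -` S \<inter> space ?C" using \<open>X \<in> _\<close> by (auto simp: pull_def)
    obtain B where B: "B \<in> sets (JM (k + 1) N)" "AE c in ?C. psi \<omega> {} c \<in> S \<longleftrightarrow> c \<in> B" using sub[OF S(1)] by blast
    have "AE c in ?C. c \<in> X \<longleftrightarrow> c \<in> B" using B(2) AE_space by eventually_elim (auto simp: S)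
    then have null: "sym_diff X B \<in> null_sets ?C"
      using sym_diff_null_iff[of X ?C B] pm[OF FA[OF S(1)]] JN[OF B(1)] by (simp add: S)
    have Xp: "X \<in> pull \<omega> ?C {} (sets A)" using S FA by (auto simp: pull_def)
    have Xs: "X \<subseteq> space ?C" by (auto simp: S)
    have "X \<in> mod_null ?C (pull \<omega> ?C {} (sets A))"
      unfolding mod_null_def using Xs Xp by (intro CollectI conjI bexI[of _ X]) auto
    moreover have "X \<in> mod_null ?C (JK (k + 1) (sets N))"
      unfolding mod_null_def sets_JM[symmetric] using Xs null B(1) by (intro CollectI conjI bexI[of _ B])
    ultimately have "X \<in> wedge ?C (pull \<omega> ?C {} (sets A)) (JK (k + 1) (sets N))" by (simp add: wedge_def)
    then show ?thesis by (intro bexI[of _ X]) auto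
  qed
  show "\<exists>X\<in>pull \<omega> ?C {} (sets (\<Phi> k)). sym_diff X Y \<in> null_sets ?C"
    if "Y \<in> wedge ?C (pull \<omega> ?C {} (sets A)) (JK (k + 1) (sets N))" for Y
  proof -
    obtain S B where S: "S \<in> sets A" "sym_diff Y (psi \<omega> {} -` S \<inter> space ?C) \<in> null_sets ?C"
      and B: "B \<in> JK (k + 1) (sets N)" "sym_diff Y B \<in> null_sets ?C"
      using \<open>Y \<in> _\<close> by (auto simp: wedge_def mod_null_def pull_def)
    let ?X = "psi \<omega> {} -` S \<inter> space ?C"
    have sd: "sym_diff X Z \<in> sets ?C" if "X \<in> sets ?C" "Z \<in> sets ?C" for X Z using that by auto
    \<comment> \<open>Measurability of \<open>Y\<close> is not part of \<open>mod_null\<close>. It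
      holds because members of \<open>null_sets\<close> are measurable and \<open>Y\<close> is
      recovered from its difference to a measurable set.\<close>
    have "Y = sym_diff (sym_diff Y ?X) ?X" by auto
    also have "\<dots> \<in> sets ?C" by (rule sd[OF null_setsD2[OF S(2)] pm[OF S(1)]])
    finally have Y: "Y \<in> sets ?C" .
    have "sets N \<subseteq> sets A" using N by (simp add: subalgebra_def)
    then have "JK (k + 1) (sets N) \<subseteq> JK (k + 1) (sets A)"
      unfolding join_K_def by (intro sigma_sets_mono') (auto simp: pull_def)
    then have BA: "B \<in> sets (JM (k + 1) A)" using B(1) by (auto simp: sets_JM)
    have BC: "B \<in> sets ?C" using B(1) JN by (simp add: sets_JM)
    have 1: "AE c in ?C. c \<in> Y \<longleftrightarrow> c \<in> ?X" using sym_diff_null_iff[OF Y pm[OF S(1)]] S(2) by simp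
    have 2: "AE c in ?C. c \<in> Y \<longleftrightarrow> c \<in> B" using sym_diff_null_iff[OF Y BC] B(2) by simp
    have "AE c in ?C. psi \<omega> {} c \<in> S \<longleftrightarrow> c \<in> B" using 1 2 AE_space by eventually_elim auto
    from Fk_if_psi_JM_A[OF S(1) BA this]
    obtain S' where S': "S' \<in> sets (\<Phi> k)" "AE x in A. x \<in> S \<longleftrightarrow> x \<in> S'" by blast
    let ?X' = "psi \<omega> {} -` S' \<inter> space ?C"
    have "AE c in ?C. c \<in> ?X' \<longleftrightarrow> c \<in> Y"
      using 1 AE_psi[OF S'(2) e] AE_space by eventually_elim auto
    then have "sym_diff ?X' Y \<in> null_sets ?C"
      using sym_diff_null_iff[OF pm[OF FA[OF S'(1)]] Y] by simp
    moreover have "?X' \<in> pull \<omega> ?C {} (sets (\<Phi> k))" using S'(1) by (auto simp: pull_def)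
    ultimately show ?thesis by blast
  qed
qed

section \<open>Passage to essentially bounded functions\<close>

lemma L_inftyE:
  assumes "subalgebra A N" "f \<in> L_infty A N"
  obtains f' where "bm N f'" "AE x in A. f x = f' x"
proof -
  obtain c where f: "f \<in> borel_measurable N" "AE x in A. cmod (f x) \<le> c"
    using assms(2) by (auto simp: L_infty_def)
  define f' where "f' x = (if cmod (f x) \<le> c then f x else 0)" for x
  show thesis
  proof (rule that)
    show "bm N f'"
    proof (rule bmI)
      show "f' \<in> borel_measurable N" using f(1) unfolding f'_def[abs_def] by measurable
      \<comment> \<open>The essential bound \<open>c\<close> is not assumed to be nonnegative; if it
        is negative, \<open>f'\<close> is zero.\<close>
      show "cmod (f' x) \<le> max c 0" for x by (auto simp: f'_def)
    qed
    show "AE x in A. f x = f' x" using f(2) by eventually_elim (simp add: f'_def)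
  qed
qed

lemma L_infty_meas: "subalgebra A N \<Longrightarrow> f \<in> L_infty A N \<Longrightarrow> f \<in> borel_measurable A"
  by (auto simp: L_infty_def intro: measurable_from_subalg)

text \<open>Changes on null sets affect neither the norm nor, up to null sets, the conditional
  expectation, so a bounded representative may be used.\<close>

lemma gn_eq_0_iff_cond_exp:
  assumes f: "f \<in> L_infty A A"
  shows "gn (k + 1) f = 0 \<longleftrightarrow> (AE x in A. complex_cond_exp A (\<Phi> k) f x = 0)"
proof -
  interpret FM: finite_measure_subalgebra A "\<Phi> k" by (rule fms_A[OF subalgebra_Fk])
  obtain f' where f': "bm A f'" "AE x in A. f x = f' x" by (rule L_inftyE[OF subalgebra_A f])
  have m: "f \<in> borel_measurable A" "f' \<in> borel_measurable A"
    using L_infty_meas[OF subalgebra_A f] bm_meas[OF f'(1)] by auto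
  have "AE x in A. real_cond_exp A (\<Phi> k) (\<lambda>y. Re (f y)) x = real_cond_exp A (\<Phi> k) (\<lambda>y. Re (f' y)) x"
    by (rule FM.real_cond_exp_cong) (use f'(2) m in auto)
  moreover have "AE x in A. real_cond_exp A (\<Phi> k) (\<lambda>y. Im (f y)) x = real_cond_exp A (\<Phi> k) (\<lambda>y. Im (f' y)) x"
    by (rule FM.real_cond_exp_cong) (use f'(2) m in auto)
  ultimately have "AE x in A. complex_cond_exp A (\<Phi> k) f x = complex_cond_exp A (\<Phi> k) f' x"
    by eventually_elim (simp add: complex_cond_exp_def)
  then have "(AE x in A. complex_cond_exp A (\<Phi> k) f x = 0) \<longleftrightarrow> (AE x in A. complex_cond_exp A (\<Phi> k) f' x = 0)"
    by (auto elim: AE_mp)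
  also have "\<dots> \<longleftrightarrow> perp A (\<Phi> k) f'" by (rule FM.perp_iff[OF f'(1), symmetric])
  also have "\<dots> \<longleftrightarrow> gn (k + 1) f' = 0" by (rule gn_eq_0_iff_perp[OF f'(1), symmetric])
  also have "gn (k + 1) f' = gn (k + 1) f" by (rule gn_cong_AE[OF m(2,1)]) (use f'(2) in auto)
  finally show ?thesis by simp
qed

lemma norm_on_L_infty_Fk: "norm_on_L_infty A (\<Phi> k) (gn (k + 1))"
  unfolding norm_on_L_infty_def
proof (intro conjI ballI allI)
  interpret FM: finite_measure_subalgebra A "\<Phi> k" by (rule fms_A[OF subalgebra_Fk])
  let ?N = "\<Phi> k"
  have n: "k + 1 \<ge> 1" by simp
  fix f assume f: "f \<in> L_infty A ?N"
  obtain f' where f': "bm ?N f'" "AE x in A. f x = f' x" by (rule L_inftyE[OF subalgebra_Fk f])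
  have bf: "bm A f'" by (rule bm_subalg[OF subalgebra_Fk f'(1)])
  have m: "f \<in> borel_measurable A" "f' \<in> borel_measurable A"
    using L_infty_meas[OF subalgebra_Fk f] bm_meas[OF bf] by auto
  have gf: "gn (k + 1) f = gn (k + 1) f'" by (rule gn_cong_AE[OF m f'(2)])
  show "0 \<le> gn (k + 1) f" unfolding gf by (rule gn_power(2)[OF bf n])
  \<comment> \<open>The representative is itself measurable for \<open>\<Phi> k\<close>, so
    orthogonality to \<open>\<Phi> k\<close> makes it pair to zero with its own conjugate.\<close>
  have "perp A ?N f' \<longleftrightarrow> (AE x in A. f' x = 0)"
  proof
    assume "perp A ?N f'"
    then have "(\<integral>x. f' x * cnj (f' x) \<partial>A) = 0" by (rule FM.perp_integral[OF bf _ bm_cnj[OF f'(1)]])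
    then show "AE x in A. f' x = 0" by (rule bm_AE_eq_0[OF fm_A bf])
  next
    assume z: "AE x in A. f' x = 0"
    have "(\<integral>x. indicator S x *\<^sub>R f' x \<partial>A) = (\<integral>x. 0 \<partial>A)" for S
    proof -
      have "AE x in A. indicator S x *\<^sub>R f' x = 0" using z by eventually_elim simp
      then show ?thesis by (simp add: integral_eq_zero_AE)
    qed
    then show "perp A ?N f'" by (simp add: perp_def)
  qed
  also have "\<dots> \<longleftrightarrow> (AE x in A. f x = 0)" using f'(2) by (auto elim: AE_mp)
  finally show "gn (k + 1) f = 0 \<longleftrightarrow> (AE x in A. f x = 0)"
    unfolding gf using gn_eq_0_iff_perp[OF bf] by simp
  show "gn (k + 1) (\<lambda>x. a * f x) = cmod a * gn (k + 1) f" for a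
  proof -
    have "gn (k + 1) (\<lambda>x. a * f x) = gn (k + 1) (\<lambda>x. a * f' x)"
      by (rule gn_cong_AE) (use m f'(2) in auto)
    then show ?thesis by (simp only: gn_scale[OF bf n] gf)
  qed
  fix g assume g: "g \<in> L_infty A ?N"
  obtain g' where g': "bm ?N g'" "AE x in A. g x = g' x" by (rule L_inftyE[OF subalgebra_Fk g])
  have bg: "bm A g'" by (rule bm_subalg[OF subalgebra_Fk g'(1)])
  have mg: "g \<in> borel_measurable A" "g' \<in> borel_measurable A"
    using L_infty_meas[OF subalgebra_Fk g] bm_meas[OF bg] by auto
  have gg: "gn (k + 1) g = gn (k + 1) g'" by (rule gn_cong_AE[OF mg g'(2)])
  have "AE x in A. f x + g x = f' x + g' x" using f'(2) g'(2) by eventually_elim simp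
  then have "gn (k + 1) (\<lambda>x. f x + g x) = gn (k + 1) (\<lambda>x. f' x + g' x)"
    by (intro gn_cong_AE) (use m mg in auto)
  then show "gn (k + 1) (\<lambda>x. f x + g x) \<le> gn (k + 1) f + gn (k + 1) g"
    using gn_triangle[OF bf bg n] by (simp only: gf gg)
qed

end

theorem mainTheorem10:
  fixes \<omega> :: "nat filter"
    and G :: "nat \<Rightarrow> 'a monoid"
    and T :: "nat \<Rightarrow> 'a topology"
    and \<mu> :: "nat \<Rightarrow> 'a measure"
    and k :: nat
  assumes "nonprincipal_ultrafilter \<omega>"
    and "\<And>i. compact_abelian_group (G i) (T i)"
    and "\<And>i. haar_prob (G i) (T i) (\<mu> i)"
    and "\<And>n. eventually (\<lambda>i. infinite (carrier (G i)) \<or> card (carrier (G i)) > n) \<omega>"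
  shows
    "eq_mod_null (Cube \<omega> G T \<mu> (k + 1))
       (pull \<omega> (Cube \<omega> G T \<mu> (k + 1)) {} (sets (Fk \<omega> G T \<mu> k)))
       (wedge (Cube \<omega> G T \<mu> (k + 1))
          (pull \<omega> (Cube \<omega> G T \<mu> (k + 1)) {} (sets (UA \<omega> T \<mu>)))
          (join_K \<omega> (Cube \<omega> G T \<mu> (k + 1)) (k + 1) (sets (UA \<omega> T \<mu>))))
     \<and> (\<forall>f \<in> L_infty (UA \<omega> T \<mu>) (UA \<omega> T \<mu>).
          gowers_norm \<omega> G T \<mu> (k + 1) f = 0 \<longleftrightarrow>
          (AE x in UA \<omega> T \<mu>. complex_cond_exp (UA \<omega> T \<mu>) (Fk \<omega> G T \<mu> k) f x = 0))
     \<and> norm_on_L_infty (UA \<omega> T \<mu>) (Fk \<omega> G T \<mu> k) (gowers_norm \<omega> G T \<mu> (k + 1))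
     \<and> shift_invariant \<omega> G (sets (Fk \<omega> G T \<mu> k))
     \<and> eq_mod_null (Cube \<omega> G T \<mu> (k + 1))
         (pull \<omega> (Cube \<omega> G T \<mu> (k + 1)) {} (sets (Fk \<omega> G T \<mu> k)))
         (wedge (Cube \<omega> G T \<mu> (k + 1))
            (pull \<omega> (Cube \<omega> G T \<mu> (k + 1)) {} (sets (UA \<omega> T \<mu>)))
            (join_K \<omega> (Cube \<omega> G T \<mu> (k + 1)) (k + 1) (sets (Fk \<omega> G T \<mu> k))))
     \<and> sets (Fk \<omega> G T \<mu> 0) = {{}, space (UA \<omega> T \<mu>)}
     \<and> (\<forall>j. sets (Fk \<omega> G T \<mu> j) \<subseteq> sets (Fk \<omega> G T \<mu> (Suc j)))"
proof -
  interpret ultra_haar \<omega> G T \<mu>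
    by (unfold_locales) (use assms in \<open>auto simp: haar_group_def\<close>)
  show ?thesis
    unfolding UA_def Cube_def
    using eq_mod_null_wedge[OF subalgebra_A Fk_psi_JM_A] gn_eq_0_iff_cond_exp norm_on_L_infty_Fk
      shift_invariant_Fk eq_mod_null_wedge[OF subalgebra_Fk Fk_psi_JM_Fk] sets_Fk_0 sets_Fk_mono
    by (intro conjI ballI allI)
qed

end
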